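(* Let $\omega=e-2$ and let $\Sigma_\omega\subset\mathbb R$ be the spectrum of the Almost Mathieu operator with coupling $b=2$ and frequency $\omega$. Then 12 bounded spectral gaps, namely those with labels $\pm1,\pm2,\pm3,\pm4,\pm5,\pm9$, are open (non-collapsed). More precisely, each of the following open intervals is contained in the open spectral gap (bounded connected component of $\mathbb R\setminus\Sigma_\omega$) having the indicated label: \begin{itemize} \item $(-2.65721095492,\,-2.64443590307)$: label $-4$; \item $(-2.60421010408,\,-2.56648816182)$: label $3$; \item $(-2.46431695653,\,-0.820368049989)$: label $-1$; \item $(-0.646689943693,\,-0.611187586183)$: label $-5$; \item $(-0.570487209785,\,-0.116609296737)$: label $2$; \item $(-0.0740258280376,\,-0.0583643948664)$: label $9$; \item $(0.0583643948664,\,0.0740258280376)$: label $-9$; \item $(0.116609296737,\,0.570487209785)$: label $-2$; \item $(0.611187586183,\,0.646689943693)$: label $5$; \item $(0.820368049989,\,2.46431695653)$: label $1$; \item $(2.56648816182,\,2.60421010408)$: label $-3$; \item $(2.64443590307,\,2.65721095492)$: label $4$. \end{itemize} Moreover $(-\infty,-2.74495255625)$ and $(2.74495255625,+\infty)$ are contained in the lower and upper unbounded connected components of $\mathbb R\setminus\Sigma_\omega$, respectively (label $0$).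
   Context: The Almost Mathieu operator with coupling $b=2$, frequency $\omega$ and phase $\theta\in\mathbb T=\mathbb R/\mathbb Z$ acts on $\ell^2(\mathbb Z)$ by $$(H_{2,\omega,\theta}x)_n=x_{n+1}+x_{n-1}+2\cos(2\pi(\omega n+\theta))\,x_n,\qquad n\in\mathbb Z.$$ For irrational $\omega$ its spectrum is a compact subset of $\mathbb R$ independent of $\theta$, denoted $\Sigma_\omega$. A (open, non-collapsed) spectral gap is a connected component of $\mathbb R\setminus\Sigma_\omega$. The integrated density of states $N:\mathbb R\to[0,1]$ (the limit as $L\to\infty$ of $\frac1L$ times the number of eigenvalues $\le a$ of the restriction of the operator to $\{1,\dots,L\}$) is continuous, nondecreasing, and constant exactly on the components of $\mathbb R\setminus\Sigma_\omega$. By the Gap Labelling Theorem, on each bounded gap the value of $N$ is $\{k\omega\}$ for a unique integer $k$, called the label of the gap, where $\{\cdot\}$ denotes the fractional part. The two unbounded components (where $N=0$ and $N=1$) are given the label $0$. Here $e$ is the base of natural logarithms. *)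

theory Defs
  imports
    "HOL-Analysis.Analysis"
    "HOL-Computational_Algebra.Fundamental_Theorem_Algebra"
    "Jordan_Normal_Form.Char_Poly"
begin

section \<open>Bounded operators on the complex Hilbert space \<open>\<ell>\<^sup>2(\<int>)\<close> and their spectrum\<close>

definition ell2 :: "(int \<Rightarrow> complex) set" where
  "ell2 = {x. (\<lambda>n. (cmod (x n))\<^sup>2) summable_on UNIV}"

definition ell2_norm :: "(int \<Rightarrow> complex) \<Rightarrow> real" where
  "ell2_norm x = sqrt (\<Sum>\<^sub>\<infinity>n. (cmod (x n))\<^sup>2)"

text \<open>Operators are functions on all sequences; only their values on \<open>ell2\<close> matter.\<close>

definition bounded_operator_ell2 ::
    "((int \<Rightarrow> complex) \<Rightarrow> (int \<Rightarrow> complex)) \<Rightarrow> bool" where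
  "bounded_operator_ell2 T \<longleftrightarrow>
     (\<forall>x\<in>ell2. T x \<in> ell2) \<and>
     (\<forall>x\<in>ell2. \<forall>y\<in>ell2. T (\<lambda>n. x n + y n) = (\<lambda>n. T x n + T y n)) \<and>
     (\<forall>c. \<forall>x\<in>ell2. T (\<lambda>n. c * x n) = (\<lambda>n. c * T x n)) \<and>
     (\<exists>C. \<forall>x\<in>ell2. ell2_norm (T x) \<le> C * ell2_norm x)"

definition spectrum_ell2 ::
    "((int \<Rightarrow> complex) \<Rightarrow> (int \<Rightarrow> complex)) \<Rightarrow> complex set" where
  "spectrum_ell2 T = {z. \<not> (\<exists>R. bounded_operator_ell2 R \<and>
     (\<forall>x\<in>ell2. R (\<lambda>n. T x n - z * x n) = x \<and> (\<lambda>n. T (R x) n - z * R x n) = x))}"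

section \<open>The Almost Mathieu operator\<close>

definition almost_mathieu ::
    "real \<Rightarrow> real \<Rightarrow> real \<Rightarrow> (int \<Rightarrow> complex) \<Rightarrow> (int \<Rightarrow> complex)" where
  "almost_mathieu b \<omega> \<theta> x =
     (\<lambda>n. x (n + 1) + x (n - 1) + complex_of_real (b * cos (2 * pi * (\<omega> * of_int n + \<theta>))) * x n)"

text \<open>The operator is self-adjoint, so passing to a subset of the reals loses nothing.\<close>

definition amo_spectrum :: "real \<Rightarrow> real \<Rightarrow> real \<Rightarrow> real set" where
  "amo_spectrum b \<omega> \<theta> = {a. complex_of_real a \<in> spectrum_ell2 (almost_mathieu b \<omega> \<theta>)}"

section \<open>Integrated density of states and gap labels\<close>

text \<open>Matrix indices start at \<open>0\<close>: row and column \<open>i\<close> belong to the site \<open>i + 1\<close> of \<open>{1..L}\<close>.\<close>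

definition amo_restriction :: "real \<Rightarrow> real \<Rightarrow> real \<Rightarrow> nat \<Rightarrow> real mat" where
  "amo_restriction b \<omega> \<theta> L = Matrix.mat L L (\<lambda>(i, j).
     if i = j then b * cos (2 * pi * (\<omega> * real (i + 1) + \<theta>))
     else if i = j + 1 \<or> j = i + 1 then 1 else 0)"

text \<open>Eigenvalues are counted with multiplicity.\<close>

definition amo_ids_approx :: "real \<Rightarrow> real \<Rightarrow> real \<Rightarrow> real \<Rightarrow> nat \<Rightarrow> real" where
  "amo_ids_approx b \<omega> \<theta> a L =
     real (size {#e \<in># proots (char_poly (amo_restriction b \<omega> \<theta> L)). e \<le> a#}) / real L"

definition amo_ids :: "real \<Rightarrow> real \<Rightarrow> real \<Rightarrow> real \<Rightarrow> real" where
  "amo_ids b \<omega> \<theta> a = lim (amo_ids_approx b \<omega> \<theta> a)"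

definition amo_gaps :: "real \<Rightarrow> real \<Rightarrow> real \<Rightarrow> real set set" where
  "amo_gaps b \<omega> \<theta> = components (- amo_spectrum b \<omega> \<theta>)"

text \<open>Since \<open>lim\<close> is unspecified on divergent sequences, convergence is demanded separately.\<close>

definition amo_gap_label :: "real \<Rightarrow> real \<Rightarrow> real \<Rightarrow> real set \<Rightarrow> int \<Rightarrow> bool" where
  "amo_gap_label b \<omega> \<theta> G k \<longleftrightarrow> G \<in> amo_gaps b \<omega> \<theta> \<and>
     (if bounded G
      then \<forall>a\<in>G. convergent (amo_ids_approx b \<omega> \<theta> a) \<and> amo_ids b \<omega> \<theta> a = frac (of_int k * \<omega>)
      else k = 0)"

end

theory Submission
  imports Defs
begin

text \<open>
  Solutions of the eigenvalue equation at an energy \<open>E\<close> evolve by matrices of determinant one, which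
  act on slopes \<open>r = x (n + 1) / x n\<close> by \<open>r \<mapsto> E - v - 1 / r\<close>. This action is monotone in the
  slope and in \<open>E\<close>. Hence a field of cones of slopes along each orbit of the rotation is invariant for
  all energies between \<open>a\<close> and \<open>b\<close> as soon as its lower boundary is a subsolution at \<open>a\<close> and its
  upper boundary a supersolution at \<open>b\<close>. Such a field (a \<open>cone_family\<close>) puts \<open>a < E < b\<close> into the
  resolvent set and also determines the integrated density of states there.

  Resolvent set: to each cone belongs an indefinite quadratic form vanishing on its boundary. Normalised
  by its discriminant, this form is invariant under the matrices and grows when the cone grows, so along
  a solution of the inhomogeneous equation it increases by a multiple of the squared entry, up to the
  inhomogeneity. Summing gives a lower bound for \<open>H - E\<close> (\<open>cone_family_bounded_below\<close>), and a
  symmetric operator that is bounded below is invertible (\<open>jacobi_onto\<close>).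

  Integrated density of states: the characteristic polynomials of the restrictions satisfy the same
  three-term recurrence, and their quotients at \<open>E\<close> form an orbit of slopes whose positive
  members count the eigenvalues up to \<open>E\<close> (\<open>sturm_count_Suc\<close>). Lifted to the universal cover of the
  projective line, this orbit is trapped in the cones, so the counting function grows at the rate at
  which the cones turn (\<open>cone_family_ids\<close>). A field of cones over the circle that gains \<open>K\<close>
  half turns around the circle turns by \<open>K * \<omega> + m\<close> half turns per step; \<open>K\<close> is the label. On the
  rest of the gap the density is constant, since a resolvent window contains at most
  two eigenvalues of each restriction (\<open>few_eigenvalues\<close>).

  Existence of the cones: the fractions \<open>334/465\<close> and \<open>385/536\<close> lie on the two sides of
  \<open>\<omega> = e - 2\<close>, so the circle is exhausted by two towers of heights 465 and 536 over an interval of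
  length about \<open>0.002\<close> around \<open>0\<close>. On each level of the towers the potential is constant up to
  \<open>0.0134\<close>, and the boundaries of the cones may be taken constant. They are computed in integer
  arithmetic from the values on the base; all that is left to check is that the values after 465
  and 536 steps lie inside the cone from which the computation started (\<open>tower_cone_family\<close>,
  \<open>certificate_sound\<close>). The tolerance is affordable because, numerically, the stated intervals end about
  \<open>0.02\<close> before the edges of the gaps. Six gaps and the energies above the spectrum are certified in
  this way; the reflection \<open>E \<mapsto> - E\<close> supplies the others (\<open>cone_family_reflect\<close>).
\<close>

section \<open>Square-summable sequences\<close>

definition nsq :: "(int \<Rightarrow> complex) \<Rightarrow> real" where
  "nsq x = (\<Sum>\<^sub>\<infinity>n. (cmod (x n))\<^sup>2)"

lemma ell2_norm_nsq: "ell2_norm x = sqrt (nsq x)"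
  by (simp add: ell2_norm_def nsq_def)

lemma nsq_nonneg: "0 \<le> nsq x"
  unfolding nsq_def by (rule infsum_nonneg) simp

lemma ell2I:
  assumes "\<And>F. finite F \<Longrightarrow> (\<Sum>n\<in>F. (cmod (x n))\<^sup>2) \<le> B"
  shows "x \<in> ell2" and "nsq x \<le> B"
proof -
  have s: "(\<lambda>n. (cmod (x n))\<^sup>2) summable_on UNIV"
    by (rule nonneg_bdd_above_summable_on) (auto intro!: bdd_aboveI2[where M=B] assms)
  then show "x \<in> ell2" by (simp add: ell2_def)
  show "nsq x \<le> B" unfolding nsq_def by (rule infsum_le_finite_sums[OF s assms])
qed

lemma finite_sum_le_nsq:
  assumes "x \<in> ell2" "finite F"
  shows "(\<Sum>n\<in>F. (cmod (x n))\<^sup>2) \<le> nsq x"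
  using assms unfolding nsq_def ell2_def by (intro finite_sum_le_infsum) auto

lemma cmod_sq_le_nsq: "x \<in> ell2 \<Longrightarrow> (cmod (x n))\<^sup>2 \<le> nsq x"
  using finite_sum_le_nsq[of x "{n}"] by simp

lemma nsq_eq_0: "x \<in> ell2 \<Longrightarrow> nsq x = 0 \<Longrightarrow> x = (\<lambda>_. 0)"
  using cmod_sq_le_nsq[of x] by fastforce

lemma ell2_scale:
  assumes "x \<in> ell2"
  shows "(\<lambda>n. c * x n) \<in> ell2" and "nsq (\<lambda>n. c * x n) = (cmod c)\<^sup>2 * nsq x"
  using assms summable_on_cmult_right[of "\<lambda>n. (cmod (x n))\<^sup>2" UNIV "(cmod c)\<^sup>2"]
  by (simp_all add: ell2_def nsq_def norm_mult power_mult_distrib infsum_cmult_right')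

lemma ell2_shift:
  fixes k :: int
  assumes "x \<in> ell2"
  shows "(\<lambda>n. x (n + k)) \<in> ell2" and "nsq (\<lambda>n. x (n + k)) = nsq x"
proof -
  have b: "bij_betw (\<lambda>n. n + k) UNIV (UNIV :: int set)"
    by (rule bij_betwI[where g="\<lambda>n. n - k"]) auto
  show "(\<lambda>n. x (n + k)) \<in> ell2"
    using assms summable_on_reindex_bij_betw[OF b, of "\<lambda>n. (cmod (x n))\<^sup>2"] by (simp add: ell2_def)
  show "nsq (\<lambda>n. x (n + k)) = nsq x"
    unfolding nsq_def by (rule infsum_reindex_bij_betw[OF b, of "\<lambda>n. (cmod (x n))\<^sup>2"])
qed

lemma cmod_add_sq_le: "(cmod (a + b))\<^sup>2 \<le> 2 * (cmod a)\<^sup>2 + 2 * (cmod b)\<^sup>2"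
proof -
  have "(cmod (a + b))\<^sup>2 \<le> (cmod a + cmod b)\<^sup>2"
    by (intro power_mono norm_triangle_ineq) auto
  also have "\<dots> \<le> 2 * (cmod a)\<^sup>2 + 2 * (cmod b)\<^sup>2"
    using zero_le_power2[of "cmod a - cmod b"] by (simp add: power2_sum power2_diff)
  finally show ?thesis .
qed

lemma ell2_add:
  assumes "x \<in> ell2" "y \<in> ell2"
  shows "(\<lambda>n. x n + y n) \<in> ell2" and "nsq (\<lambda>n. x n + y n) \<le> 2 * nsq x + 2 * nsq y"
proof -
  have *: "(\<Sum>n\<in>F. (cmod (x n + y n))\<^sup>2) \<le> 2 * nsq x + 2 * nsq y" if "finite F" for F
  proof -
    have "(\<Sum>n\<in>F. (cmod (x n + y n))\<^sup>2) \<le> (\<Sum>n\<in>F. 2 * (cmod (x n))\<^sup>2 + 2 * (cmod (y n))\<^sup>2)"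
      by (intro sum_mono cmod_add_sq_le)
    also have "\<dots> = 2 * (\<Sum>n\<in>F. (cmod (x n))\<^sup>2) + 2 * (\<Sum>n\<in>F. (cmod (y n))\<^sup>2)"
      by (simp add: sum.distrib sum_distrib_left)
    finally show ?thesis
      using finite_sum_le_nsq[OF assms(1) that] finite_sum_le_nsq[OF assms(2) that] by linarith
  qed
  show "(\<lambda>n. x n + y n) \<in> ell2" by (rule ell2I(1)[OF *])
  show "nsq (\<lambda>n. x n + y n) \<le> 2 * nsq x + 2 * nsq y" by (rule ell2I(2)[OF *])
qed

lemma ell2_diff:
  assumes "x \<in> ell2" "y \<in> ell2"
  shows "(\<lambda>n. x n - y n) \<in> ell2" and "nsq (\<lambda>n. x n - y n) \<le> 2 * nsq x + 2 * nsq y"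
  using ell2_add[OF assms(1) ell2_scale(1)[OF assms(2), of "-1"]]
    ell2_scale(2)[OF assms(2), of "-1"] by simp_all

lemma ell2_summable_inner:
  assumes "x \<in> ell2" "y \<in> ell2"
  shows "(\<lambda>n. inner (x n) (y n)) summable_on (UNIV :: int set)"
proof -
  have "(\<lambda>n. (cmod (x n))\<^sup>2 + (cmod (y n))\<^sup>2) summable_on (UNIV :: int set)"
    using assms by (intro summable_on_add) (auto simp: ell2_def)
  moreover have "norm (inner (x n) (y n)) \<le> (cmod (x n))\<^sup>2 + (cmod (y n))\<^sup>2" for n
  proof -
    have "norm (inner (x n) (y n)) \<le> cmod (x n) * cmod (y n)"
      using Cauchy_Schwarz_ineq2[of "x n" "y n"] by simp
    also have "\<dots> \<le> (cmod (x n))\<^sup>2 + (cmod (y n))\<^sup>2"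
      using sum_squares_bound[of "cmod (x n)" "cmod (y n)"]
        mult_nonneg_nonneg[OF norm_ge_zero norm_ge_zero, of "x n" "y n"] by linarith
    finally show ?thesis .
  qed
  ultimately have "(\<lambda>n. norm (inner (x n) (y n))) summable_on (UNIV :: int set)"
    by (rule Infinite_Sum.abs_summable_on_comparison_test')
  then show ?thesis by (rule abs_summable_summable)
qed

section \<open>Doubly infinite Jacobi operators\<close>

definition jacobi :: "(int \<Rightarrow> real) \<Rightarrow> (int \<Rightarrow> complex) \<Rightarrow> int \<Rightarrow> complex" where
  "jacobi u x = (\<lambda>n. x (n + 1) + x (n - 1) + complex_of_real (u n) * x n)"

lemma jacobi_add: "jacobi u (\<lambda>n. x n + y n) = (\<lambda>n. jacobi u x n + jacobi u y n)"
  by (simp add: jacobi_def algebra_simps)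

lemma jacobi_diff: "jacobi u (\<lambda>n. x n - y n) = (\<lambda>n. jacobi u x n - jacobi u y n)"
  by (simp add: jacobi_def algebra_simps)

lemma jacobi_scale: "jacobi u (\<lambda>n. c * x n) = (\<lambda>n. c * jacobi u x n)"
  by (simp add: jacobi_def algebra_simps)

lemma jacobi_ell2:
  assumes u: "\<And>n. \<bar>u n\<bar> \<le> B" and x: "x \<in> ell2"
  shows "jacobi u x \<in> ell2" and "nsq (jacobi u x) \<le> (8 + 2 * B\<^sup>2) * nsq x"
proof -
  have B: "0 \<le> B" using u[of 0] by linarith
  have m: "(\<Sum>n\<in>F. (cmod (complex_of_real (u n) * x n))\<^sup>2) \<le> B\<^sup>2 * nsq x" if F: "finite F" for F
  proof -
    have "(\<Sum>n\<in>F. (cmod (complex_of_real (u n) * x n))\<^sup>2) \<le> (\<Sum>n\<in>F. B\<^sup>2 * (cmod (x n))\<^sup>2)"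
      using u B by (intro sum_mono)
        (simp add: norm_mult power_mult_distrib mult_right_mono flip: abs_le_square_iff)
    also have "\<dots> \<le> B\<^sup>2 * nsq x"
      using finite_sum_le_nsq[OF x F] by (simp add: mult_left_mono flip: sum_distrib_left)
    finally show ?thesis .
  qed
  note s1 = ell2_shift[OF x, of 1] and s2 = ell2_shift[OF x, of "-1"]
  note s = ell2_add[OF s1(1) s2(1)]
  note t = ell2_add[OF s(1) ell2I(1)[OF m]]
  show "jacobi u x \<in> ell2" using t(1) by (simp add: jacobi_def)
  have "nsq (jacobi u x) \<le> 2 * (2 * nsq x + 2 * nsq x) + 2 * (B\<^sup>2 * nsq x)"
    using t(2) s(2) s1(2) s2(2) ell2I(2)[OF m] by (simp add: jacobi_def)
  then show "nsq (jacobi u x) \<le> (8 + 2 * B\<^sup>2) * nsq x" by (simp add: algebra_simps)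
qed

lemma jacobi_symmetric:
  assumes u: "\<And>n. \<bar>u n\<bar> \<le> B" and x: "x \<in> ell2" and y: "y \<in> ell2"
  shows "(\<Sum>\<^sub>\<infinity>n. inner (x n) (jacobi u y n)) = (\<Sum>\<^sub>\<infinity>n. inner (jacobi u x n) (y n))"
proof -
  have b: "bij_betw (\<lambda>n. n + k) UNIV (UNIV :: int set)" for k
    by (rule bij_betwI[where g="\<lambda>n. n - k"]) auto
  have diag: "(\<lambda>n. complex_of_real (u n) * z n) \<in> ell2" if z: "z \<in> ell2" for z
  proof -
    have "(\<lambda>n. jacobi u z n - (z (n + 1) + z (n + -1))) \<in> ell2"
      using ell2_shift(1)[OF z, of 1] ell2_shift(1)[OF z, of "-1"]
      by (intro ell2_diff(1) ell2_add(1) jacobi_ell2(1)[OF u z])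
    then show ?thesis by (simp add: jacobi_def)
  qed
  have split: "(\<Sum>\<^sub>\<infinity>n. inner (w n) (jacobi u z n)) =
      (\<Sum>\<^sub>\<infinity>n. inner (w n) (z (n + 1))) + (\<Sum>\<^sub>\<infinity>n. inner (w n) (z (n + -1)))
      + (\<Sum>\<^sub>\<infinity>n. u n * inner (w n) (z n))" if w: "w \<in> ell2" and z: "z \<in> ell2" for w z
  proof -
    note a = ell2_summable_inner[OF w ell2_shift(1)[OF z]]
    have c: "(\<lambda>n. u n * inner (w n) (z n)) summable_on UNIV"
      using ell2_summable_inner[OF w diag[OF z]]
      by (simp add: scaleR_conv_of_real[symmetric])
    have "(\<Sum>\<^sub>\<infinity>n. inner (w n) (jacobi u z n)) =
      (\<Sum>\<^sub>\<infinity>n. (inner (w n) (z (n + 1)) + inner (w n) (z (n + -1))) + u n * inner (w n) (z n))"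
      by (simp add: jacobi_def inner_add_right scaleR_conv_of_real[symmetric])
    also have "\<dots> = (\<Sum>\<^sub>\<infinity>n. inner (w n) (z (n + 1)) + inner (w n) (z (n + -1)))
      + (\<Sum>\<^sub>\<infinity>n. u n * inner (w n) (z n))"
      by (rule infsum_add[OF summable_on_add[OF a a] c])
    also have "(\<Sum>\<^sub>\<infinity>n. inner (w n) (z (n + 1)) + inner (w n) (z (n + -1))) =
      (\<Sum>\<^sub>\<infinity>n. inner (w n) (z (n + 1))) + (\<Sum>\<^sub>\<infinity>n. inner (w n) (z (n + -1)))"
      by (rule infsum_add[OF a a])
    finally show ?thesis .
  qed
  have m: "(\<Sum>\<^sub>\<infinity>n. inner (x n) (y (n + -1))) = (\<Sum>\<^sub>\<infinity>n. inner (x (n + 1)) (y n))"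
    using infsum_reindex_bij_betw[OF b[of 1], of "\<lambda>n. inner (x n) (y (n + -1))"] by simp
  have p: "(\<Sum>\<^sub>\<infinity>n. inner (x n) (y (n + 1))) = (\<Sum>\<^sub>\<infinity>n. inner (x (n + -1)) (y n))"
    using infsum_reindex_bij_betw[OF b[of "-1"], of "\<lambda>n. inner (x n) (y (n + 1))"] by simp
  show ?thesis
    unfolding split[OF x y] inner_commute[of "jacobi u x _"] split[OF y x] m p
    by (simp add: inner_commute)
qed

lemma nsq_combination:
  assumes x: "x \<in> ell2" and y: "y \<in> ell2"
  shows "nsq (\<lambda>n. x n - complex_of_real t * y n) =
    nsq x - 2 * t * (\<Sum>\<^sub>\<infinity>n. inner (x n) (y n)) + t\<^sup>2 * nsq y"
proof -
  have e: "(cmod (x n - complex_of_real t * y n))\<^sup>2 =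
      ((cmod (x n))\<^sup>2 + (- 2 * t) * inner (x n) (y n)) + t\<^sup>2 * (cmod (y n))\<^sup>2" for n
    unfolding cmod_power2 by (simp add: inner_complex_def power2_eq_square algebra_simps)
  have s: "(\<lambda>n. (cmod (x n))\<^sup>2) summable_on UNIV" "(\<lambda>n. (cmod (y n))\<^sup>2) summable_on UNIV"
    using x y by (auto simp: ell2_def)
  note i = ell2_summable_inner[OF x y]
  show ?thesis
    unfolding nsq_def e
    by (subst infsum_add, intro summable_on_add summable_on_cmult_right s i,
        intro summable_on_cmult_right s, subst infsum_add, intro s,
        intro summable_on_cmult_right i)
      (simp add: infsum_cmult_right' infsum_uminus mult.assoc)
qed

text \<open>A symmetric operator that is bounded below is onto. Iterating
  \<open>\<rho> \<mapsto> \<rho> - \<tau> J (J \<rho>)\<close> contracts the norm, because \<open>J\<^sup>2\<close> is bounded below as well, and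
  \<open>J\<close> applied to the sum of the \<open>\<tau> J \<rho>\<close> telescopes. Since \<open>J\<close> is local, the sum may be taken
  pointwise, so that completeness of the sequence space never enters.\<close>
lemma jacobi_onto:
  assumes u: "\<And>n. \<bar>u n\<bar> \<le> B" and c: "c > 0"
    and lower: "\<And>x. x \<in> ell2 \<Longrightarrow> c * nsq x \<le> nsq (jacobi u x)"
    and y: "y \<in> ell2"
  shows "\<exists>x\<in>ell2. jacobi u x = y"
proof -
  define K where "K = 8 + 2 * B\<^sup>2 + c"
  define t where "t = 1 / K"
  define q where "q = 1 - t * c"
  define \<rho> where "\<rho> k = ((\<lambda>r n. r n - complex_of_real t * jacobi u (jacobi u r) n) ^^ k) y" for k
  have K: "K > c" "K > 0" using c zero_le_power2[of B] unfolding K_def by linarith+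
  have t: "t > 0" using K by (simp add: t_def)
  have q: "0 \<le> q" "q < 1" using K c by (auto simp: q_def t_def)
  have JK: "jacobi u x \<in> ell2" "nsq (jacobi u x) \<le> K * nsq x" if "x \<in> ell2" for x
  proof -
    show "jacobi u x \<in> ell2" by (rule jacobi_ell2(1)[OF u that])
    have "(8 + 2 * B\<^sup>2) * nsq x \<le> K * nsq x"
      using c by (intro mult_right_mono nsq_nonneg) (simp add: K_def)
    then show "nsq (jacobi u x) \<le> K * nsq x" using jacobi_ell2(2)[where u=u, OF u that] by linarith
  qed
  have \<rho>S: "\<rho> (Suc k) = (\<lambda>n. \<rho> k n - complex_of_real t * jacobi u (jacobi u (\<rho> k)) n)" for k
    by (simp add: \<rho>_def)
  have \<rho>: "\<rho> k \<in> ell2" for k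
    by (induction k) (auto simp: \<rho>S \<rho>_def[of 0] y intro!: ell2_diff(1) ell2_scale(1) JK(1))
  have contr: "nsq (\<rho> (Suc k)) \<le> q * nsq (\<rho> k)" for k
  proof -
    let ?r = "\<rho> k"
    note Jr = JK(1)[OF \<rho>[of k]]
    have "nsq (\<rho> (Suc k)) = nsq ?r - 2 * t * nsq (jacobi u ?r) + t\<^sup>2 * nsq (jacobi u (jacobi u ?r))"
      unfolding \<rho>S nsq_combination[OF \<rho> JK(1)[OF Jr]] jacobi_symmetric[OF u \<rho> Jr]
      by (simp add: nsq_def power2_norm_eq_inner)
    also have "t\<^sup>2 * nsq (jacobi u (jacobi u ?r)) \<le> t\<^sup>2 * (K * nsq (jacobi u ?r))"
      by (intro mult_left_mono JK(2) Jr) auto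
    also have "t\<^sup>2 * (K * nsq (jacobi u ?r)) = t * nsq (jacobi u ?r)"
      using K by (simp add: t_def power2_eq_square)
    also have "nsq ?r - 2 * t * nsq (jacobi u ?r) + t * nsq (jacobi u ?r) = nsq ?r - t * nsq (jacobi u ?r)"
      by simp
    also have "\<dots> \<le> nsq ?r - t * (c * nsq ?r)"
      using lower[OF \<rho>[of k]] t by (intro diff_left_mono mult_left_mono) auto
    also have "\<dots> = q * nsq ?r" by (simp add: q_def algebra_simps)
    finally show ?thesis by simp
  qed
  have geom: "nsq (\<rho> k) \<le> q ^ k * nsq y" for k
  proof (induction k)
    case (Suc k)
    have "nsq (\<rho> (Suc k)) \<le> q * (q ^ k * nsq y)"
      using contr[of k] mult_left_mono[OF Suc q(1)] by linarith
    then show ?case by simp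
  qed (simp add: \<rho>_def)
  have bound: "cmod (z n) \<le> sqrt (M * (q ^ k * nsq y))" if "z \<in> ell2" "nsq z \<le> M * nsq (\<rho> k)" "0 \<le> M" for z n k M
    using order_trans[OF cmod_sq_le_nsq[OF that(1), of n] order_trans[OF that(2) mult_left_mono[OF geom that(3)]]]
    by (simp add: real_le_rsqrt)
  have sq: "summable (\<lambda>k. sqrt (M * (q ^ k * nsq y)))" for M
    using q by (simp add: real_sqrt_mult real_sqrt_power summable_mult summable_mult2 summable_geometric)
  define a where "a k n = complex_of_real t * jacobi u (\<rho> k) n" for k n
  have sa: "summable (\<lambda>k. a k n)" for n
  proof -
    have "summable (\<lambda>k. jacobi u (\<rho> k) n)"
      using bound[OF JK(1)[OF \<rho>] JK(2)[OF \<rho>]] K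
      by (intro summable_comparison_test'[OF sq[of K], of 0]) auto
    then show ?thesis unfolding a_def by (rule summable_mult)
  qed
  define x where "x n = (\<Sum>k. a k n)" for n
  have lim: "(\<lambda>k. \<rho> k n) \<longlonglongrightarrow> 0" for n
    using bound[OF \<rho>, of _ 1] by (intro summable_LIMSEQ_zero summable_comparison_test'[OF sq[of 1], of 0]) auto
  have Ja: "jacobi u (a k) = (\<lambda>n. \<rho> k n - \<rho> (Suc k) n)" for k
    unfolding \<rho>S a_def jacobi_scale by simp
  have Jx: "jacobi u x = y"
  proof
    fix n
    have "(\<lambda>k. a k (n + 1) + a k (n - 1) + complex_of_real (u n) * a k n) sums jacobi u x n"
      unfolding jacobi_def x_def using sa by (intro sums_add sums_mult summable_sums)
    then have "(\<lambda>k. \<rho> k n - \<rho> (Suc k) n) sums jacobi u x n"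
      using Ja by (simp add: jacobi_def fun_eq_iff)
    moreover have "(\<lambda>k. \<rho> k n - \<rho> (Suc k) n) sums (\<rho> 0 n - 0)"
      by (rule telescope_sums'[OF lim])
    ultimately have "jacobi u x n = \<rho> 0 n - 0" by (rule sums_unique2)
    then show "jacobi u x n = y n" by (simp add: \<rho>_def)
  qed
  define X where "X m n = (\<Sum>k<m. a k n)" for m n
  have XS: "X (Suc m) = (\<lambda>n. X m n + a m n)" for m by (simp add: X_def fun_eq_iff)
  have X: "X m \<in> ell2" for m
  proof (induction m)
    case 0 then show ?case by (auto simp: X_def intro!: ell2I(1)[where B=0])
  next
    case (Suc m) then show ?case unfolding XS a_def by (intro ell2_add(1) ell2_scale(1) JK(1) \<rho>)
  qed
  have JX: "jacobi u (X m) = (\<lambda>n. y n - \<rho> m n)" for m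
  proof (induction m)
    case 0 then show ?case by (simp add: X_def jacobi_def \<rho>_def)
  next
    case (Suc m) then show ?case unfolding XS jacobi_add Ja by (simp add: fun_eq_iff)
  qed
  have nX: "nsq (X m) \<le> 4 * nsq y / c" for m
  proof -
    have "c * nsq (X m) \<le> nsq (\<lambda>n. y n - \<rho> m n)" using lower[OF X[of m]] by (simp add: JX)
    also have "\<dots> \<le> 2 * nsq y + 2 * nsq (\<rho> m)" by (rule ell2_diff(2)[OF y \<rho>])
    also have "nsq (\<rho> m) \<le> nsq y"
      using geom[of m] mult_right_mono[OF power_le_one[of q m] nsq_nonneg[of y]] q by simp
    finally show ?thesis using c by (simp add: field_simps)
  qed
  have "x \<in> ell2"
  proof (rule ell2I(1))
    fix F :: "int set" assume F: "finite F"
    have "(\<lambda>m. \<Sum>n\<in>F. (cmod (X m n))\<^sup>2) \<longlonglongrightarrow> (\<Sum>n\<in>F. (cmod (x n))\<^sup>2)"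
      unfolding X_def x_def by (intro tendsto_sum tendsto_power tendsto_norm summable_LIMSEQ sa)
    then show "(\<Sum>n\<in>F. (cmod (x n))\<^sup>2) \<le> 4 * nsq y / c"
      by (rule LIMSEQ_le_const2) (use order_trans[OF finite_sum_le_nsq[OF X F] nX] in auto)
  qed
  with Jx show ?thesis by blast
qed

lemma jacobi_resolvent:
  assumes u: "\<And>n. \<bar>u n\<bar> \<le> B" and c: "c > 0"
    and lower: "\<And>x. x \<in> ell2 \<Longrightarrow> c * nsq x \<le> nsq (jacobi u x)"
  shows "\<exists>R. bounded_operator_ell2 R \<and> (\<forall>x\<in>ell2. R (jacobi u x) = x \<and> jacobi u (R x) = x)"
proof -
  have inj: "x = z" if "x \<in> ell2" "z \<in> ell2" "jacobi u x = jacobi u z" for x z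
  proof -
    note d = ell2_diff(1)[OF that(1,2)]
    have "jacobi u (\<lambda>n. x n - z n) = (\<lambda>n. 0)" by (simp add: jacobi_diff that(3))
    then have "nsq (jacobi u (\<lambda>n. x n - z n)) = 0" by (simp add: nsq_def)
    then have "c * nsq (\<lambda>n. x n - z n) \<le> 0" using lower[OF d] by simp
    then have "nsq (\<lambda>n. x n - z n) = 0" using c nsq_nonneg[of "\<lambda>n. x n - z n"]
      by (simp add: mult_le_0_iff)
    then show ?thesis using nsq_eq_0[OF d] by (simp add: fun_eq_iff)
  qed
  obtain R where R: "\<And>y. y \<in> ell2 \<Longrightarrow> R y \<in> ell2 \<and> jacobi u (R y) = y"
    using jacobi_onto[OF u c lower] by metis
  have "bounded_operator_ell2 R"
    unfolding bounded_operator_ell2_def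
  proof (intro conjI ballI allI)
    fix x y assume x: "x \<in> ell2" and y: "y \<in> ell2"
    show "R (\<lambda>n. x n + y n) = (\<lambda>n. R x n + R y n)"
    proof (rule inj)
      show "R (\<lambda>n. x n + y n) \<in> ell2" using R[OF ell2_add(1)[OF x y]] by blast
      show "(\<lambda>n. R x n + R y n) \<in> ell2" using R[OF x] R[OF y] ell2_add(1) by blast
      show "jacobi u (R (\<lambda>n. x n + y n)) = jacobi u (\<lambda>n. R x n + R y n)"
        unfolding jacobi_add using R[OF x] R[OF y] R[OF ell2_add(1)[OF x y]] by simp
    qed
  next
    fix k x assume x: "x \<in> ell2"
    show "R (\<lambda>n. k * x n) = (\<lambda>n. k * R x n)"
    proof (rule inj)
      show "R (\<lambda>n. k * x n) \<in> ell2" using R[OF ell2_scale(1)[OF x]] by blast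
      show "(\<lambda>n. k * R x n) \<in> ell2" using R[OF x] ell2_scale(1) by blast
      show "jacobi u (R (\<lambda>n. k * x n)) = jacobi u (\<lambda>n. k * R x n)"
        unfolding jacobi_scale using R[OF x] R[OF ell2_scale(1)[OF x]] by simp
    qed
  next
    have "ell2_norm (R x) \<le> sqrt (1 / c) * ell2_norm x" if "x \<in> ell2" for x
      using lower[of "R x"] R[OF that] c
      by (simp add: ell2_norm_nsq field_simps flip: real_sqrt_mult)
    then show "\<exists>C. \<forall>x\<in>ell2. ell2_norm (R x) \<le> C * ell2_norm x" by blast
  qed (use R in auto)
  moreover have "R (jacobi u x) = x" if "x \<in> ell2" for x
  proof -
    have "jacobi u x \<in> ell2" by (rule jacobi_ell2(1)[OF u that])
    then have "R (jacobi u x) \<in> ell2 \<and> jacobi u (R (jacobi u x)) = jacobi u x" by (rule R)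
    then show ?thesis using inj[of "R (jacobi u x)" x] that by blast
  qed
  moreover have "jacobi u (R x) = x" if "x \<in> ell2" for x using R[OF that] by blast
  ultimately show ?thesis by blast
qed

section \<open>The resolvent set of the Almost Mathieu operator\<close>

definition amo_potential :: "real \<Rightarrow> real \<Rightarrow> real \<Rightarrow> int \<Rightarrow> real" where
  "amo_potential b \<omega> \<theta> n = b * cos (2 * pi * (\<omega> * of_int n + \<theta>))"

lemma almost_mathieu_jacobi:
  "(\<lambda>n. almost_mathieu b \<omega> \<theta> x n - complex_of_real E * x n) = jacobi (\<lambda>n. amo_potential b \<omega> \<theta> n - E) x"
  by (simp add: almost_mathieu_def jacobi_def amo_potential_def algebra_simps)

lemma amo_potential_bound: "\<bar>amo_potential b \<omega> \<theta> n - E\<bar> \<le> \<bar>b\<bar> + \<bar>E\<bar>"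
proof -
  have "\<bar>amo_potential b \<omega> \<theta> n\<bar> \<le> \<bar>b\<bar> * 1"
    unfolding amo_potential_def abs_mult by (intro mult_left_mono) auto
  then show ?thesis by linarith
qed

definition bounded_below :: "real \<Rightarrow> real \<Rightarrow> real \<Rightarrow> real \<Rightarrow> real \<Rightarrow> bool" where
  "bounded_below b \<omega> \<theta> E c \<longleftrightarrow>
     (\<forall>x\<in>ell2. c * nsq x \<le> nsq (jacobi (\<lambda>n. amo_potential b \<omega> \<theta> n - E) x))"

text \<open>For real energies invertibility is the same as a lower bound, by symmetry. In this form
  the resolvent set is accessible to quadratic forms and to test vectors.\<close>
lemma not_in_amo_spectrum_iff:
  "E \<notin> amo_spectrum b \<omega> \<theta> \<longleftrightarrow> (\<exists>c>0. bounded_below b \<omega> \<theta> E c)"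
proof
  let ?J = "jacobi (\<lambda>n. amo_potential b \<omega> \<theta> n - E)"
  assume "\<exists>c>0. bounded_below b \<omega> \<theta> E c"
  then obtain c where c: "c > 0" "\<And>x. x \<in> ell2 \<Longrightarrow> c * nsq x \<le> nsq (?J x)"
    by (auto simp: bounded_below_def)
  obtain R where R: "bounded_operator_ell2 R" "\<forall>x\<in>ell2. R (?J x) = x \<and> ?J (R x) = x"
    using jacobi_resolvent[OF amo_potential_bound[of b \<omega> \<theta> _ E] c] by blast
  then show "E \<notin> amo_spectrum b \<omega> \<theta>"
    unfolding amo_spectrum_def spectrum_ell2_def almost_mathieu_jacobi mem_Collect_eq not_not
    by blast
next
  let ?J = "jacobi (\<lambda>n. amo_potential b \<omega> \<theta> n - E)"
  assume "E \<notin> amo_spectrum b \<omega> \<theta>"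
  then obtain R where R: "bounded_operator_ell2 R" "\<forall>x\<in>ell2. R (?J x) = x"
    unfolding amo_spectrum_def spectrum_ell2_def almost_mathieu_jacobi mem_Collect_eq not_not
    by blast
  obtain C0 where C0: "\<And>x. x \<in> ell2 \<Longrightarrow> ell2_norm (R x) \<le> C0 * ell2_norm x"
    using R(1) unfolding bounded_operator_ell2_def by blast
  define C where "C = max C0 1"
  have "nsq x \<le> C\<^sup>2 * nsq (?J x)" if x: "x \<in> ell2" for x
  proof -
    have Jx: "?J x \<in> ell2" by (rule jacobi_ell2(1)[OF amo_potential_bound x])
    have "sqrt (nsq x) \<le> C0 * sqrt (nsq (?J x))"
      using C0[OF Jx] R(2) x by (simp add: ell2_norm_nsq)
    also have "\<dots> \<le> C * sqrt (nsq (?J x))"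
      by (intro mult_right_mono) (auto simp: C_def nsq_nonneg)
    finally have "(sqrt (nsq x))\<^sup>2 \<le> (C * sqrt (nsq (?J x)))\<^sup>2"
      by (intro power_mono) (auto simp: nsq_nonneg)
    then show ?thesis by (simp add: power_mult_distrib nsq_nonneg)
  qed
  moreover have "C > 0" by (simp add: C_def)
  ultimately show "\<exists>c>0. bounded_below b \<omega> \<theta> E c"
    unfolding bounded_below_def
    by (intro exI[of _ "1 / C\<^sup>2"]) (auto simp: field_simps)
qed

lemma bounded_below_nearby:
  assumes "bounded_below b \<omega> \<theta> E c" "\<bar>E' - E\<bar>\<^sup>2 \<le> c / 4"
  shows "bounded_below b \<omega> \<theta> E' (c / 4)"
  unfolding bounded_below_def
proof
  let ?J = "\<lambda>E. jacobi (\<lambda>n. amo_potential b \<omega> \<theta> n - E)"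
  fix x assume x: "x \<in> ell2"
  have J': "?J E' x \<in> ell2" by (rule jacobi_ell2(1)[OF amo_potential_bound x])
  have J: "?J E x = (\<lambda>n. ?J E' x n + complex_of_real (E' - E) * x n)"
    by (rule ext) (simp add: jacobi_def left_diff_distrib)
  have "nsq (?J E x) \<le> 2 * nsq (?J E' x) + 2 * (\<bar>E' - E\<bar>\<^sup>2 * nsq x)"
    unfolding J using ell2_add(2)[OF J' ell2_scale(1)[OF x, of "complex_of_real (E' - E)"]]
    unfolding ell2_scale(2)[OF x] norm_of_real .
  moreover have "\<bar>E' - E\<bar>\<^sup>2 * nsq x \<le> c / 4 * nsq x"
    using assms(2) by (rule mult_right_mono[OF _ nsq_nonneg])
  moreover have "c * nsq x \<le> nsq (?J E x)" using assms(1) x by (simp add: bounded_below_def)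
  ultimately show "c / 4 * nsq x \<le> nsq (?J E' x)" by simp
qed

lemma open_resolvent: "open (- amo_spectrum b \<omega> \<theta>)"
proof (rule openI)
  fix E assume "E \<in> - amo_spectrum b \<omega> \<theta>"
  then obtain c where c: "c > 0" "bounded_below b \<omega> \<theta> E c"
    using not_in_amo_spectrum_iff by auto
  have "E' \<in> - amo_spectrum b \<omega> \<theta>" if "E' \<in> ball E (sqrt c / 2)" for E'
  proof -
    have "\<bar>E' - E\<bar>\<^sup>2 \<le> (sqrt c / 2)\<^sup>2"
      using that by (intro power_mono) (auto simp: dist_real_def abs_minus_commute)
    then have "\<bar>E' - E\<bar>\<^sup>2 \<le> c / 4" using c by (simp add: power_divide)
    then have "bounded_below b \<omega> \<theta> E' (c / 4)" by (rule bounded_below_nearby[OF c(2)])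
    moreover have "c / 4 > 0" using c by simp
    ultimately show ?thesis unfolding Compl_iff not_in_amo_spectrum_iff by blast
  qed
  then show "\<exists>e>0. ball E e \<subseteq> - amo_spectrum b \<omega> \<theta>"
    using c by (intro exI[of _ "sqrt c / 2"]) auto
qed

section \<open>Invariant cones and a Lyapunov form\<close>

text \<open>A pair of an integer (the sheet) and a slope is a point of the universal cover of the projective
  line, the point at infinity joining consecutive sheets; the lexicographic order is the orientation of
  that line. The matrix with potential \<open>v\<close> at energy \<open>e\<close> lifts to
  \<open>(i, r) \<mapsto> (i + sheet r, e - v - 1 / r)\<close>: the image passes through infinity when \<open>r\<close> passes
  through \<open>0\<close>.\<close>
definition lexle :: "int \<Rightarrow> real \<Rightarrow> int \<Rightarrow> real \<Rightarrow> bool" where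
  "lexle i r j s \<longleftrightarrow> i < j \<or> i = j \<and> r \<le> s"

text \<open>The upper boundary lies above the lower one by less than a full sheet.\<close>
definition lifted_cone :: "int \<Rightarrow> real \<Rightarrow> int \<Rightarrow> real \<Rightarrow> bool" where
  "lifted_cone i r k p \<longleftrightarrow> k = i \<and> r < p \<or> k = i + 1 \<and> p < r"

definition sheet :: "real \<Rightarrow> int" where
  "sheet r = (if r > 0 then 1 else 0)"

text \<open>The lower boundary is tested at the energy \<open>a\<close> only and the upper one at \<open>b\<close> only; since the lifted
  maps increase with the energy, all energies in between preserve the cones. The bound \<open>\<delta>\<close> keeps the
  slopes away from \<open>0\<close>, where the map is singular, and the cones from degenerating.\<close>
definition cone_orbit ::
  "(nat \<Rightarrow> real) \<Rightarrow> real \<Rightarrow> real \<Rightarrow> real \<Rightarrow> real \<Rightarrow>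
   (nat \<Rightarrow> int) \<Rightarrow> (nat \<Rightarrow> real) \<Rightarrow> (nat \<Rightarrow> int) \<Rightarrow> (nat \<Rightarrow> real) \<Rightarrow> bool" where
  "cone_orbit v a b \<delta> C i r k p \<longleftrightarrow> (\<forall>n.
     \<delta> \<le> \<bar>r n\<bar> \<and> \<bar>r n\<bar> \<le> C \<and> \<delta> \<le> \<bar>p n\<bar> \<and> \<bar>p n\<bar> \<le> C \<and> \<delta> \<le> \<bar>p n - r n\<bar> \<and>
     lifted_cone (i n) (r n) (k n) (p n) \<and>
     lexle (i (Suc n)) (r (Suc n)) (i n + sheet (r n)) (a - v (Suc n) - 1 / r n) \<and>
     lexle (k n + sheet (p n)) (b - v (Suc n) - 1 / p n) (k (Suc n)) (p (Suc n)))"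

text \<open>The quadratic form with null directions \<open>r\<close> and \<open>p\<close>, nonnegative on the cone between them. The
  denominator fixes its discriminant, which makes it depend on the cone alone.\<close>
definition cone_form :: "real \<Rightarrow> real \<Rightarrow> real \<Rightarrow> real \<Rightarrow> real" where
  "cone_form r p x y = (y - r * x) * (p * x - y) / (p - r)"

lemma cone_form_invariant:
  assumes "r \<noteq> 0" "p \<noteq> 0" "r \<noteq> p"
  shows "cone_form (c - 1 / r) (c - 1 / p) x (c * x - w) = cone_form r p w x"
proof -
  have 1: "(c * x - w) - (c - 1 / r) * x = (x - r * w) / r"
    "(c - 1 / p) * x - (c * x - w) = (p * w - x) / p"
    "(c - 1 / p) - (c - 1 / r) = (p - r) / (r * p)"
    using assms by (simp_all add: field_simps)
  show ?thesis unfolding cone_form_def 1 using assms by simp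
qed

lemma cone_form_lower:
  assumes "p \<noteq> r" "p \<noteq> r'"
  shows "cone_form r' p x y - cone_form r p x y = (p * x - y)\<^sup>2 * ((r - r') / ((p - r) * (p - r')))"
proof -
  have 1: "cone_form s p x y = (p * x - y) * x - (p * x - y)\<^sup>2 * (1 / (p - s))" if "p \<noteq> s" for s
    using that by (simp add: cone_form_def field_simps power2_eq_square)
  have 2: "1 / (p - r) - 1 / (p - r') = (r - r') / ((p - r) * (p - r'))"
    using assms by (simp add: field_simps)
  show ?thesis unfolding 1[OF assms(1)] 1[OF assms(2)] 2[symmetric] by (simp add: algebra_simps)
qed

lemma cone_form_upper:
  assumes "p \<noteq> r" "p' \<noteq> r"
  shows "cone_form r p' x y - cone_form r p x y = (y - r * x)\<^sup>2 * ((p' - p) / ((p - r) * (p' - r)))"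
proof -
  have 1: "cone_form r s x y = (y - r * x) * x - (y - r * x)\<^sup>2 * (1 / (s - r))" if "s \<noteq> r" for s
    using that by (simp add: cone_form_def field_simps power2_eq_square)
  have 2: "1 / (p - r) - 1 / (p' - r) = (p' - p) / ((p - r) * (p' - r))"
    using assms by (simp add: field_simps)
  show ?thesis unfolding 1[OF assms(1)] 1[OF assms(2)] 2[symmetric] by (simp add: algebra_simps)
qed

lemma fraction_ge:
  fixes A B D :: real
  assumes "\<mu> > 0" "C > 0" "\<mu> \<le> \<bar>A\<bar>" "B \<noteq> 0" "\<bar>B\<bar> \<le> 2 * C" "D \<noteq> 0" "\<bar>D\<bar> \<le> 2 * C"
    and sign: "0 < A \<longleftrightarrow> (0 < B \<longleftrightarrow> 0 < D)"
  shows "\<mu> / (4 * C\<^sup>2) \<le> A / (B * D)"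
proof -
  have "\<bar>B\<bar> * \<bar>D\<bar> \<le> (2 * C) * (2 * C)" using assms by (intro mult_mono) auto
  then have "\<mu> / (4 * C\<^sup>2) \<le> \<bar>A\<bar> / (\<bar>B\<bar> * \<bar>D\<bar>)"
    using assms by (intro frac_le) (auto simp: power2_eq_square)
  also have "\<bar>A\<bar> / (\<bar>B\<bar> * \<bar>D\<bar>) = \<bar>A / (B * D)\<bar>" by (simp add: abs_divide abs_mult)
  also have "\<dots> = A / (B * D)"
  proof -
    consider "0 < A" "0 < B * D" | "A < 0" "B * D < 0"
      using sign assms by (cases "0 < B"; cases "0 < D") (auto simp: mult_pos_neg mult_neg_pos mult_neg_neg not_less)
    then have "0 \<le> A / (B * D)" by cases (auto intro: divide_nonpos_nonpos)
    then show ?thesis by (rule abs_of_nonneg)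
  qed
  finally show ?thesis .
qed

text \<open>Enlarging a cone enlarges its form: as a function of \<open>p\<close> it contains \<open>- 1 / (p - r)\<close> with a square
  as coefficient, which increases on the whole period between \<open>r\<close> and the next lift of \<open>r\<close>, also through
  infinity. The two squares, one from each boundary, cannot vanish together unless \<open>x\<close> does, because
  \<open>p\<close> and \<open>r'\<close> stay apart.\<close>
lemma cone_form_gain:
  assumes \<mu>: "\<mu> > 0" and C: "C > 0"
    and S: "lexle i' (r' + \<mu>) i r" and T: "lexle k p k' (p' - \<mu>)"
    and c: "lifted_cone i r k p" and c': "lifted_cone i' r' k' p'"
    and b: "\<bar>r\<bar> \<le> C" "\<bar>p\<bar> \<le> C" "\<bar>r'\<bar> \<le> C" "\<bar>p'\<bar> \<le> C"
  shows "\<mu> ^ 3 / (8 * C\<^sup>2) * x\<^sup>2 \<le> cone_form r' p' x y - cone_form r p x y"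
proof -
  \<comment> \<open>The larger cone spans at most one sheet change, which leaves four places for it in the chain
    \<open>r'\<close>, \<open>r\<close>, \<open>p\<close>, \<open>p'\<close>.\<close>
  consider (1) "r' + \<mu> \<le> r" "r < p" "p \<le> p' - \<mu>"
    | (2) "r' + \<mu> \<le> r" "r < p" "p' < r'"
    | (3) "r' + \<mu> \<le> r" "p \<le> p' - \<mu>" "p' < r'"
    | (4) "r < p" "p \<le> p' - \<mu>" "p' < r'"
    using S T c c' unfolding lexle_def lifted_cone_def by linarith
  then have *: "\<mu> / (4 * C\<^sup>2) \<le> (r - r') / ((p - r) * (p - r')) \<and>
      \<mu> / (4 * C\<^sup>2) \<le> (p' - p) / ((p - r') * (p' - r')) \<and> \<mu> \<le> \<bar>p - r'\<bar> \<and>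
      p \<noteq> r \<and> p \<noteq> r' \<and> p' \<noteq> r'"
  proof cases
    case 1
    then show ?thesis using \<mu> b
      by (intro conjI fraction_ge[OF \<mu> C]; linarith)
  next
    case 2
    then show ?thesis using \<mu> b
      by (intro conjI fraction_ge[OF \<mu> C]; linarith)
  next
    case 3
    then show ?thesis using \<mu> b
      by (intro conjI fraction_ge[OF \<mu> C]; linarith)
  next
    case 4
    then show ?thesis using \<mu> b
      by (intro conjI fraction_ge[OF \<mu> C]; linarith)
  qed
  define \<kappa> where "\<kappa> = \<mu> / (4 * C\<^sup>2)"
  have \<kappa>: "\<kappa> > 0" using \<mu> C by (simp add: \<kappa>_def)
  have "\<mu>\<^sup>2 * x\<^sup>2 \<le> \<bar>p - r'\<bar>\<^sup>2 * x\<^sup>2"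
    using * \<mu> by (intro mult_right_mono power_mono) auto
  also have "\<bar>p - r'\<bar>\<^sup>2 * x\<^sup>2 = ((p * x - y) + (y - r' * x))\<^sup>2"
    by (simp add: power2_eq_square algebra_simps)
  also have "\<dots> \<le> 2 * (p * x - y)\<^sup>2 + 2 * (y - r' * x)\<^sup>2"
  proof -
    have "(s + t)\<^sup>2 \<le> 2 * s\<^sup>2 + 2 * t\<^sup>2" for s t :: real
      using zero_le_power2[of "s - t"] by (simp add: power2_sum power2_diff)
    then show ?thesis .
  qed
  finally have "\<kappa> * (\<mu>\<^sup>2 * x\<^sup>2) \<le> \<kappa> * (2 * (p * x - y)\<^sup>2 + 2 * (y - r' * x)\<^sup>2)"
    using \<kappa> by (intro mult_left_mono) auto
  also have "\<dots> = 2 * ((p * x - y)\<^sup>2 * \<kappa> + (y - r' * x)\<^sup>2 * \<kappa>)" by (simp add: algebra_simps)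
  also have "\<dots> \<le> 2 * ((p * x - y)\<^sup>2 * ((r - r') / ((p - r) * (p - r')))
      + (y - r' * x)\<^sup>2 * ((p' - p) / ((p - r') * (p' - r'))))"
    using * by (intro mult_left_mono add_mono) (auto simp: \<kappa>_def)
  also have "\<dots> = 2 * (cone_form r' p' x y - cone_form r p x y)"
    using cone_form_lower[of p r r' x y] cone_form_upper[of p r' p' x y] * by simp
  finally show ?thesis by (simp add: \<kappa>_def power3_eq_cube power2_eq_square)
qed

lemma cone_step:
  assumes c: "lifted_cone i r k p" and "r \<noteq> 0" "p \<noteq> 0"
  shows "lifted_cone (i + sheet r) (e - 1 / r) (k + sheet p) (e - 1 / p)"
proof -
  have "r < p \<Longrightarrow> (r > 0 \<or> p < 0) \<Longrightarrow> 1 / p < 1 / r" "p < r \<Longrightarrow> (p > 0 \<or> r < 0) \<Longrightarrow> 1 / r < 1 / p"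
    using assms by (auto intro: divide_strict_left_mono divide_strict_left_mono_neg simp: mult_pos_pos mult_neg_neg)
  moreover have "r > 0 \<Longrightarrow> 1 / r > 0" "p > 0 \<Longrightarrow> 1 / p > 0" "r < 0 \<Longrightarrow> 1 / r < 0" "p < 0 \<Longrightarrow> 1 / p < 0"
    by auto
  ultimately show ?thesis
    using assms unfolding lifted_cone_def sheet_def by (smt (verit))
qed

lemma cone_form_bound:
  assumes "\<delta> > 0" "\<delta> \<le> \<bar>p - r\<bar>" "\<bar>r\<bar> \<le> C" "\<bar>p\<bar> \<le> C"
  shows "\<bar>cone_form r p x y\<bar> \<le> 2 * (C\<^sup>2 + 1) / \<delta> * (x\<^sup>2 + y\<^sup>2)"
proof -
  have C: "0 \<le> C" using assms by linarith
  have m: "\<bar>y - s * x\<bar> \<le> C * \<bar>x\<bar> + \<bar>y\<bar>" if "\<bar>s\<bar> \<le> C" for s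
  proof -
    have "\<bar>y - s * x\<bar> \<le> \<bar>y\<bar> + \<bar>s\<bar> * \<bar>x\<bar>" using abs_triangle_ineq4[of y "s * x"] by (simp add: abs_mult)
    also have "\<bar>s\<bar> * \<bar>x\<bar> \<le> C * \<bar>x\<bar>" using that by (intro mult_right_mono) auto
    finally show ?thesis by simp
  qed
  have "\<bar>(y - r * x) * (p * x - y)\<bar> \<le> (C * \<bar>x\<bar> + \<bar>y\<bar>) * (C * \<bar>x\<bar> + \<bar>y\<bar>)"
    using m[OF assms(3)] m[OF assms(4)] C unfolding abs_mult abs_minus_commute[of "p * x"]
    by (intro mult_mono) auto
  also have "\<dots> \<le> 2 * (C\<^sup>2 * x\<^sup>2 + y\<^sup>2)"
    using zero_le_power2[of "C * \<bar>x\<bar> - \<bar>y\<bar>"] by (simp add: power2_eq_square algebra_simps)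
  also have "\<dots> \<le> 2 * (C\<^sup>2 + 1) * (x\<^sup>2 + y\<^sup>2)" by (simp add: algebra_simps)
  finally have n: "\<bar>(y - r * x) * (p * x - y)\<bar> \<le> 2 * (C\<^sup>2 + 1) * (x\<^sup>2 + y\<^sup>2)" .
  have "\<bar>cone_form r p x y\<bar> = \<bar>(y - r * x) * (p * x - y)\<bar> / \<bar>p - r\<bar>" by (simp add: cone_form_def abs_divide)
  also have "\<dots> \<le> 2 * (C\<^sup>2 + 1) * (x\<^sup>2 + y\<^sup>2) / \<delta>"
    using n assms by (intro frac_le) auto
  finally show ?thesis by simp
qed

lemma cone_form_perturb:
  assumes "\<delta> > 0" "\<delta> \<le> \<bar>p - r\<bar>" "\<bar>r\<bar> \<le> C" "\<bar>p\<bar> \<le> C" "\<epsilon> > 0"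
  shows "cone_form r p x (y - f) - cone_form r p x y \<le> \<epsilon> * x\<^sup>2 + \<epsilon> * y\<^sup>2 + ((C\<^sup>2 + 1) / (\<delta>\<^sup>2 * \<epsilon>) + 1 / \<delta>) * f\<^sup>2"
proof -
  have young: "2 * a * c \<le> \<epsilon> * a\<^sup>2 + c\<^sup>2 / \<epsilon>" for a c :: real
  proof -
    have "0 \<le> (\<epsilon> * a - c)\<^sup>2 / \<epsilon>" using assms by simp
    also have "\<dots> = \<epsilon> * a\<^sup>2 - 2 * a * c + c\<^sup>2 / \<epsilon>"
      using assms by (simp add: power2_eq_square field_simps)
    finally show ?thesis by simp
  qed
  have ne: "p - r \<noteq> 0" using assms by auto
  have "cone_form r p x (y - f) - cone_form r p x y = ((2 * y * f - (p + r) * x * f) - f\<^sup>2) / (p - r)"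
    unfolding cone_form_def diff_divide_distrib[symmetric] by (simp add: power2_eq_square algebra_simps)
  also have "\<dots> \<le> (2 * \<bar>y\<bar> * \<bar>f\<bar> + 2 * C * \<bar>x\<bar> * \<bar>f\<bar> + f\<^sup>2) / \<delta>"
  proof -
    have "\<bar>(p + r) * x * f\<bar> \<le> 2 * C * \<bar>x\<bar> * \<bar>f\<bar>"
      unfolding abs_mult using assms by (intro mult_right_mono) auto
    then have "\<bar>(2 * y * f - (p + r) * x * f) - f\<^sup>2\<bar> \<le> 2 * \<bar>y\<bar> * \<bar>f\<bar> + 2 * C * \<bar>x\<bar> * \<bar>f\<bar> + f\<^sup>2"
      using abs_triangle_ineq4[of "2 * y * f - (p + r) * x * f" "f\<^sup>2"]
        abs_triangle_ineq4[of "2 * y * f" "(p + r) * x * f"] by (simp add: abs_mult)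
    then have "\<bar>((2 * y * f - (p + r) * x * f) - f\<^sup>2) / (p - r)\<bar> \<le> (2 * \<bar>y\<bar> * \<bar>f\<bar> + 2 * C * \<bar>x\<bar> * \<bar>f\<bar> + f\<^sup>2) / \<delta>"
      unfolding abs_divide using assms by (intro frac_le) auto
    then show ?thesis by linarith
  qed
  also have "\<dots> = 2 * \<bar>y\<bar> * (\<bar>f\<bar> / \<delta>) + 2 * \<bar>x\<bar> * (C * \<bar>f\<bar> / \<delta>) + f\<^sup>2 / \<delta>"
    by (simp add: add_divide_distrib)
  also have "\<dots> \<le> (\<epsilon> * \<bar>y\<bar>\<^sup>2 + (\<bar>f\<bar> / \<delta>)\<^sup>2 / \<epsilon>) + (\<epsilon> * \<bar>x\<bar>\<^sup>2 + (C * \<bar>f\<bar> / \<delta>)\<^sup>2 / \<epsilon>) + f\<^sup>2 / \<delta>"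
    by (intro add_mono young order_refl)
  also have "\<dots> = \<epsilon> * x\<^sup>2 + \<epsilon> * y\<^sup>2 + ((C\<^sup>2 + 1) / (\<delta>\<^sup>2 * \<epsilon>) + 1 / \<delta>) * f\<^sup>2"
    using assms by (simp add: power_divide power_mult_distrib add_divide_distrib distrib_right)
  finally show ?thesis .
qed

text \<open>The cone form is a Lyapunov function: each step increases it by a multiple of the squared entry, up
  to the inhomogeneity \<open>f\<close>. The entry \<open>x (Suc n)\<close> suffices, although the form sees two neighbouring
  entries, because the gain in the cone at \<open>Suc n\<close> comes from moving the energy, which moves all slopes
  over that site by the same amount.\<close>
lemma cone_orbit_estimate:
  fixes v x :: "nat \<Rightarrow> real"
  assumes orb: "cone_orbit v a b \<delta> C i r k p" and \<delta>: "\<delta> > 0" and v: "\<And>n. \<bar>v n\<bar> \<le> 2"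
    and \<mu>: "\<mu> > 0" "a + \<mu> \<le> E" "E + \<mu> \<le> b"
  defines "D \<equiv> C + \<bar>E\<bar> + 2 + 1 / \<delta>"
  defines "c \<equiv> \<mu> ^ 3 / (8 * D\<^sup>2)"
  defines "K \<equiv> 4 * (D\<^sup>2 + 1) / (\<delta>\<^sup>2 * c) + 1 / \<delta>"
  defines "M \<equiv> c / 4 + 2 * (D\<^sup>2 + 1) / \<delta>"
  defines "f \<equiv> \<lambda>n. x (Suc (Suc n)) + x n + (v (Suc n) - E) * x (Suc n)"
  shows "c / 2 * (\<Sum>n<N. (x (Suc n))\<^sup>2) \<le> K * (\<Sum>n<N. (f n)\<^sup>2)
     + M * ((x 0)\<^sup>2 + (x 1)\<^sup>2 + (x N)\<^sup>2 + (x (Suc N))\<^sup>2)"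
proof -
  have o: "\<delta> \<le> \<bar>r n\<bar>" "\<bar>r n\<bar> \<le> C" "\<delta> \<le> \<bar>p n\<bar>" "\<bar>p n\<bar> \<le> C" "\<delta> \<le> \<bar>p n - r n\<bar>"
     "lifted_cone (i n) (r n) (k n) (p n)"
     "lexle (i (Suc n)) (r (Suc n)) (i n + sheet (r n)) (a - v (Suc n) - 1 / r n)"
     "lexle (k n + sheet (p n)) (b - v (Suc n) - 1 / p n) (k (Suc n)) (p (Suc n))" for n
    using orb unfolding cone_orbit_def by blast+
  have CD: "C \<le> D" "D > 0" using \<delta> o(2)[of 0] unfolding D_def
    by (smt (verit) divide_nonneg_nonneg, smt (verit) divide_nonneg_nonneg)
  have bD: "\<bar>r n\<bar> \<le> D" "\<bar>p n\<bar> \<le> D" for n using o(2,4)[of n] CD by linarith+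
  have c: "c > 0" using \<mu> CD by (simp add: c_def)
  have K: "K > 0" using \<delta> c by (simp add: K_def add_pos_pos power2_eq_square add_nonneg_pos)
  define q where "q n = cone_form (r n) (p n) (x n) (x (Suc n))" for n
  have qb: "\<bar>q n\<bar> \<le> 2 * (D\<^sup>2 + 1) / \<delta> * ((x n)\<^sup>2 + (x (Suc n))\<^sup>2)" for n
    unfolding q_def by (rule cone_form_bound[OF \<delta> o(5) bD])
  have step: "c * (x (Suc n))\<^sup>2 - c / 4 * (x (Suc n))\<^sup>2 - c / 4 * (x (Suc (Suc n)))\<^sup>2 - K * (f n)\<^sup>2
      \<le> q (Suc n) - q n" for n
  proof -
    let ?e = "E - v (Suc n)" and ?x = "x (Suc n)" and ?z = "x (Suc (Suc n)) - f n"
    have z: "?z = ?e * ?x - x n" by (simp add: f_def algebra_simps)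
    have nz: "r n \<noteq> 0" "p n \<noteq> 0" "r n \<noteq> p n" using o(1,3,5)[of n] \<delta> by auto
    have inv: "\<bar>1 / r n\<bar> \<le> 1 / \<delta>" "\<bar>1 / p n\<bar> \<le> 1 / \<delta>"
      using o(1,3)[of n] \<delta> by (auto simp: abs_divide intro!: divide_left_mono)
    have bnd: "\<bar>?e - 1 / r n\<bar> \<le> D" "\<bar>?e - 1 / p n\<bar> \<le> D"
      using inv v[of "Suc n"] o(2)[of n] unfolding D_def by linarith+
    have "c * ?x\<^sup>2 \<le> cone_form (r (Suc n)) (p (Suc n)) ?x ?z - cone_form (?e - 1 / r n) (?e - 1 / p n) ?x ?z"
      unfolding c_def
    proof (rule cone_form_gain[OF \<mu>(1) CD(2) _ _ cone_step[OF o(6) nz(1,2)] o(6) bnd bD])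
      show "lexle (i (Suc n)) (r (Suc n) + \<mu>) (i n + sheet (r n)) (?e - 1 / r n)"
        using o(7)[of n] \<mu> by (auto simp: lexle_def)
      show "lexle (k n + sheet (p n)) (?e - 1 / p n) (k (Suc n)) (p (Suc n) - \<mu>)"
        using o(8)[of n] \<mu> by (auto simp: lexle_def)
    qed
    also have "cone_form (?e - 1 / r n) (?e - 1 / p n) ?x ?z = q n"
      unfolding q_def z by (rule cone_form_invariant[OF nz])
    finally have 1: "c * ?x\<^sup>2 \<le> cone_form (r (Suc n)) (p (Suc n)) ?x ?z - q n" .
    have "cone_form (r (Suc n)) (p (Suc n)) ?x ?z - q (Suc n) \<le> c / 4 * ?x\<^sup>2 + c / 4 * (x (Suc (Suc n)))\<^sup>2
        + ((D\<^sup>2 + 1) / (\<delta>\<^sup>2 * (c / 4)) + 1 / \<delta>) * (f n)\<^sup>2"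
      unfolding q_def by (rule cone_form_perturb[OF \<delta> o(5) bD]) (use c in simp)
    also have "(D\<^sup>2 + 1) / (\<delta>\<^sup>2 * (c / 4)) + 1 / \<delta> = K" by (simp add: K_def field_simps)
    finally show ?thesis using 1 by linarith
  qed
  have tele: "(\<Sum>n<N. q (Suc n) - q n) = q N - q 0" by (rule sum_lessThan_telescope)
  have sh: "(\<Sum>n<N. (x (Suc (Suc n)))\<^sup>2) = (\<Sum>n<N. (x (Suc n))\<^sup>2) - (x 1)\<^sup>2 + (x (Suc N))\<^sup>2"
    by (induction N) auto
  have "(\<Sum>n<N. c * (x (Suc n))\<^sup>2 - c / 4 * (x (Suc n))\<^sup>2 - c / 4 * (x (Suc (Suc n)))\<^sup>2 - K * (f n)\<^sup>2)
     \<le> q N - q 0"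
    unfolding tele[symmetric] by (intro sum_mono step)
  then have "c * (\<Sum>n<N. (x (Suc n))\<^sup>2) - c / 4 * (\<Sum>n<N. (x (Suc n))\<^sup>2)
      - c / 4 * ((\<Sum>n<N. (x (Suc n))\<^sup>2) - (x 1)\<^sup>2 + (x (Suc N))\<^sup>2) - K * (\<Sum>n<N. (f n)\<^sup>2) \<le> q N - q 0"
    unfolding sum_subtractf sum_distrib_left[symmetric] sh .
  then have "c / 2 * (\<Sum>n<N. (x (Suc n))\<^sup>2) \<le> K * (\<Sum>n<N. (f n)\<^sup>2)
      + c / 4 * (x (Suc N))\<^sup>2 - c / 4 * (x 1)\<^sup>2 + q N - q 0"
    by (simp add: algebra_simps)
  also have "\<dots> \<le> K * (\<Sum>n<N. (f n)\<^sup>2) + c / 4 * ((x 0)\<^sup>2 + (x 1)\<^sup>2 + (x N)\<^sup>2 + (x (Suc N))\<^sup>2)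
      + 2 * (D\<^sup>2 + 1) / \<delta> * ((x N)\<^sup>2 + (x (Suc N))\<^sup>2) + 2 * (D\<^sup>2 + 1) / \<delta> * ((x 0)\<^sup>2 + (x 1)\<^sup>2)"
  proof -
    have "0 \<le> c / 4 * ((x 0)\<^sup>2 + (x 1)\<^sup>2 + (x N)\<^sup>2 + (x 1)\<^sup>2)" using c by simp
    moreover have "c / 4 * ((x 0)\<^sup>2 + (x 1)\<^sup>2 + (x N)\<^sup>2 + (x (Suc N))\<^sup>2) =
      c / 4 * ((x 0)\<^sup>2 + (x 1)\<^sup>2 + (x N)\<^sup>2 + (x 1)\<^sup>2) + c / 4 * (x (Suc N))\<^sup>2 - c / 4 * (x 1)\<^sup>2"
      by (simp add: algebra_simps)
    ultimately show ?thesis using qb[of N] qb[of 0] unfolding One_nat_def by linarith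
  qed
  also have "\<dots> = K * (\<Sum>n<N. (f n)\<^sup>2) + M * ((x 0)\<^sup>2 + (x 1)\<^sup>2 + (x N)\<^sup>2 + (x (Suc N))\<^sup>2)"
  proof -
    have "S + c / 4 * (A + B + G + H) + W * (G + H) + W * (A + B) = S + (c / 4 + W) * (A + B + G + H)"
      for S A B G H W :: real by (simp add: distrib_left distrib_right)
    then show ?thesis unfolding M_def .
  qed
  finally show ?thesis .
qed

text \<open>The constants are uniform in the phase, so that the estimate holds on windows that start arbitrarily
  far to the left. The number \<open>N\<close> is the mean number of sheets gained per step.\<close>
definition cone_family :: "real \<Rightarrow> real \<Rightarrow> real \<Rightarrow> real \<Rightarrow> bool" where
  "cone_family \<omega> a b N \<longleftrightarrow> (\<exists>\<delta>>0. \<exists>C. \<forall>\<theta>. \<exists>i r k p.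
     cone_orbit (\<lambda>n. amo_potential 2 \<omega> \<theta> (int n)) a b \<delta> C i r k p \<and>
     (\<forall>n. \<bar>real_of_int (i n) - N * real n\<bar> \<le> C))"

lemma cone_family_bounded_below:
  assumes "cone_family \<omega> a b N" "a < E" "E < b"
  shows "\<exists>c>0. bounded_below 2 \<omega> \<theta> E c"
proof -
  obtain \<delta> C where \<delta>: "\<delta> > 0"
    and orb: "\<And>\<theta>. \<exists>i r k p. cone_orbit (\<lambda>n. amo_potential 2 \<omega> \<theta> (int n)) a b \<delta> C i r k p"
    using assms(1) unfolding cone_family_def by meson
  define \<mu> where "\<mu> = min (E - a) (b - E)"
  have \<mu>: "\<mu> > 0" "a + \<mu> \<le> E" "E + \<mu> \<le> b" using assms by (auto simp: \<mu>_def)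
  define D where "D = C + \<bar>E\<bar> + 2 + 1 / \<delta>"
  define c where "c = \<mu> ^ 3 / (8 * D\<^sup>2)"
  define K where "K = 4 * (D\<^sup>2 + 1) / (\<delta>\<^sup>2 * c) + 1 / \<delta>"
  define M where "M = c / 4 + 2 * (D\<^sup>2 + 1) / \<delta>"
  have "C \<ge> \<delta>" using orb[of 0] unfolding cone_orbit_def by (meson order_trans)
  then have D: "D > 0" using \<delta> unfolding D_def by (smt (verit) divide_pos_pos)
  have c: "c > 0" using \<mu> D by (simp add: c_def)
  have K: "K > 0" using \<delta> c by (simp add: K_def add_pos_pos power2_eq_square add_nonneg_pos)
  let ?J = "jacobi (\<lambda>n. amo_potential 2 \<omega> \<theta> n - E)"
  \<comment> \<open>The window starts at site \<open>- m\<close>, reached by shifting the phase; real and imaginary parts decouple.\<close>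
  have window: "c / 2 * (\<Sum>n<N. (cmod (x (int (Suc n) - m)))\<^sup>2) \<le>
      K * (\<Sum>n<N. (cmod (?J x (int (Suc n) - m)))\<^sup>2)
      + M * ((cmod (x (- m)))\<^sup>2 + (cmod (x (1 - m)))\<^sup>2 + (cmod (x (int N - m)))\<^sup>2 + (cmod (x (int (Suc N) - m)))\<^sup>2)"
    for x :: "int \<Rightarrow> complex" and m N
  proof -
    let ?v = "\<lambda>n. amo_potential 2 \<omega> (\<theta> - \<omega> * of_int m) (int n)"
    obtain i r k p where o: "cone_orbit ?v a b \<delta> C i r k p" using orb by blast
    have v: "\<bar>?v n\<bar> \<le> 2" for n using amo_potential_bound[of 2 \<omega> "\<theta> - \<omega> * of_int m" "int n" 0] by simp
    have vn: "?v n = amo_potential 2 \<omega> \<theta> (int n - m)" for n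
      by (simp add: amo_potential_def algebra_simps)
    note est = cone_orbit_estimate[OF o \<delta> v \<mu>, folded D_def, folded c_def, folded K_def M_def, unfolded vn]
    note re = est[of "\<lambda>n. Re (x (int n - m))" N] and im = est[of "\<lambda>n. Im (x (int n - m))" N]
    have e: "int (Suc (Suc n)) - m = int (Suc n) - m + 1" "int n - m = int (Suc n) - m - 1" for n by simp_all
    have J: "Re (x (int (Suc (Suc n)) - m)) + Re (x (int n - m)) +
       (amo_potential 2 \<omega> \<theta> (int (Suc n) - m) - E) * Re (x (int (Suc n) - m)) = Re (?J x (int (Suc n) - m))"
       "Im (x (int (Suc (Suc n)) - m)) + Im (x (int n - m)) +
       (amo_potential 2 \<omega> \<theta> (int (Suc n) - m) - E) * Im (x (int (Suc n) - m)) = Im (?J x (int (Suc n) - m))" for n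
      unfolding jacobi_def e(1) e(2)[of n] by simp_all
    have s: "(\<Sum>n<N. (cmod (y n))\<^sup>2) = (\<Sum>n<N. (Re (y n))\<^sup>2) + (\<Sum>n<N. (Im (y n))\<^sup>2)" for y :: "nat \<Rightarrow> complex"
      by (simp add: cmod_power2 sum.distrib)
    show ?thesis
      using re im unfolding J s unfolding cmod_power2 by (simp add: algebra_simps)
  qed
  have "c / (2 * K) * nsq x \<le> nsq (?J x)" if x: "x \<in> ell2" for x
  proof -
    have Jx: "?J x \<in> ell2" by (rule jacobi_ell2(1)[OF amo_potential_bound x])
    have dec: "(\<lambda>m. (cmod (x (h m)))\<^sup>2) \<longlonglongrightarrow> 0" if h: "inj h" for h :: "nat \<Rightarrow> int"
    proof (rule summable_LIMSEQ_zero, rule summableI_nonneg_bounded)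
      fix n
      have "(\<Sum>i<n. (cmod (x (h i)))\<^sup>2) = (\<Sum>j\<in>h ` {..<n}. (cmod (x j))\<^sup>2)"
        using h by (subst sum.reindex) (auto intro: inj_on_subset)
      also have "\<dots> \<le> nsq x" by (rule finite_sum_le_nsq[OF x]) auto
      finally show "(\<Sum>i<n. (cmod (x (h i)))\<^sup>2) \<le> nsq x" .
    qed auto
    define \<beta> where "\<beta> m = (cmod (x (- int m)))\<^sup>2 + (cmod (x (1 - int m)))\<^sup>2
       + (cmod (x (int (2 * m) - int m)))\<^sup>2 + (cmod (x (int (Suc (2 * m)) - int m)))\<^sup>2" for m
    have \<beta>: "\<beta> \<longlonglongrightarrow> 0 + 0 + 0 + 0"
      unfolding \<beta>_def by (intro tendsto_add dec) (auto simp: inj_def)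
    have "(\<Sum>n\<in>F. (cmod (x n))\<^sup>2) \<le> (K * nsq (?J x)) / (c / 2)" if F: "finite F" for F
    proof -
      obtain m0 :: nat where m0: "\<And>n. n \<in> F \<Longrightarrow> \<bar>n\<bar> < int m0"
      proof -
        obtain B where "\<And>n. n \<in> F \<Longrightarrow> \<bar>n\<bar> \<le> B"
          using F by (metis finite_imageI bdd_above_finite bdd_above.E image_eqI)
        then show ?thesis using that[of "nat (B + 1)"] by force
      qed
      have le: "c / 2 * (\<Sum>n\<in>F. (cmod (x n))\<^sup>2) \<le> K * nsq (?J x) + M * \<beta> m" if m: "m \<ge> m0" for m
      proof -
        let ?h = "\<lambda>n. int (Suc n) - int m"
        have inj: "inj_on ?h {..<2 * m}" by (auto simp: inj_on_def)
        have "F \<subseteq> ?h ` {..<2 * m}"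
        proof
          fix n assume "n \<in> F"
          then have "n = ?h (nat (n + int m - 1)) \<and> nat (n + int m - 1) < 2 * m"
            using m0[of n] m by auto
          then show "n \<in> ?h ` {..<2 * m}" by blast
        qed
        then have "(\<Sum>n\<in>F. (cmod (x n))\<^sup>2) \<le> (\<Sum>n\<in>?h ` {..<2 * m}. (cmod (x n))\<^sup>2)"
          by (intro sum_mono2) auto
        also have "\<dots> = (\<Sum>n<2 * m. (cmod (x (?h n)))\<^sup>2)" using inj by (simp add: sum.reindex)
        finally have "c / 2 * (\<Sum>n\<in>F. (cmod (x n))\<^sup>2) \<le> c / 2 * (\<Sum>n<2 * m. (cmod (x (?h n)))\<^sup>2)"
          using c by (intro mult_left_mono) auto
        also have "\<dots> \<le> K * (\<Sum>n<2 * m. (cmod (?J x (?h n)))\<^sup>2) + M * \<beta> m"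
          using window[where x=x and N="2 * m" and m="int m"] unfolding \<beta>_def .
        also have "(\<Sum>n<2 * m. (cmod (?J x (?h n)))\<^sup>2) = (\<Sum>n\<in>?h ` {..<2 * m}. (cmod (?J x n))\<^sup>2)"
          using inj by (simp add: sum.reindex)
        also have "\<dots> \<le> nsq (?J x)" by (rule finite_sum_le_nsq[OF Jx]) auto
        finally show ?thesis using K by (smt (verit) mult_left_mono)
      qed
      have "(\<lambda>m. K * nsq (?J x) + M * \<beta> m) \<longlonglongrightarrow> K * nsq (?J x) + M * (0 + 0 + 0 + 0)"
        by (intro tendsto_intros \<beta>)
      then have "c / 2 * (\<Sum>n\<in>F. (cmod (x n))\<^sup>2) \<le> K * nsq (?J x) + M * (0 + 0 + 0 + 0)"
        by (rule LIMSEQ_le_const) (use le in blast)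
      then show ?thesis using c by (simp add: field_simps)
    qed
    then have "nsq x \<le> (K * nsq (?J x)) / (c / 2)" by (rule ell2I(2))
    then show ?thesis using c K by (simp add: field_simps)
  qed
  then show ?thesis
    unfolding bounded_below_def using c K by (intro exI[of _ "c / (2 * K)"]) auto
qed

section \<open>Characteristic polynomials of tridiagonal matrices\<close>

fun jacobi_poly :: "(nat \<Rightarrow> real) \<Rightarrow> nat \<Rightarrow> real poly" where
  "jacobi_poly v 0 = 1"
| "jacobi_poly v (Suc 0) = [:- v 1, 1:]"
| "jacobi_poly v (Suc (Suc n)) = [:- v (n + 2), 1:] * jacobi_poly v (Suc n) - jacobi_poly v n"

definition tridiagonal :: "(nat \<Rightarrow> real) \<Rightarrow> nat \<Rightarrow> real poly mat" where
  "tridiagonal v n = Matrix.mat n n (\<lambda>(i, j).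
     if i = j then [:- v (i + 1), 1:] else if i = j + 1 \<or> j = i + 1 then - 1 else 0)"

lemma det_tridiagonal: "det (tridiagonal v n) = jacobi_poly v n"
proof (induction v n rule: jacobi_poly.induct)
  case (1 v)
  show ?case by (simp add: tridiagonal_def)
next
  case (2 v)
  have "det (tridiagonal v (Suc 0)) = (\<Sum>j<Suc 0. tridiagonal v (Suc 0) $$ (0, j) * cofactor (tridiagonal v (Suc 0)) 0 j)"
    by (rule laplace_expansion_row) (auto simp: tridiagonal_def)
  then show ?case by (simp add: tridiagonal_def cofactor_def mat_delete_def)
next
  case (3 v n)
  let ?T = "tridiagonal v (Suc (Suc n))"
  define B where "B = mat_delete ?T (Suc n) n"
  have 1: "mat_delete ?T (Suc n) (Suc n) = tridiagonal v (Suc n)"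
    by (rule eq_matI) (auto simp: tridiagonal_def mat_delete_def)
  have 2: "mat_delete B n n = tridiagonal v n"
    by (rule eq_matI) (auto simp: B_def tridiagonal_def mat_delete_def)
  have B: "B \<in> carrier_mat (Suc n) (Suc n)" by (auto simp: B_def tridiagonal_def mat_delete_def)
  have "det B = (\<Sum>i<Suc n. B $$ (i, n) * cofactor B i n)"
    by (rule laplace_expansion_column[OF B]) simp
  also have "\<dots> = (\<Sum>i\<in>{n}. B $$ (i, n) * cofactor B i n)"
    by (rule sum.mono_neutral_right) (auto simp: B_def tridiagonal_def mat_delete_def)
  also have "\<dots> = - jacobi_poly v n"
    by (simp add: cofactor_def 2 3) (simp add: B_def tridiagonal_def mat_delete_def)
  finally have B: "det B = - jacobi_poly v n" .
  have "det ?T = (\<Sum>j<Suc (Suc n). ?T $$ (Suc n, j) * cofactor ?T (Suc n) j)"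
    by (rule laplace_expansion_row) (auto simp: tridiagonal_def)
  also have "\<dots> = (\<Sum>j\<in>{n, Suc n}. ?T $$ (Suc n, j) * cofactor ?T (Suc n) j)"
    by (rule sum.mono_neutral_right) (auto simp: tridiagonal_def)
  also have "\<dots> = - 1 * (- det B) + [:- v (n + 2), 1:] * jacobi_poly v (Suc n)"
    by (simp add: cofactor_def 1 3 flip: B_def) (simp add: tridiagonal_def)
  finally show ?case by (simp add: B)
qed

lemma char_poly_amo_restriction:
  "char_poly (amo_restriction b \<omega> \<theta> L) = jacobi_poly (\<lambda>n. amo_potential b \<omega> \<theta> (int n)) L"
proof -
  have "char_poly_matrix (amo_restriction b \<omega> \<theta> L) = tridiagonal (\<lambda>n. amo_potential b \<omega> \<theta> (int n)) L"
    by (rule eq_matI)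
      (auto simp: char_poly_matrix_def amo_restriction_def tridiagonal_def amo_potential_def one_pCons)
  then show ?thesis by (simp add: char_poly_def det_tridiagonal)
qed

section \<open>Interlacing and the Sturm count\<close>

lemma jacobi_poly_monic: "degree (jacobi_poly v n) = n \<and> lead_coeff (jacobi_poly v n) = 1"
proof (induction v n rule: jacobi_poly.induct)
  case (3 v n)
  let ?p = "[:- v (n + 2), 1:] * jacobi_poly v (Suc n)"
  have nz: "jacobi_poly v (Suc n) \<noteq> 0" using 3 by auto
  have d: "degree ?p = Suc (Suc n)" using 3 nz by (subst degree_mult_eq) auto
  have l: "lead_coeff ?p = 1" using 3 by (subst lead_coeff_mult) auto
  have lt: "degree (jacobi_poly v n) < degree ?p" unfolding d using 3 by simp
  have "degree (?p - jacobi_poly v n) = degree ?p"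
    using degree_add_eq_left[of "- jacobi_poly v n" ?p] lt by simp
  moreover have "coeff (jacobi_poly v n) (degree ?p) = 0" using lt by (rule coeff_eq_0)
  ultimately show ?case using d l by simp
qed auto

lemma sign_prod:
  fixes y :: "nat \<Rightarrow> real"
  assumes "finite A" "\<And>k. k \<in> A \<Longrightarrow> y k \<noteq> E"
  shows "0 < (\<Prod>k\<in>A. E - y k) * (- 1) ^ card {k\<in>A. E < y k}"
  using assms
proof (induction A)
  case (insert a A)
  have "{k \<in> insert a A. E < y k} = (if E < y a then insert a {k\<in>A. E < y k} else {k\<in>A. E < y k})"
    by auto
  then have c: "card {k \<in> insert a A. E < y k} = (if E < y a then 1 else 0) + card {k\<in>A. E < y k}"
    using insert by auto
  have "0 < ((E - y a) * (if E < y a then -1 else 1)) * ((\<Prod>k\<in>A. E - y k) * (- 1) ^ card {k\<in>A. E < y k})"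
  proof (rule mult_pos_pos)
    show "0 < (E - y a) * (if E < y a then -1 else 1)" using insert.prems[of a] by auto
  qed (use insert in blast)
  also have "\<dots> = (\<Prod>k\<in>insert a A. E - y k) * (- 1) ^ card {k \<in> insert a A. E < y k}"
    unfolding c prod.insert[OF insert.hyps(1,2)] by simp
  finally show ?case .
qed simp

lemma poly_root_product: "poly (\<Prod>k<n. [:- y k, 1:]) E = (\<Prod>k<n. E - y k)"
  for y :: "nat \<Rightarrow> real"
  by (simp add: poly_prod)

lemma monic_alternating:
  fixes p :: "real poly" and w :: "nat \<Rightarrow> real"
  assumes p: "degree p = m" "lead_coeff p = 1"
    and w: "\<And>k. k < m \<Longrightarrow> w (Suc k) < w k"
    and s: "\<And>k. k \<le> m \<Longrightarrow> 0 < poly p (w k) * (- 1) ^ k"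
  shows "\<exists>z. (\<forall>k<m. w (Suc k) < z k \<and> z k < w k) \<and> p = (\<Prod>k<m. [:- z k, 1:])"
proof -
  have "\<exists>x. w (Suc k) < x \<and> x < w k \<and> poly p x = 0" if k: "k < m" for k
  proof -
    have "poly p (w (Suc k)) * poly p (w k) < 0"
    proof -
      have "0 < (poly p (w k) * (- 1) ^ k) * (poly p (w (Suc k)) * (- 1) ^ Suc k)"
        by (rule mult_pos_pos[OF s s]) (use k in auto)
      also have "\<dots> = - (poly p (w (Suc k)) * poly p (w k)) * ((- 1) ^ k * (- 1) ^ k)"
        by simp
      also have "(- 1) ^ k * (- 1) ^ k = (1 :: real)" by (simp flip: power_mult_distrib)
      finally show ?thesis by simp
    qed
    then show ?thesis using poly_IVT[OF w[OF k]] by auto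
  qed
  then obtain z where z: "\<And>k. k < m \<Longrightarrow> w (Suc k) < z k \<and> z k < w k \<and> poly p (z k) = 0" by metis
  have desc: "z l < z k" if "k < l" "l < m" for k l
    using that
  proof (induction l)
    case (Suc l)
    have "z (Suc l) < z l" using z[of "Suc l"] z[of l] Suc by fastforce
    then show ?case using Suc by (cases "k = l") auto
  qed simp
  have inj: "inj_on z {..<m}"
    by (rule linorder_inj_onI) (use desc in \<open>auto simp: neq_iff\<close>)
  let ?q = "\<Prod>k<m. [:- z k, 1:]"
  have dq: "degree ?q = m" by (simp add: degree_prod_sum_eq)
  have "lead_coeff ?q = (\<Prod>k<m. lead_coeff [:- z k, 1:])" by (rule lead_coeff_prod)
  then have q: "degree ?q = m" "lead_coeff ?q = 1" using dq by simp_all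
  have "p = ?q"
  proof (rule poly_eqI_degree_lead_coeff[where A="z ` {..<m}" and n=m])
    show "coeff p m = coeff ?q m" using p q by simp
    show "m \<le> card (z ` {..<m})" by (simp add: card_image inj)
    show "poly p x = poly ?q x" if "x \<in> z ` {..<m}" for x
      using that z unfolding poly_root_product by (auto simp: prod_zero_iff)
  qed (use p q in auto)
  then show ?thesis using z by blast
qed

lemma monic_sign_far:
  fixes p :: "real poly"
  assumes "degree p = m" "lead_coeff p = 1"
  shows "\<exists>u>c. 0 < poly p u" and "\<exists>u<c. 0 < poly p u * (- 1) ^ m"
proof -
  have gen: "\<exists>u>d. 0 < poly q u" if "lead_coeff q > 0" for q :: "real poly" and d
  proof -
    obtain u0 where "\<And>x. x \<ge> u0 \<Longrightarrow> poly q x \<ge> lead_coeff q" using poly_pinfty_gt_lc[OF \<open>lead_coeff q > 0\<close>] by blast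
    then show ?thesis using that by (intro exI[of _ "max u0 (d + 1)"]) (auto intro: less_le_trans)
  qed
  show "\<exists>u>c. 0 < poly p u" using gen assms by simp
  let ?q = "Polynomial.smult ((- 1) ^ m) (pcompose p [:0, - 1:])"
  have "lead_coeff ?q = 1"
  proof -
    have "lead_coeff (pcompose p [:0, - 1:]) = (- 1) ^ m"
      using assms by (subst lead_coeff_comp) auto
    then show ?thesis unfolding lead_coeff_smult by (simp flip: power_mult_distrib)
  qed
  then obtain u where "u > - c" "0 < poly ?q u" using gen[of ?q "- c"] by auto
  then show "\<exists>u<c. 0 < poly p u * (- 1) ^ m"
    by (intro exI[of _ "- u"]) (auto simp: poly_pcompose mult.commute)
qed

text \<open>The recurrence gives the new polynomial, at a root of its predecessor, minus the value of the
  polynomial two steps before, so that interlacing passes on by the intermediate value theorem.\<close>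
lemma jacobi_poly_interlacing:
  "\<exists>x y. jacobi_poly v (Suc n) = (\<Prod>k<Suc n. [:- x k, 1:]) \<and> jacobi_poly v n = (\<Prod>k<n. [:- y k, 1:]) \<and>
     (\<forall>k<n. x (Suc k) < y k \<and> y k < x k)"
proof (induction n)
  case 0
  show ?case by (rule exI[of _ "\<lambda>_. v 1"]) auto
next
  case (Suc n)
  then obtain x y where px: "jacobi_poly v (Suc n) = (\<Prod>k<Suc n. [:- x k, 1:])"
    and py: "jacobi_poly v n = (\<Prod>k<n. [:- y k, 1:])"
    and xy: "\<And>k. k < n \<Longrightarrow> x (Suc k) < y k \<and> y k < x k" by blast
  let ?p = "jacobi_poly v (Suc (Suc n))"
  have mon: "degree ?p = Suc (Suc n)" "lead_coeff ?p = 1" using jacobi_poly_monic[of v "Suc (Suc n)"] by auto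
  have xdesc: "x l \<le> x k" if "k \<le> l" "l \<le> n" for k l
        using that
  proof (induction l)
    case (Suc l)
    then show ?case using xy[of l] by (cases "k = Suc l") auto
  qed simp
  have sx: "poly ?p (x k) * (- 1) ^ k < 0" if k: "k \<le> n" for k
  proof -
    have root: "poly (jacobi_poly v (Suc n)) (x k) = 0"
      unfolding px poly_root_product using k by (force simp: prod_zero_iff simp del: prod.lessThan_Suc)
    have above: "x k < y j" if "j < k" for j using xy[of j] xdesc[of "Suc j" k] that k by fastforce
    have below: "y j < x k" if "k \<le> j" "j < n" for j using xy[of j] xdesc[of k j] that k by fastforce
    have "{j \<in> {..<n}. x k < y j} = {..<k}"
      using above below k by (force simp: not_less[symmetric])
    then have "0 < poly (jacobi_poly v n) (x k) * (- 1) ^ k"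
      using sign_prod[of "{..<n}" y "x k"] above below unfolding py poly_root_product
      by (metis card_lessThan finite_lessThan lessThan_iff not_less order_less_irrefl)
    then show ?thesis using root by simp
  qed
  obtain hi where hi: "hi > x 0" "0 < poly ?p hi" using monic_sign_far(1)[OF mon] by blast
  obtain lo where lo: "lo < x n" "0 < poly ?p lo * (- 1) ^ Suc (Suc n)" using monic_sign_far(2)[OF mon] by blast
  define w where "w k = (if k = 0 then hi else if k = Suc (Suc n) then lo else x (k - 1))" for k
  have "\<exists>z. (\<forall>k<Suc (Suc n). w (Suc k) < z k \<and> z k < w k) \<and> ?p = (\<Prod>k<Suc (Suc n). [:- z k, 1:])"
  proof (rule monic_alternating[OF mon])
    fix k assume "k < Suc (Suc n)"
    then show "w (Suc k) < w k"
      using hi lo xy[of "k - 1"] by (cases k) (auto simp: w_def)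
  next
    fix k assume k: "k \<le> Suc (Suc n)"
    show "0 < poly ?p (w k) * (- 1) ^ k"
    proof (cases k)
      case 0 then show ?thesis using hi by (simp add: w_def)
    next
      case (Suc l)
      then show ?thesis using k lo sx[of l] by (cases "l = Suc n") (auto simp: w_def simp del: jacobi_poly.simps)
    qed
  qed
  then obtain z where z: "\<And>k. k < Suc (Suc n) \<Longrightarrow> w (Suc k) < z k \<and> z k < w k"
    and pz: "?p = (\<Prod>k<Suc (Suc n). [:- z k, 1:])" by blast
  have "z (Suc k) < x k \<and> x k < z k" if "k < Suc n" for k
    using z[of k] z[of "Suc k"] that by (auto simp: w_def)
  then show ?case using px pz by blast
qed

definition sturm_count :: "(nat \<Rightarrow> real) \<Rightarrow> nat \<Rightarrow> real \<Rightarrow> nat" where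
  "sturm_count v n E = size {#e \<in># proots (jacobi_poly v n). e \<le> E#}"

lemma card_split_threshold:
  fixes y :: "nat \<Rightarrow> real"
  shows "card {k \<in> {..<n}. y k \<le> E} + card {k \<in> {..<n}. E < y k} = card {..<n}"
proof -
  have "{..<n} = {k \<in> {..<n}. y k \<le> E} \<union> {k \<in> {..<n}. E < y k}" by auto
  then have "card {..<n} = card ({k \<in> {..<n}. y k \<le> E} \<union> {k \<in> {..<n}. E < y k})"
    by (rule arg_cong)
  also have "\<dots> = card {k \<in> {..<n}. y k \<le> E} + card {k \<in> {..<n}. E < y k}"
    by (rule card_Un_disjoint) auto
  finally show ?thesis by (rule sym)
qed

lemma sturm_count_product:
  assumes "jacobi_poly v n = (\<Prod>k<n. [:- y k, 1:])"
  shows "sturm_count v n E + card {k \<in> {..<n}. E < y k} = n"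
proof -
  have "proots (jacobi_poly v n) = (\<Sum>k<n. {#y k#})"
    unfolding assms by (subst proots_prod) auto
  also have "\<dots> = image_mset y (mset_set {..<n})" by (induction n) (auto simp: lessThan_Suc)
  finally have "sturm_count v n E = card {k \<in> {..<n}. y k \<le> E}"
    by (simp add: sturm_count_def filter_mset_image_mset)
  moreover have "card {k \<in> {..<n}. y k \<le> E} + card {k \<in> {..<n}. E < y k} = card {..<n}"
    by (rule card_split_threshold)
  ultimately show ?thesis by simp
qed

text \<open>Interlacing lets the number of roots above \<open>E\<close> grow by at most one, so its parity, which is the sign
  of the polynomial at \<open>E\<close>, decides whether it grows.\<close>
lemma sturm_count_Suc:
  assumes "poly (jacobi_poly v n) E \<noteq> 0" "poly (jacobi_poly v (Suc n)) E \<noteq> 0"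
  shows "sturm_count v (Suc n) E = sturm_count v n E +
     (if poly (jacobi_poly v (Suc n)) E / poly (jacobi_poly v n) E > 0 then 1 else 0)"
proof -
  obtain x y where px: "jacobi_poly v (Suc n) = (\<Prod>k<Suc n. [:- x k, 1:])"
    and py: "jacobi_poly v n = (\<Prod>k<n. [:- y k, 1:])"
    and xy: "\<And>k. k < n \<Longrightarrow> x (Suc k) < y k \<and> y k < x k" using jacobi_poly_interlacing[of v n] by blast
  let ?X = "{k \<in> {..<Suc n}. E < x k}" and ?Y = "{k \<in> {..<n}. E < y k}"
  have sx: "0 < poly (jacobi_poly v (Suc n)) E * (- 1) ^ card ?X"
    using assms(2) unfolding px poly_root_product
    by (intro sign_prod) (force simp: prod_zero_iff simp del: prod.lessThan_Suc)+
  have sy: "0 < poly (jacobi_poly v n) E * (- 1) ^ card ?Y"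
    using assms(1) unfolding py poly_root_product
    by (intro sign_prod) (force simp: prod_zero_iff simp del: prod.lessThan_Suc)+
  have "card ?Y \<le> card ?X" by (rule card_mono) (use xy in fastforce)+
  moreover have "card ?X \<le> Suc (card ?Y)"
  proof -
    have "?X \<subseteq> insert 0 (Suc ` ?Y)"
    proof
      fix k assume "k \<in> ?X"
      then show "k \<in> insert 0 (Suc ` ?Y)" using xy[of "k - 1"] by (cases k) force+
    qed
    then have "card ?X \<le> card (insert 0 (Suc ` ?Y))" by (intro card_mono) auto
    also have "\<dots> \<le> Suc (card ?Y)" by (simp add: card_insert_if card_image)
    finally show ?thesis .
  qed
  ultimately consider "card ?X = card ?Y" | "card ?X = Suc (card ?Y)" by linarith
  then have "0 < poly (jacobi_poly v (Suc n)) E / poly (jacobi_poly v n) E \<longleftrightarrow> card ?X = card ?Y"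
  proof cases
    case 1
    then show ?thesis using sx sy by (cases "even (card ?Y)") (auto simp: zero_less_divide_iff)
  next
    case 2
    then show ?thesis using sx sy by (cases "even (card ?Y)") (auto simp: zero_less_divide_iff)
  qed
  then show ?thesis
    using sturm_count_product[OF px, of E] sturm_count_product[OF py, of E] \<open>card ?Y \<le> card ?X\<close> \<open>card ?X \<le> Suc (card ?Y)\<close>
    by auto
qed

section \<open>The integrated density of states\<close>

lemma amo_ids_approx_sturm:
  "amo_ids_approx b \<omega> \<theta> E L = real (sturm_count (\<lambda>n. amo_potential b \<omega> \<theta> (int n)) L E) / real L"
  by (simp add: amo_ids_approx_def sturm_count_def char_poly_amo_restriction)

lemma lexle_trans: "lexle i r j s \<Longrightarrow> lexle j s k t \<Longrightarrow> lexle i r k t"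
  unfolding lexle_def by auto

lemma lexle_step:
  assumes "lexle i r j s" "r \<noteq> 0" "s \<noteq> 0" "e \<le> e'"
  shows "lexle (i + sheet r) (e - 1 / r) (j + sheet s) (e' - 1 / s)"
proof -
  have "i = j \<Longrightarrow> r \<le> s \<Longrightarrow> (r > 0 \<or> s < 0) \<Longrightarrow> 1 / s \<le> 1 / r"
    using assms by (auto intro: divide_left_mono divide_left_mono_neg simp: mult_pos_pos mult_neg_neg)
  moreover have "r > 0 \<Longrightarrow> 1 / r > 0" "s > 0 \<Longrightarrow> 1 / s > 0" "r < 0 \<Longrightarrow> 1 / r < 0" "s < 0 \<Longrightarrow> 1 / s < 0"
    by auto
  ultimately show ?thesis
    using assms unfolding lexle_def sheet_def by (smt (verit))
qed

text \<open>The quotients of successive characteristic polynomials at \<open>E\<close>, with the Sturm count as sheet,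
  form an orbit of the lifted dynamics, so they stay between the two boundaries of the cone.\<close>
lemma sturm_count_cone:
  assumes orb: "cone_orbit v a b \<delta> C i r k p" and \<delta>: "\<delta> > 0" and E: "a \<le> E" "E \<le> b"
    and gen: "\<And>n. poly (jacobi_poly v n) E \<noteq> 0"
  shows "i (Suc n) - i 1 - 1 \<le> int (sturm_count v n E) \<and> int (sturm_count v n E) \<le> k (Suc n) - k 1 + 1"
proof -
  have o: "r n \<noteq> 0" "p n \<noteq> 0"
     "lexle (i (Suc n)) (r (Suc n)) (i n + sheet (r n)) (a - v (Suc n) - 1 / r n)"
     "lexle (k n + sheet (p n)) (b - v (Suc n) - 1 / p n) (k (Suc n)) (p (Suc n))" for n
    using orb \<delta> unfolding cone_orbit_def by (metis abs_zero not_le, metis abs_zero not_le, blast, blast)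
  define q where "q n = poly (jacobi_poly v (Suc n)) E / poly (jacobi_poly v n) E" for n
  have q0: "q n \<noteq> 0" for n using gen by (simp add: q_def del: jacobi_poly.simps)
  have qS: "q (Suc n) = E - v (Suc (Suc n)) - 1 / q n" for n
  proof -
    have "poly (jacobi_poly v (Suc (Suc n))) E =
      (E - v (Suc (Suc n))) * poly (jacobi_poly v (Suc n)) E - poly (jacobi_poly v n) E"
      by (simp add: algebra_simps)
    then show ?thesis using gen[of n] gen[of "Suc n"] by (simp add: q_def diff_divide_distrib del: jacobi_poly.simps)
  qed
  have cS: "int (sturm_count v (Suc n) E) = int (sturm_count v n E) + sheet (q n)" for n
    using sturm_count_Suc[OF gen gen, of n] by (simp add: sheet_def q_def del: jacobi_poly.simps)
  have c0: "sturm_count v 0 E = 0" by (simp add: sturm_count_def)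
  have "lexle (i (Suc n) - i 1 - 1) (r (Suc n)) (int (sturm_count v n E)) (q n) \<and>
        lexle (int (sturm_count v n E)) (q n) (k (Suc n) - k 1 + 1) (p (Suc n))"
  proof (induction n)
    case 0
    show ?case using c0 by (simp add: lexle_def)
  next
    case (Suc n)
    let ?e = "\<lambda>e. e - v (Suc (Suc n))"
    have l: "lexle (i (Suc n) - i 1 - 1 + sheet (r (Suc n))) (?e a - 1 / r (Suc n))
       (int (sturm_count v (Suc n) E)) (q (Suc n))"
      unfolding cS qS by (rule lexle_step) (use Suc o q0 E in auto)
    have u: "lexle (int (sturm_count v (Suc n) E)) (q (Suc n))
       (k (Suc n) - k 1 + 1 + sheet (p (Suc n))) (?e b - 1 / p (Suc n))"
      unfolding cS qS by (rule lexle_step) (use Suc o q0 E in auto)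
    have "lexle (i (Suc (Suc n)) - i 1 - 1) (r (Suc (Suc n)))
       (i (Suc n) - i 1 - 1 + sheet (r (Suc n))) (?e a - 1 / r (Suc n))"
      using o(3)[of "Suc n"] by (auto simp: lexle_def)
    moreover have "lexle (k (Suc n) - k 1 + 1 + sheet (p (Suc n))) (?e b - 1 / p (Suc n))
       (k (Suc (Suc n)) - k 1 + 1) (p (Suc (Suc n)))"
      using o(4)[of "Suc n"] by (auto simp: lexle_def)
    ultimately show ?case using l u lexle_trans by blast
  qed
  then show ?thesis unfolding lexle_def by auto
qed

lemma cone_family_ids:
  assumes cf: "cone_family \<omega> a b N" and E: "a \<le> E" "E \<le> b"
    and gen: "\<And>n. poly (jacobi_poly (\<lambda>n. amo_potential 2 \<omega> \<theta> (int n)) n) E \<noteq> 0"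
  shows "amo_ids_approx 2 \<omega> \<theta> E \<longlonglongrightarrow> N"
proof -
  let ?v = "\<lambda>n. amo_potential 2 \<omega> \<theta> (int n)"
  obtain \<delta> C i r k p where \<delta>: "\<delta> > 0" and orb: "cone_orbit ?v a b \<delta> C i r k p"
    and i: "\<And>n. \<bar>real_of_int (i n) - N * real n\<bar> \<le> C"
    using cf unfolding cone_family_def by meson
  have k: "k n = i n \<or> k n = i n + 1" for n
    using orb unfolding cone_orbit_def lifted_cone_def by blast
  define B where "B = 2 * C + 2 * \<bar>N\<bar> + 3"
  have est: "\<bar>real (sturm_count ?v n E) - N * real n\<bar> \<le> B" for n
  proof -
    have "i (Suc n) - i 1 - 1 \<le> int (sturm_count ?v n E)" "int (sturm_count ?v n E) \<le> i (Suc n) - i 1 + 2"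
      using sturm_count_cone[OF orb \<delta> E gen, of n] k[of "Suc n"] k[of 1] by auto
    then have "real_of_int (i (Suc n)) - real_of_int (i 1) - 1 \<le> real (sturm_count ?v n E)"
       "real (sturm_count ?v n E) \<le> real_of_int (i (Suc n)) - real_of_int (i 1) + 2"
      by linarith+
    moreover have "N * real (Suc n) = N * real n + N" by (simp add: algebra_simps)
    ultimately show ?thesis using i[of "Suc n"] i[of 1] unfolding B_def by linarith
  qed
  have "(\<lambda>n. B / real n) \<longlonglongrightarrow> 0" by (rule lim_const_over_n)
  moreover have "\<forall>\<^sub>F n in sequentially. norm (amo_ids_approx 2 \<omega> \<theta> E n - N) \<le> B / real n"
  proof (rule eventually_mono[OF eventually_gt_at_top[of 0]])
    fix n :: nat assume n: "0 < n"
    then have "amo_ids_approx 2 \<omega> \<theta> E n - N = (real (sturm_count ?v n E) - N * real n) / real n"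
      by (simp add: amo_ids_approx_sturm diff_divide_distrib)
    then show "norm (amo_ids_approx 2 \<omega> \<theta> E n - N) \<le> B / real n"
      using est[of n] n by (simp add: abs_divide divide_right_mono)
  qed
  ultimately have "(\<lambda>n. amo_ids_approx 2 \<omega> \<theta> E n - N) \<longlonglongrightarrow> 0" by (rule Lim_null_comparison[rotated])
  then show ?thesis by (simp add: LIM_zero_iff)
qed

section \<open>Few eigenvalues in a resolvent window\<close>

lemma jacobi_poly_inj_roots:
  "\<exists>y. jacobi_poly v n = (\<Prod>k<n. [:- y k, 1:]) \<and> inj_on y {..<n}"
proof (cases n)
  case (Suc m)
  obtain x y where x: "jacobi_poly v (Suc m) = (\<Prod>k<Suc m. [:- x k, 1:])"
    and xy: "\<And>k. k < m \<Longrightarrow> x (Suc k) < y k \<and> y k < x k"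
    using jacobi_poly_interlacing[of v m] by blast
  have desc: "x l < x k" if "k < l" "l < Suc m" for k l
    using that
  proof (induction l)
    case (Suc l)
    then show ?case using xy[of l] by (cases "k = l") auto
  qed simp
  have "inj_on x {..<Suc m}"
    by (rule linorder_inj_onI) (use desc in \<open>auto simp: neq_iff\<close>)
  then show ?thesis using x Suc by blast
qed auto

lemma sturm_count_card: "sturm_count v n E = card {e. poly (jacobi_poly v n) e = 0 \<and> e \<le> E}"
proof -
  obtain y where y: "jacobi_poly v n = (\<Prod>k<n. [:- y k, 1:])" "inj_on y {..<n}"
    using jacobi_poly_inj_roots by blast
  have "card {k \<in> {..<n}. y k \<le> E} + card {k \<in> {..<n}. E < y k} = card {..<n}"
    by (rule card_split_threshold)
  then have "sturm_count v n E = card {k \<in> {..<n}. y k \<le> E}"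
    using sturm_count_product[OF y(1), of E] by simp
  also have "\<dots> = card (y ` {k \<in> {..<n}. y k \<le> E})"
    using y(2) by (intro card_image[symmetric]) (auto intro: inj_on_subset)
  also have "y ` {k \<in> {..<n}. y k \<le> E} = {e. poly (jacobi_poly v n) e = 0 \<and> e \<le> E}"
    unfolding y(1) poly_root_product by (auto simp: prod_zero_iff)
  finally show ?thesis .
qed

lemma finite_jacobi_poly_roots: "finite {e. poly (jacobi_poly v n) e = 0}"
  using jacobi_poly_monic[of v n] by (intro poly_roots_finite) auto

lemma christoffel_darboux:
  "(e - f) * (\<Sum>n<Suc L. poly (jacobi_poly v n) e * poly (jacobi_poly v n) f) =
     poly (jacobi_poly v (Suc L)) e * poly (jacobi_poly v L) f -
     poly (jacobi_poly v L) e * poly (jacobi_poly v (Suc L)) f"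
proof (induction L)
  case (Suc L)
  have "poly (jacobi_poly v (Suc (Suc L))) e =
      (e - v (Suc (Suc L))) * poly (jacobi_poly v (Suc L)) e - poly (jacobi_poly v L) e" for e
    by (simp add: algebra_simps)
  note r = this[of e] this[of f]
  show ?case
    unfolding sum.lessThan_Suc[of _ "Suc L"] distrib_left Suc.IH r by (simp add: algebra_simps del: jacobi_poly.simps)
qed simp

text \<open>For a root \<open>e\<close>, the extension by zero of the eigenvector with first entry \<open>1\<close>.\<close>
definition dirichlet_vector :: "(nat \<Rightarrow> real) \<Rightarrow> nat \<Rightarrow> real \<Rightarrow> int \<Rightarrow> complex" where
  "dirichlet_vector v L e s =
     (if 1 \<le> s \<and> s \<le> int L then complex_of_real (poly (jacobi_poly v (nat (s - 1))) e) else 0)"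

lemma jacobi_dirichlet_vector:
  assumes L: "L > 0" and e: "poly (jacobi_poly (\<lambda>n. u (int n)) L) e = 0"
  shows "jacobi (\<lambda>n. u n - E) (dirichlet_vector (\<lambda>n. u (int n)) L e) s =
    complex_of_real (e - E) * dirichlet_vector (\<lambda>n. u (int n)) L e s
    + (if s = 0 then 1 else if s = int L + 1 then dirichlet_vector (\<lambda>n. u (int n)) L e (int L) else 0)"
proof -
  let ?v = "\<lambda>n. u (int n)" and ?X = "dirichlet_vector (\<lambda>n. u (int n)) L e"
  consider "s < 0" | "s = 0" | "s = 1" | n where "s = int (Suc (Suc n))" "Suc (Suc n) \<le> L"
    | "s = int L + 1" | "s > int L + 1"
  proof -
    have "s \<ge> 2 \<Longrightarrow> s \<le> int L \<Longrightarrow> s = int (Suc (Suc (nat s - 2))) \<and> Suc (Suc (nat s - 2)) \<le> L" by auto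
    then show ?thesis using that by (smt (verit))
  qed
  then show ?thesis
  proof cases
    case 3
    have "?X 2 = complex_of_real (poly (jacobi_poly ?v 1) e)"
      using e L by (cases "L = 1") (auto simp: dirichlet_vector_def)
    moreover have "L = 1 \<Longrightarrow> u 1 = e" using e by simp
    ultimately show ?thesis using L 3 by (cases "L = 1") (auto simp: jacobi_def dirichlet_vector_def algebra_simps)
  next
    case (4 n)
    have X: "?X (int (Suc m)) = complex_of_real (poly (jacobi_poly ?v m) e)" if "m \<le> L" for m
      using e that by (cases "m = L") (auto simp: dirichlet_vector_def)
    have s: "s + 1 = int (Suc (Suc (Suc n)))" "s - 1 = int (Suc n)" using 4 by simp_all
    have rel: "poly (jacobi_poly ?v (Suc (Suc n))) e + poly (jacobi_poly ?v n) e
        + (u s - E) * poly (jacobi_poly ?v (Suc n)) e = (e - E) * poly (jacobi_poly ?v (Suc n)) e"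
      unfolding 4 by (simp add: algebra_simps)
    have "jacobi (\<lambda>n. u n - E) ?X s = complex_of_real (poly (jacobi_poly ?v (Suc (Suc n))) e
        + poly (jacobi_poly ?v n) e + (u s - E) * poly (jacobi_poly ?v (Suc n)) e)"
      using 4(2) X[of "Suc (Suc n)"] X[of "Suc n"] X[of n] unfolding jacobi_def s 4(1)[symmetric]
      by (simp del: jacobi_poly.simps of_nat_Suc)
    also have "\<dots> = complex_of_real (e - E) * ?X s"
      unfolding rel using 4 X[of "Suc n"] by (simp del: jacobi_poly.simps of_nat_Suc)
    finally show ?thesis using 4 by simp
  qed (use L in \<open>auto simp: jacobi_def dirichlet_vector_def\<close>)
qed

lemma nsq_finite_support:
  assumes "\<And>s. s < 1 \<or> int L < s \<Longrightarrow> x s = 0"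
  shows "x \<in> ell2" and "nsq x = (\<Sum>n<L. (cmod (x (int n + 1)))\<^sup>2)"
proof -
  have "(\<lambda>s. (cmod (x s))\<^sup>2) summable_on {1..int L}" by (rule summable_on_finite) simp
  then show "x \<in> ell2"
    unfolding ell2_def mem_Collect_eq
    by (subst summable_on_cong_neutral[where T="{1..int L}" and g="\<lambda>s. (cmod (x s))\<^sup>2"]) (auto simp: assms)
  have "nsq x = infsum (\<lambda>s. (cmod (x s))\<^sup>2) {1..int L}"
    unfolding nsq_def by (rule infsum_cong_neutral) (auto simp: assms)
  also have "\<dots> = (\<Sum>s\<in>{1..int L}. (cmod (x s))\<^sup>2)" by simp
  also have "\<dots> = (\<Sum>n<L. (cmod (x (int n + 1)))\<^sup>2)"
    by (rule sum.reindex_bij_witness[of _ "\<lambda>n. int n + 1" "\<lambda>s. nat (s - 1)"]) auto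
  finally show "nsq x = (\<Sum>n<L. (cmod (x (int n + 1)))\<^sup>2)" .
qed

lemma nontrivial_combination:
  fixes l1 l2 l3 :: real
  shows "\<exists>c1 c2 c3 :: real. (c1 \<noteq> 0 \<or> c2 \<noteq> 0 \<or> c3 \<noteq> 0) \<and> c1 + c2 + c3 = 0 \<and> c1 * l1 + c2 * l2 + c3 * l3 = 0"
proof (cases "l1 = l2 \<and> l2 = l3")
  case True
  then show ?thesis by (intro exI[of _ 1] exI[of _ "-1"] exI[of _ 0]) auto
next
  case False
  then show ?thesis
    by (intro exI[of _ "l3 - l2"] exI[of _ "l1 - l3"] exI[of _ "l2 - l1"]) (auto simp: algebra_simps)
qed

text \<open>Three eigenvectors of a restriction have a combination that vanishes at both ends of the
  window. Extended by zero it is a test vector for the full operator, and three eigenvalues close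
  to \<open>E\<close> would make it violate the lower bound.\<close>
lemma few_eigenvalues:
  assumes bb: "bounded_below b \<omega> \<theta> E c"
  shows "card {e. poly (jacobi_poly (\<lambda>n. amo_potential b \<omega> \<theta> (int n)) L) e = 0 \<and> (e - E)\<^sup>2 < c} \<le> 2"
proof (rule ccontr)
  let ?u = "amo_potential b \<omega> \<theta>"
  let ?v = "\<lambda>n. ?u (int n)"
  let ?R = "{e. poly (jacobi_poly ?v L) e = 0 \<and> (e - E)\<^sup>2 < c}"
  assume "\<not> card ?R \<le> 2"
  then have "3 \<le> card ?R" by simp
  then obtain T where "T \<subseteq> ?R" "card T = 3" "finite T" by (rule obtain_subset_with_card_n)
  then obtain e f g where ne: "e \<noteq> f" "e \<noteq> g" "f \<noteq> g"
    and roots: "poly (jacobi_poly ?v L) e = 0" "poly (jacobi_poly ?v L) f = 0" "poly (jacobi_poly ?v L) g = 0"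
    and close: "(e - E)\<^sup>2 < c" "(f - E)\<^sup>2 < c" "(g - E)\<^sup>2 < c"
    unfolding card_3_iff by blast
  obtain M where M: "L = Suc M" using roots(1) by (cases L) auto
  let ?P = "\<lambda>n e. poly (jacobi_poly ?v n) e"
  let ?X = "dirichlet_vector ?v L"
  have orth: "(\<Sum>n<L. ?P n x * ?P n y) = 0" if "x \<noteq> y" "?P L x = 0" "?P L y = 0" for x y
    using christoffel_darboux[of x y ?v M] that unfolding M by simp
  have pos: "0 < (\<Sum>n<L. ?P n x * ?P n x)" for x
  proof -
    have "?P 0 x * ?P 0 x \<le> (\<Sum>n<L. ?P n x * ?P n x)" by (rule member_le_sum) (auto simp: M)
    then show ?thesis by simp
  qed
  obtain c1 c2 c3 where nz: "c1 \<noteq> 0 \<or> c2 \<noteq> 0 \<or> c3 \<noteq> 0" and c0: "c1 + c2 + c3 = 0"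
    and cL: "c1 * ?P M e + c2 * ?P M f + c3 * ?P M g = 0"
    using nontrivial_combination by blast
  define comb where "comb x y z s = complex_of_real x * ?X e s + (complex_of_real y * ?X f s + complex_of_real z * ?X g s)" for x y z s
  have comb_sq: "nsq (comb x y z) = x\<^sup>2 * (\<Sum>n<L. ?P n e * ?P n e) + y\<^sup>2 * (\<Sum>n<L. ?P n f * ?P n f) + z\<^sup>2 * (\<Sum>n<L. ?P n g * ?P n g)"
    and comb_ell2: "comb x y z \<in> ell2" for x y z
  proof -
    have supp: "comb x y z s = 0" if "s < 1 \<or> int L < s" for s using that by (auto simp: comb_def dirichlet_vector_def)
    show "comb x y z \<in> ell2" by (rule nsq_finite_support(1)[OF supp])
    have val: "comb x y z (int n + 1) = complex_of_real (x * ?P n e + y * ?P n f + z * ?P n g)" if "n < L" for n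
      using that by (simp add: comb_def dirichlet_vector_def nat_add_distrib)
    have "nsq (comb x y z) = (\<Sum>n<L. (cmod (comb x y z (int n + 1)))\<^sup>2)" by (rule nsq_finite_support(2)[OF supp])
    also have "\<dots> = (\<Sum>n<L. (x * ?P n e + y * ?P n f + z * ?P n g)\<^sup>2)"
      by (intro sum.cong refl) (simp only: lessThan_iff val norm_of_real power2_abs)
    also have "\<dots> = (\<Sum>n<L. x\<^sup>2 * (?P n e * ?P n e) + y\<^sup>2 * (?P n f * ?P n f) + z\<^sup>2 * (?P n g * ?P n g)
       + 2 * x * y * (?P n e * ?P n f) + 2 * x * z * (?P n e * ?P n g) + 2 * y * z * (?P n f * ?P n g))"
      by (intro sum.cong refl) (simp add: power2_eq_square algebra_simps)
    also have "\<dots> = x\<^sup>2 * (\<Sum>n<L. ?P n e * ?P n e) + y\<^sup>2 * (\<Sum>n<L. ?P n f * ?P n f) + z\<^sup>2 * (\<Sum>n<L. ?P n g * ?P n g)"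
      unfolding sum.distrib sum_distrib_left[symmetric] orth[OF ne(1) roots(1,2)] orth[OF ne(2) roots(1,3)] orth[OF ne(3) roots(2,3)]
      by simp
    finally show "nsq (comb x y z) = \<dots>" .
  qed
  have L: "L > 0" using M by simp
  have J: "jacobi (\<lambda>n. ?u n - E) (comb c1 c2 c3) = comb (c1 * (e - E)) (c2 * (f - E)) (c3 * (g - E))"
  proof
    fix s
    have end1: "complex_of_real c1 + (complex_of_real c2 + complex_of_real c3) = 0"
      using arg_cong[OF c0, of complex_of_real] by (simp add: add.assoc)
    have "complex_of_real c1 * complex_of_real (?P M e) + (complex_of_real c2 * complex_of_real (?P M f) + complex_of_real c3 * complex_of_real (?P M g)) = 0"
      using arg_cong[OF cL, of complex_of_real]
      unfolding of_real_add of_real_mult of_real_0 add.assoc .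
    then have end2: "complex_of_real c1 * ?X e (int L) + (complex_of_real c2 * ?X f (int L) + complex_of_real c3 * ?X g (int L)) = 0"
      by (simp add: dirichlet_vector_def M nat_add_distrib)
    have "jacobi (\<lambda>n. ?u n - E) (comb c1 c2 c3) s =
       complex_of_real c1 * jacobi (\<lambda>n. ?u n - E) (?X e) s + (complex_of_real c2 * jacobi (\<lambda>n. ?u n - E) (?X f) s
        + complex_of_real c3 * jacobi (\<lambda>n. ?u n - E) (?X g) s)"
      by (simp add: jacobi_def comb_def algebra_simps)
    also have "\<dots> = comb (c1 * (e - E)) (c2 * (f - E)) (c3 * (g - E)) s"
    proof -
      have alg: "x1 * (d1 * y1 + b1) + (x2 * (d2 * y2 + b2) + x3 * (d3 * y3 + b3)) =
          x1 * d1 * y1 + (x2 * d2 * y2 + x3 * d3 * y3) + (x1 * b1 + (x2 * b2 + x3 * b3))"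
        for x1 d1 y1 b1 x2 d2 y2 b2 x3 d3 y3 b3 :: complex by (simp add: distrib_left)
      have tail: "complex_of_real c1 * (if s = 0 then 1 else if s = int L + 1 then ?X e (int L) else 0)
        + (complex_of_real c2 * (if s = 0 then 1 else if s = int L + 1 then ?X f (int L) else 0)
        + complex_of_real c3 * (if s = 0 then 1 else if s = int L + 1 then ?X g (int L) else 0)) = 0"
        using end1 end2 by simp
      show ?thesis unfolding jacobi_dirichlet_vector[where u="?u", OF L roots(1)]
        jacobi_dirichlet_vector[where u="?u", OF L roots(2)] jacobi_dirichlet_vector[where u="?u", OF L roots(3)] alg tail comb_def of_real_mult by simp
    qed
    finally show "jacobi (\<lambda>n. ?u n - E) (comb c1 c2 c3) s = comb (c1 * (e - E)) (c2 * (f - E)) (c3 * (g - E)) s" .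
  qed
  have lt: "x\<^sup>2 * (y - E)\<^sup>2 * (\<Sum>n<L. ?P n y * ?P n y) \<le> c * x\<^sup>2 * (\<Sum>n<L. ?P n y * ?P n y)"
     "x \<noteq> 0 \<Longrightarrow> x\<^sup>2 * (y - E)\<^sup>2 * (\<Sum>n<L. ?P n y * ?P n y) < c * x\<^sup>2 * (\<Sum>n<L. ?P n y * ?P n y)"
    if "(y - E)\<^sup>2 < c" for x y
  proof -
    have "(y - E)\<^sup>2 * (x\<^sup>2 * (\<Sum>n<L. ?P n y * ?P n y)) \<le> c * (x\<^sup>2 * (\<Sum>n<L. ?P n y * ?P n y))"
      using that pos[of y] by (intro mult_right_mono mult_nonneg_nonneg) auto
    then show "x\<^sup>2 * (y - E)\<^sup>2 * (\<Sum>n<L. ?P n y * ?P n y) \<le> c * x\<^sup>2 * (\<Sum>n<L. ?P n y * ?P n y)"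
      by (simp only: mult_ac)
    assume "x \<noteq> 0"
    then have "(y - E)\<^sup>2 * (x\<^sup>2 * (\<Sum>n<L. ?P n y * ?P n y)) < c * (x\<^sup>2 * (\<Sum>n<L. ?P n y * ?P n y))"
      using that pos[of y] by (intro mult_strict_right_mono mult_pos_pos) auto
    then show "x\<^sup>2 * (y - E)\<^sup>2 * (\<Sum>n<L. ?P n y * ?P n y) < c * x\<^sup>2 * (\<Sum>n<L. ?P n y * ?P n y)"
      by (simp only: mult_ac)
  qed
  have "c * nsq (comb c1 c2 c3) \<le> nsq (comb (c1 * (e - E)) (c2 * (f - E)) (c3 * (g - E)))"
    using bb comb_ell2[of c1 c2 c3] unfolding bounded_below_def J[symmetric] by blast
  then show False
    unfolding comb_sq power_mult_distrib distrib_left mult.assoc[symmetric]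
    using lt[OF close(1), of c1] lt[OF close(2), of c2] lt[OF close(3), of c3] nz by linarith
qed

text \<open>Within a resolvent window the counting functions differ by at most two, which is invisible after
  division by the length.\<close>
lemma ids_locally_constant:
  assumes bb: "bounded_below b \<omega> \<theta> E0 c" and c: "c > 0"
    and E: "(E - E0)\<^sup>2 < c" "(E' - E0)\<^sup>2 < c"
    and lim: "amo_ids_approx b \<omega> \<theta> E \<longlonglongrightarrow> l"
  shows "amo_ids_approx b \<omega> \<theta> E' \<longlonglongrightarrow> l"
proof -
  let ?v = "\<lambda>n. amo_potential b \<omega> \<theta> (int n)"
  have aux: "sturm_count ?v L x \<le> sturm_count ?v L y \<and> sturm_count ?v L y \<le> sturm_count ?v L x + 2"
    if xy: "x \<le> y" "(x - E0)\<^sup>2 < c" "(y - E0)\<^sup>2 < c" for x y L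
  proof -
    let ?R = "\<lambda>x. {e. poly (jacobi_poly ?v L) e = 0 \<and> e \<le> x}"
    have fin: "finite (?R x)" for x by (rule finite_subset[OF _ finite_jacobi_poly_roots[of ?v L]]) auto
    have mono: "?R x \<subseteq> ?R y" using xy by auto
    have "?R y - ?R x \<subseteq> {e. poly (jacobi_poly ?v L) e = 0 \<and> (e - E0)\<^sup>2 < c}"
    proof
      fix e assume "e \<in> ?R y - ?R x"
      then have e: "poly (jacobi_poly ?v L) e = 0" "x < e" "e \<le> y" by auto
      have "\<bar>e - E0\<bar> \<le> max \<bar>x - E0\<bar> \<bar>y - E0\<bar>" using e by auto
      moreover have "\<bar>x - E0\<bar> < sqrt c" "\<bar>y - E0\<bar> < sqrt c" using xy by (auto simp: real_less_rsqrt)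
      ultimately have "\<bar>e - E0\<bar> < sqrt c" by simp
      then have "(e - E0)\<^sup>2 < c" using c by (metis abs_ge_zero power2_abs power_strict_mono real_sqrt_pow2 less_imp_le zero_less_numeral)
      then show "e \<in> {e. poly (jacobi_poly ?v L) e = 0 \<and> (e - E0)\<^sup>2 < c}" using e by blast
    qed
    then have "card (?R y - ?R x) \<le> card {e. poly (jacobi_poly ?v L) e = 0 \<and> (e - E0)\<^sup>2 < c}"
      by (intro card_mono finite_subset[OF _ finite_jacobi_poly_roots[of ?v L]]) auto
    also have "\<dots> \<le> 2" by (rule few_eigenvalues[OF bb])
    finally have "card (?R y - ?R x) \<le> 2" .
    moreover have "card (?R y - ?R x) = card (?R y) - card (?R x)" by (rule card_Diff_subset[OF fin mono])
    moreover have "card (?R x) \<le> card (?R y)" by (rule card_mono[OF fin mono])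
    ultimately show ?thesis unfolding sturm_count_card by linarith
  qed
  have "\<bar>real (sturm_count ?v L E') - real (sturm_count ?v L E)\<bar> \<le> 2" for L
    using aux[of E E' L] aux[of E' E L] E by (cases "E \<le> E'") auto
  then have n: "norm (amo_ids_approx b \<omega> \<theta> E' L - amo_ids_approx b \<omega> \<theta> E L) \<le> 2 / real L" for L
    by (simp add: amo_ids_approx_sturm abs_divide divide_right_mono flip: diff_divide_distrib)
  have "(\<lambda>L. amo_ids_approx b \<omega> \<theta> E' L - amo_ids_approx b \<omega> \<theta> E L) \<longlonglongrightarrow> 0"
    by (rule Lim_null_comparison[OF always_eventually[OF allI[OF n]] lim_const_over_n])
  from tendsto_add[OF this lim] show ?thesis by simp
qed

lemma ids_constant_on_gap:
  assumes G: "connected G" "G \<subseteq> - amo_spectrum b \<omega> \<theta>" and E: "E \<in> G" "E' \<in> G"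
    and lim: "amo_ids_approx b \<omega> \<theta> E \<longlonglongrightarrow> l"
  shows "amo_ids_approx b \<omega> \<theta> E' \<longlonglongrightarrow> l"
proof (rule connected_induction_simple[OF G(1) E, of "\<lambda>E. amo_ids_approx b \<omega> \<theta> E \<longlonglongrightarrow> l", OF lim])
  fix E0 assume E0: "E0 \<in> G"
  then obtain c where c: "c > 0" "bounded_below b \<omega> \<theta> E0 c"
    using G(2) not_in_amo_spectrum_iff[of E0 b \<omega> \<theta>] by blast
  have "openin (top_of_set G) (G \<inter> ball E0 (sqrt c))" by (rule openin_open_Int) simp
  moreover have "E0 \<in> G \<inter> ball E0 (sqrt c)" using E0 c by simp
  moreover have "amo_ids_approx b \<omega> \<theta> y \<longlonglongrightarrow> l"
    if "x \<in> G \<inter> ball E0 (sqrt c)" "y \<in> G \<inter> ball E0 (sqrt c)" "amo_ids_approx b \<omega> \<theta> x \<longlonglongrightarrow> l" for x y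
  proof -
    have sq: "(z - E0)\<^sup>2 < c" if "z \<in> ball E0 (sqrt c)" for z
    proof -
      have "\<bar>z - E0\<bar>\<^sup>2 < (sqrt c)\<^sup>2" using that
        by (intro power_strict_mono) (auto simp: dist_real_def abs_minus_commute)
      then show ?thesis using c by simp
    qed
    show ?thesis using ids_locally_constant[OF c(2,1) sq sq that(3)] that by blast
  qed
  ultimately show "\<exists>T. openin (top_of_set G) T \<and> E0 \<in> T \<and>
      (\<forall>x\<in>T. \<forall>y\<in>T. amo_ids_approx b \<omega> \<theta> x \<longlonglongrightarrow> l \<longrightarrow> amo_ids_approx b \<omega> \<theta> y \<longlonglongrightarrow> l)"
    by blast
qed

text \<open>Only countably many energies are eigenvalues of some restriction, hence some energy of the
  interval is none.\<close>
lemma cone_family_ids_exists: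
  assumes "cone_family \<omega> a b N" "a < b"
  shows "\<exists>E. a < E \<and> E < b \<and> amo_ids_approx 2 \<omega> \<theta> E \<longlonglongrightarrow> N"
proof -
  let ?v = "\<lambda>n. amo_potential 2 \<omega> \<theta> (int n)"
  let ?Z = "\<Union>n. {e. poly (jacobi_poly ?v n) e = 0}"
  have "countable ?Z" by (intro countable_UN countableI_type countable_finite finite_jacobi_poly_roots)
  moreover have "uncountable {a<..<b}" using assms(2) uncountable_open_interval by blast
  ultimately have "\<not> {a<..<b} \<subseteq> ?Z" using countable_subset by blast
  then obtain E where "E \<in> {a<..<b}" "E \<notin> ?Z" by blast
  then show ?thesis using cone_family_ids[OF assms(1), of E] by (intro exI[of _ E]) auto
qed

section \<open>Reflection of the energy\<close>

lemma sheet_minus: "r \<noteq> 0 \<Longrightarrow> sheet (- r) = 1 - sheet r"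
  by (auto simp: sheet_def)

text \<open>Half a turn of the phase changes the sign of the potential, and then \<open>r \<mapsto> - r\<close> conjugates the maps at
  \<open>E\<close> and \<open>- E\<close>. It reverses the orientation, so the two boundaries change places. Of two opposite slopes
  exactly one is positive, so the sheets of the two boundaries add up to the number of steps.\<close>
lemma cone_family_reflect:
  assumes "cone_family \<omega> a b N"
  shows "cone_family \<omega> (- b) (- a) (1 - N)"
proof -
  obtain \<delta> C where \<delta>: "\<delta> > 0"
    and orb: "\<And>\<theta>. \<exists>i r k p. cone_orbit (\<lambda>n. amo_potential 2 \<omega> \<theta> (int n)) a b \<delta> C i r k p \<and>
      (\<forall>n. \<bar>real_of_int (i n) - N * real n\<bar> \<le> C)"
    using assms unfolding cone_family_def by meson
  show ?thesis
    unfolding cone_family_def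
  proof (rule exI[of _ \<delta>], intro conjI exI[of _ "C + 1"] allI)
    show "\<delta> > 0" by fact
    fix \<theta>
    let ?v = "\<lambda>n. amo_potential 2 \<omega> \<theta> (int n)" and ?v' = "\<lambda>n. amo_potential 2 \<omega> (\<theta> + 1 / 2) (int n)"
    obtain i r k p where o: "cone_orbit ?v' a b \<delta> C i r k p" and N: "\<And>n. \<bar>real_of_int (i n) - N * real n\<bar> \<le> C"
      using orb by blast
    have v: "?v' n = - ?v n" for n
    proof -
      have "2 * pi * (\<omega> * of_int (int n) + (\<theta> + 1 / 2)) = 2 * pi * (\<omega> * of_int (int n) + \<theta>) + pi"
        by (simp add: algebra_simps)
      then show ?thesis by (simp only: amo_potential_def cos_periodic_pi mult_minus_right)
    qed
    have k: "k n = i n \<or> k n = i n + 1" for n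
      using o unfolding cone_orbit_def lifted_cone_def by blast
    have "cone_orbit ?v (- b) (- a) \<delta> (C + 1) (\<lambda>n. int n - k n) (\<lambda>n. - p n) (\<lambda>n. int n - i n) (\<lambda>n. - r n)"
      unfolding cone_orbit_def
    proof (intro allI)
      fix n
      have o: "\<delta> \<le> \<bar>r n\<bar>" "\<bar>r n\<bar> \<le> C" "\<delta> \<le> \<bar>p n\<bar>" "\<bar>p n\<bar> \<le> C" "\<delta> \<le> \<bar>p n - r n\<bar>"
        "lifted_cone (i n) (r n) (k n) (p n)"
        "lexle (i (Suc n)) (r (Suc n)) (i n + sheet (r n)) (a - ?v' (Suc n) - 1 / r n)"
        "lexle (k n + sheet (p n)) (b - ?v' (Suc n) - 1 / p n) (k (Suc n)) (p (Suc n))"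
        using o unfolding cone_orbit_def by blast+
      have nz: "r n \<noteq> 0" "p n \<noteq> 0" using o(1,3) \<delta> by auto
      show "\<delta> \<le> \<bar>- p n\<bar> \<and> \<bar>- p n\<bar> \<le> C + 1 \<and> \<delta> \<le> \<bar>- r n\<bar> \<and> \<bar>- r n\<bar> \<le> C + 1 \<and> \<delta> \<le> \<bar>- r n - - p n\<bar> \<and>
        lifted_cone (int n - k n) (- p n) (int n - i n) (- r n) \<and>
        lexle (int (Suc n) - k (Suc n)) (- p (Suc n)) (int n - k n + sheet (- p n)) (- b - ?v (Suc n) - 1 / - p n) \<and>
        lexle (int n - i n + sheet (- r n)) (- a - ?v (Suc n) - 1 / - r n) (int (Suc n) - i (Suc n)) (- r (Suc n))"
        using o unfolding v[of "Suc n"] sheet_minus[OF nz(1)] sheet_minus[OF nz(2)] lifted_cone_def lexle_def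
        by (intro conjI) (auto simp: algebra_simps)
    qed
    moreover have "\<bar>real_of_int (int n - k n) - (1 - N) * real n\<bar> \<le> C + 1" for n
      using N[of n] k[of n] by (auto simp: algebra_simps)
    ultimately show "\<exists>i r k p. cone_orbit ?v (- b) (- a) \<delta> (C + 1) i r k p \<and>
        (\<forall>n. \<bar>real_of_int (i n) - (1 - N) * real n\<bar> \<le> C + 1)"
      by blast
  qed
qed

section \<open>Cone families from Rokhlin towers\<close>

definition potential :: "real \<Rightarrow> real" where
  "potential x = 2 * cos (2 * pi * x)"

lemma potential_shift: "potential (x - of_int z) = potential x"
proof -
  have "cos (2 * pi * x - 2 * pi * of_int z) = cos (2 * pi * x)"
    by (simp add: cos_diff cos_int_2pin sin_int_2pin)
  then show ?thesis by (simp only: potential_def right_diff_distrib)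
qed

lemma amo_potential_eq: "amo_potential 2 \<omega> \<theta> n = potential (\<theta> + of_int n * \<omega>)"
  by (simp add: amo_potential_def potential_def algebra_simps)

text \<open>A state consists of the last point \<open>y\<close> in the base interval, the level \<open>l\<close> above it, and the sheets
  \<open>g\<close> gained in the completed passages.\<close>
definition climb ::
  "real \<Rightarrow> nat \<Rightarrow> int \<Rightarrow> nat \<Rightarrow> int \<Rightarrow> int \<Rightarrow> int \<Rightarrow> real \<times> nat \<times> int \<Rightarrow> real \<times> nat \<times> int" where
  "climb \<omega> h1 p1 h2 p2 K m = (\<lambda>(y, l, g).
     if y \<le> 0 then (if Suc l < h1 then (y, Suc l, g) else (y + (h1 * \<omega> - p1), 0, g + K * p1 + m * int h1))
     else (if Suc l < h2 then (y, Suc l, g) else (y - (p2 - h2 * \<omega>), 0, g + K * p2 + m * int h2)))"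

text \<open>The base interval around \<open>0\<close> carries two towers. A point of its left half
  returns after \<open>h1\<close> steps, displaced to the right, and one of its right half after \<open>h2\<close> steps,
  displaced to the left. It thus suffices to give one cone for each level of the towers. The sheet
  number gained on a return is forced by the displacement, which yields the mean gain per step.\<close>
lemma tower_cone_family:
  fixes \<omega> a b D :: real and h1 h2 :: nat and p1 p2 K m :: int and i R k P :: "nat \<Rightarrow> int"
  assumes h: "h1 > 0" "h2 > 0" and D: "D > 0"
    and d1: "0 < h1 * \<omega> - p1" "h1 * \<omega> - p1 \<le> \<eta>" and d2: "0 < p2 - h2 * \<omega>" "p2 - h2 * \<omega> \<le> \<eta>"
    and H: "H = max h1 h2"
    and nz: "\<And>l. l < H \<Longrightarrow> R l \<noteq> 0 \<and> P l \<noteq> 0 \<and> lifted_cone (i l) (real_of_int (R l) / D) (k l) (real_of_int (P l) / D)"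
    and lo: "\<And>l y. l < H \<Longrightarrow> \<bar>y\<bar> \<le> \<eta> \<Longrightarrow> lexle (i (Suc l)) (R (Suc l) / D)
       (i l + sheet (R l / D)) (a - potential (y + real (Suc l) * \<omega>) - 1 / (R l / D))"
    and up: "\<And>l y. l < H \<Longrightarrow> \<bar>y\<bar> \<le> \<eta> \<Longrightarrow> lexle
       (k l + sheet (P l / D)) (b - potential (y + real (Suc l) * \<omega>) - 1 / (P l / D)) (k (Suc l)) (P (Suc l) / D)"
    and ret1: "lexle (K * p1 + m * int h1 + i 0) (R 0 / D) (i h1) (R h1 / D)"
       "lexle (k h1) (P h1 / D) (K * p1 + m * int h1 + k 0) (P 0 / D)"
    and ret2: "lexle (K * p2 + m * int h2 + i 0) (R 0 / D) (i h2) (R h2 / D)"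
       "lexle (k h2) (P h2 / D) (K * p2 + m * int h2 + k 0) (P 0 / D)"
  shows "cone_family \<omega> a b (K * \<omega> + m)"
proof -
  let ?d1 = "h1 * \<omega> - p1" and ?d2 = "p2 - h2 * \<omega>" and ?N = "K * \<omega> + m"
  let ?step = "climb \<omega> h1 p1 h2 p2 K m"
  define B where "B = (\<Sum>l<H. \<bar>real_of_int (i l)\<bar> + \<bar>R l / D\<bar> + \<bar>P l / D\<bar>)"
  have B: "\<bar>real_of_int (i l)\<bar> + \<bar>R l / D\<bar> + \<bar>P l / D\<bar> \<le> B" if "l < H" for l
    unfolding B_def by (rule member_le_sum[where f="\<lambda>l. \<bar>real_of_int (i l)\<bar> + \<bar>R l / D\<bar> + \<bar>P l / D\<bar>"]) (use that in auto)
  define C where "C = \<bar>real_of_int K\<bar> * (2 * \<eta> + H * \<bar>\<omega>\<bar>) + \<bar>real_of_int m\<bar> * H + B + 1"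
  have \<eta>: "0 < \<eta>" using d1 by linarith
  have BC: "B \<le> C" unfolding C_def using \<eta> by (auto intro!: add_nonneg_nonneg mult_nonneg_nonneg)
  show ?thesis
    unfolding cone_family_def
  proof (rule exI[of _ "1 / D"], intro conjI exI[of _ C] allI)
    show "0 < 1 / D" using D by simp
    fix \<theta> :: real
    \<comment> \<open>Going back \<open>h1\<close> steps at a time moves by less than the length of the base interval, so some earlier
      point of the orbit lies in it.\<close>
    define n0 where "n0 = nat \<lfloor>frac \<theta> / ?d1\<rfloor>"
    define y0 where "y0 = frac \<theta> - real n0 * ?d1"
    define M where "M = n0 * h1"
    have n0: "real n0 = of_int \<lfloor>frac \<theta> / ?d1\<rfloor>"
      using d1 frac_ge_0[of \<theta>] by (simp add: n0_def)
    have y0: "0 \<le> y0" "y0 \<le> ?d1"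
    proof -
      have "real n0 \<le> frac \<theta> / ?d1" "frac \<theta> / ?d1 \<le> real n0 + 1" unfolding n0 by linarith+
      then show "0 \<le> y0" "y0 \<le> ?d1" using d1 by (simp_all add: y0_def field_simps)
    qed
    have y0M: "y0 + real M * \<omega> = \<theta> - of_int (\<lfloor>\<theta>\<rfloor> - int n0 * p1)"
      by (simp add: y0_def M_def frac_def algebra_simps)
    define st where "st t = (?step ^^ t) (y0, 0, 0)" for t
    define Y where "Y t = fst (st t)" for t
    define l where "l t = fst (snd (st t))" for t
    define g where "g t = snd (snd (st t))" for t
    have st: "st t = (Y t, l t, g t)" for t by (simp add: Y_def l_def g_def)
    have stS: "(Y (Suc t), l (Suc t), g (Suc t)) = ?step (Y t, l t, g t)" for t
      unfolding st[symmetric] by (simp add: st_def)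
    have inv: "- ?d2 \<le> Y t \<and> Y t \<le> ?d1 \<and> l t < (if Y t \<le> 0 then h1 else h2) \<and>
       (\<exists>z. Y t + real (l t) * \<omega> = y0 + real t * \<omega> - of_int z \<and> g t = K * z + m * (int t - int (l t)))" for t
    proof (induction t)
      case 0
      have "Y 0 = y0" "l 0 = 0" "g 0 = 0" by (simp_all add: Y_def l_def g_def st_def)
      then show ?case using y0 d1 d2 h by (auto intro!: exI[of _ 0])
    next
      case (Suc t)
      then obtain z where z: "Y t + real (l t) * \<omega> = y0 + real t * \<omega> - of_int z"
         "g t = K * z + m * (int t - int (l t))" by blast
      consider "Y t \<le> 0" "Suc (l t) < h1" | "Y t \<le> 0" "Suc (l t) = h1"
        | "Y t > 0" "Suc (l t) < h2" | "Y t > 0" "Suc (l t) = h2"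
        using Suc by (cases "Y t \<le> 0") (auto, linarith+)
      then show ?case
      proof cases
        case 1
        then have "Y (Suc t) = Y t" "l (Suc t) = Suc (l t)" "g (Suc t) = g t"
          using stS[of t] by (auto simp: climb_def)
        then show ?thesis using Suc 1 z by (auto simp: algebra_simps intro!: exI[of _ z])
      next
        case 2
        then have e: "Y (Suc t) = Y t + ?d1" "l (Suc t) = 0" "g (Suc t) = g t + K * p1 + m * int h1"
          using stS[of t] by (auto simp: climb_def)
        have rh: "real h1 = real (l t) + 1" and ih: "int h1 = int (l t) + 1" using 2 by auto
        have "Y (Suc t) + real (l (Suc t)) * \<omega> = Y t + real h1 * \<omega> - p1" unfolding e by simp
        then have "Y (Suc t) + real (l (Suc t)) * \<omega> = y0 + real (Suc t) * \<omega> - of_int (z + p1)"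
          unfolding rh using z(1) by (simp add: distrib_right)
        moreover have "g (Suc t) = K * (z + p1) + m * (int (Suc t) - int (l (Suc t)))"
          unfolding e z(2) ih by (simp add: algebra_simps)
        ultimately have "\<exists>z. Y (Suc t) + real (l (Suc t)) * \<omega> = y0 + real (Suc t) * \<omega> - of_int z \<and>
            g (Suc t) = K * z + m * (int (Suc t) - int (l (Suc t)))" by blast
        then show ?thesis using Suc 2 d1 d2 h e by auto
      next
        case 3
        then have "Y (Suc t) = Y t" "l (Suc t) = Suc (l t)" "g (Suc t) = g t"
          using stS[of t] by (auto simp: climb_def)
        then show ?thesis using Suc 3 z by (auto simp: algebra_simps intro!: exI[of _ z])
      next
        case 4
        then have e: "Y (Suc t) = Y t - ?d2" "l (Suc t) = 0" "g (Suc t) = g t + K * p2 + m * int h2"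
          using stS[of t] by (auto simp: climb_def)
        have rh: "real h2 = real (l t) + 1" and ih: "int h2 = int (l t) + 1" using 4 by auto
        have "Y (Suc t) + real (l (Suc t)) * \<omega> = Y t + real h2 * \<omega> - p2" unfolding e by simp
        then have "Y (Suc t) + real (l (Suc t)) * \<omega> = y0 + real (Suc t) * \<omega> - of_int (z + p2)"
          unfolding rh using z(1) by (simp add: distrib_right)
        moreover have "g (Suc t) = K * (z + p2) + m * (int (Suc t) - int (l (Suc t)))"
          unfolding e z(2) ih by (simp add: algebra_simps)
        ultimately have "\<exists>z. Y (Suc t) + real (l (Suc t)) * \<omega> = y0 + real (Suc t) * \<omega> - of_int z \<and>
            g (Suc t) = K * z + m * (int (Suc t) - int (l (Suc t)))" by blast
        then show ?thesis using Suc 4 d1 d2 h e by auto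
      qed
    qed
    have lH: "l t < H" for t using inv[of t] unfolding H by (auto split: if_splits)
    have Y\<eta>: "\<bar>Y t\<bar> \<le> \<eta>" for t using inv[of t] d1 d2 by auto
    have pot: "potential (Y t + real (Suc (l t)) * \<omega>) = amo_potential 2 \<omega> \<theta> (int n)" if "Suc t = n + M" for t n
    proof -
      obtain z where z: "Y t + real (l t) * \<omega> = y0 + real t * \<omega> - of_int z" using inv by blast
      have rt: "real t = real n + real M - 1" using that by linarith
      have "y0 + real t * \<omega> + \<omega> = y0 + real M * \<omega> + real n * \<omega>"
        unfolding rt by (simp add: algebra_simps)
      then have "Y t + real (Suc (l t)) * \<omega> = (\<theta> + real n * \<omega>) - of_int (\<lfloor>\<theta>\<rfloor> - int n0 * p1 + z)"
        using z y0M by (simp add: algebra_simps)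
      then show ?thesis by (simp only: potential_shift amo_potential_eq of_int_of_nat_eq)
    qed
    have next_lo: "lexle (g (Suc t) + i (l (Suc t))) (R (l (Suc t)) / D) (g t + i (Suc (l t))) (R (Suc (l t)) / D)"
      and next_up: "lexle (g t + k (Suc (l t))) (P (Suc (l t)) / D) (g (Suc t) + k (l (Suc t))) (P (l (Suc t)) / D)" for t
    proof -
      consider "l (Suc t) = Suc (l t)" "g (Suc t) = g t"
        | "l (Suc t) = 0" "Suc (l t) = h1" "g (Suc t) = g t + K * p1 + m * int h1"
        | "l (Suc t) = 0" "Suc (l t) = h2" "g (Suc t) = g t + K * p2 + m * int h2"
        using stS[of t] inv[of t] by (auto simp: climb_def split: if_splits)
      then show "lexle (g (Suc t) + i (l (Suc t))) (R (l (Suc t)) / D) (g t + i (Suc (l t))) (R (Suc (l t)) / D)"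
        "lexle (g t + k (Suc (l t))) (P (Suc (l t)) / D) (g (Suc t) + k (l (Suc t))) (P (l (Suc t)) / D)"
        using ret1 ret2 by (cases; auto simp: lexle_def)+
    qed
    \<comment> \<open>The sheets gained in the \<open>M\<close> steps before time zero are discarded, to be uniform in the phase.\<close>
    define c where "c = \<lfloor>?N * real M\<rfloor>"
    define i' where "i' n = g (n + M) + i (l (n + M)) - c" for n
    define k' where "k' n = g (n + M) + k (l (n + M)) - c" for n
    define r' where "r' n = R (l (n + M)) / D" for n
    define p' where "p' n = P (l (n + M)) / D" for n
    have "cone_orbit (\<lambda>n. amo_potential 2 \<omega> \<theta> (int n)) a b (1 / D) C i' r' k' p'"
      unfolding cone_orbit_def
    proof (intro allI)
      fix n
      let ?t = "n + M"
      note nzt = nz[OF lH[of ?t]] and Bt = B[OF lH[of ?t]]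
      have big: "1 / D \<le> \<bar>of_int x / D\<bar>" if "x \<noteq> 0" for x :: int
        using that D by (simp add: abs_divide divide_right_mono)
      have ne: "P (l ?t) - R (l ?t) \<noteq> 0" using nzt D by (auto simp: lifted_cone_def)
      have diff: "p' n - r' n = of_int (P (l ?t) - R (l ?t)) / D" by (simp add: p'_def r'_def diff_divide_distrib)
      have bnd: "\<bar>r' n\<bar> \<le> C" "\<bar>p' n\<bar> \<le> C" unfolding r'_def p'_def using Bt BC by linarith+
      have cone: "lifted_cone (i' n) (r' n) (k' n) (p' n)"
        using nzt by (auto simp: lifted_cone_def i'_def r'_def k'_def p'_def)
      have L: "lexle (i' (Suc n)) (r' (Suc n)) (i' n + sheet (r' n)) (a - amo_potential 2 \<omega> \<theta> (int (Suc n)) - 1 / r' n)"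
      proof -
        have "lexle (g ?t + i (Suc (l ?t))) (R (Suc (l ?t)) / D)
            (g ?t + i (l ?t) + sheet (r' n)) (a - amo_potential 2 \<omega> \<theta> (int (Suc n)) - 1 / r' n)"
          using lo[OF lH Y\<eta>, of ?t ?t] pot[of ?t "Suc n"] by (simp add: lexle_def r'_def)
        then show ?thesis using next_lo[of ?t] by (auto simp: lexle_def i'_def r'_def)
      qed
      have U: "lexle (k' n + sheet (p' n)) (b - amo_potential 2 \<omega> \<theta> (int (Suc n)) - 1 / p' n) (k' (Suc n)) (p' (Suc n))"
      proof -
        have "lexle (g ?t + k (l ?t) + sheet (p' n)) (b - amo_potential 2 \<omega> \<theta> (int (Suc n)) - 1 / p' n)
            (g ?t + k (Suc (l ?t))) (P (Suc (l ?t)) / D)"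
          using up[OF lH Y\<eta>, of ?t ?t] pot[of ?t "Suc n"] by (simp add: lexle_def p'_def)
        then show ?thesis using next_up[of ?t] by (auto simp: lexle_def k'_def p'_def)
      qed
      show "1 / D \<le> \<bar>r' n\<bar> \<and> \<bar>r' n\<bar> \<le> C \<and> 1 / D \<le> \<bar>p' n\<bar> \<and> \<bar>p' n\<bar> \<le> C \<and> 1 / D \<le> \<bar>p' n - r' n\<bar> \<and>
        lifted_cone (i' n) (r' n) (k' n) (p' n) \<and>
        lexle (i' (Suc n)) (r' (Suc n)) (i' n + sheet (r' n)) (a - amo_potential 2 \<omega> \<theta> (int (Suc n)) - 1 / r' n) \<and>
        lexle (k' n + sheet (p' n)) (b - amo_potential 2 \<omega> \<theta> (int (Suc n)) - 1 / p' n) (k' (Suc n)) (p' (Suc n))"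
        using cone L U bnd big[of "R (l ?t)"] big[of "P (l ?t)"] big[OF ne] nzt
        unfolding diff by (simp add: r'_def p'_def)
    qed
    moreover have "\<bar>real_of_int (i' n) - ?N * real n\<bar> \<le> C" for n
    proof -
      let ?t = "n + M"
      obtain z where z: "Y ?t + real (l ?t) * \<omega> = y0 + real ?t * \<omega> - of_int z"
        "g ?t = K * z + m * (int ?t - int (l ?t))" using inv by blast
      have "real_of_int (g ?t) - ?N * real ?t = K * (of_int z - real ?t * \<omega>) - m * real (l ?t)"
      proof -
        have "real_of_int (g ?t) = real_of_int (K * z + m * (int ?t - int (l ?t)))" by (simp only: z(2))
        also have "\<dots> = K * real_of_int z + m * (real ?t - real (l ?t))"
          by (simp only: of_int_add of_int_mult of_int_diff of_int_of_nat_eq)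
        finally have eg: "real_of_int (g ?t) = K * real_of_int z + m * (real ?t - real (l ?t))" .
        show ?thesis unfolding eg by (simp add: algebra_simps)
      qed
      also have "of_int z - real ?t * \<omega> = y0 - Y ?t - real (l ?t) * \<omega>" using z(1) by linarith
      finally have e: "real_of_int (g ?t) - ?N * real ?t = K * (y0 - Y ?t - real (l ?t) * \<omega>) - m * real (l ?t)" .
      have lle: "real (l ?t) \<le> real H" using lH[of ?t] by simp
      have "\<bar>y0 - Y ?t - real (l ?t) * \<omega>\<bar> \<le> \<bar>y0\<bar> + \<bar>Y ?t\<bar> + \<bar>real (l ?t) * \<omega>\<bar>" by linarith
      also have "\<bar>real (l ?t) * \<omega>\<bar> \<le> H * \<bar>\<omega>\<bar>" unfolding abs_mult using lle by (intro mult_mono) auto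
      finally have "\<bar>y0 - Y ?t - real (l ?t) * \<omega>\<bar> \<le> 2 * \<eta> + H * \<bar>\<omega>\<bar>"
        using Y\<eta>[of ?t] y0 d1 by auto
      then have 1: "\<bar>K * (y0 - Y ?t - real (l ?t) * \<omega>)\<bar> \<le> \<bar>real_of_int K\<bar> * (2 * \<eta> + H * \<bar>\<omega>\<bar>)"
        unfolding abs_mult by (intro mult_left_mono) auto
      have 2: "\<bar>m * real (l ?t)\<bar> \<le> \<bar>real_of_int m\<bar> * H"
        unfolding abs_mult using lle by (intro mult_mono) auto
      have 3: "\<bar>real_of_int (i (l ?t))\<bar> \<le> B" using B[OF lH[of ?t]] by linarith
      have 4: "\<bar>?N * real M - of_int c\<bar> \<le> 1" unfolding c_def by linarith
      have "real_of_int (i' n) - ?N * real n = (real_of_int (g ?t) - ?N * real ?t) + i (l ?t) + (?N * real M - of_int c)"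
        by (simp add: i'_def algebra_simps)
      then show ?thesis unfolding e C_def using 1 2 3 4 by linarith
    qed
    ultimately show "\<exists>i r k p. cone_orbit (\<lambda>n. amo_potential 2 \<omega> \<theta> (int n)) a b (1 / D) C i r k p \<and>
        (\<forall>n. \<bar>real_of_int (i n) - ?N * real n\<bar> \<le> C)"
      by blast
  qed
qed

section \<open>Numerical bounds\<close>

lemma e_bounds: "2.7182818284 < exp (1::real)" "exp (1::real) < 2.7182818285"
proof -
  obtain t :: real where t: "\<bar>t\<bar> \<le> \<bar>1\<bar>" and e: "exp 1 = (\<Sum>m<15. 1 ^ m / fact m) + exp t / fact 15 * 1 ^ 15"
    using Maclaurin_exp_le[of 1 15] by blast
  have t3: "exp t \<le> 3" using t exp_le by (smt (verit) exp_le_cancel_iff)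
  have t0: "exp t > 0" by simp
  have s: "(\<Sum>m<15. 1 ^ m / fact m) = (47395032961 / 17435658240 :: real)"
    by (simp add: eval_nat_numeral fact_Suc)
  have f: "fact 15 = (1307674368000 :: real)" by (simp add: eval_nat_numeral fact_Suc)
  show "2.7182818284 < exp (1::real)" unfolding e s f by (simp, use t0 in linarith)
  show "exp (1::real) < 2.7182818285" unfolding e s f by (simp, use t3 in linarith)
qed

text \<open>Comparing Taylor polynomials of the sine with \<open>sin (pi / 6) = 1 / 2\<close> locates \<open>pi / 6\<close>.\<close>
lemma pi_bounds: "3.14159265 < pi" "pi < 3.1415926537"
proof -
  have sum: "(\<Sum>m<12. sin_coeff m * x ^ m) = x - x ^ 3 / 6 + x ^ 5 / 120 - x ^ 7 / 5040 + x ^ 9 / 362880 - x ^ 11 / 39916800" for x :: real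
    by (simp add: eval_nat_numeral sin_coeff_Suc cos_coeff_Suc)
  have f: "fact 12 = (479001600 :: real)" by (simp add: eval_nat_numeral fact_Suc)
  note bound = Maclaurin_sin_bound[of _ 12, unfolded sum f]
  have 1: "sin (0.523598775 :: real) < sin (pi / 6)"
    using abs_le_D1[OF bound[of "0.523598775"]] unfolding sin_30 by (simp add: power_divide)
  have 2: "sin (pi / 6) < sin (0.52359877561 :: real)"
    using abs_le_D2[OF bound[of "0.52359877561"]] unfolding sin_30 by (simp add: power_divide)
  have "(0.523598775 :: real) < pi / 6"
    using 1 pi_gt3 by (subst sin_mono_less_eq[symmetric]) auto
  then show "3.14159265 < pi" by simp
  have "pi / 6 < (0.52359877561 :: real)"
    using 2 pi_gt3 by (subst sin_mono_less_eq[symmetric]) auto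
  then show "pi < 3.1415926537" by simp
qed

lemma cos_diff_le: "\<bar>cos x - cos y\<bar> \<le> \<bar>x - y\<bar>" for x y :: real
proof -
  have "\<bar>cos x - cos y\<bar> = 2 * (\<bar>sin ((x + y) / 2)\<bar> * \<bar>sin ((y - x) / 2)\<bar>)"
    by (simp add: cos_diff_cos abs_mult)
  also have "\<dots> \<le> 2 * (1 * \<bar>(y - x) / 2\<bar>)"
    by (intro mult_left_mono mult_mono abs_sin_x_le_abs_x abs_sin_le_one) auto
  finally show ?thesis by simp
qed

lemma sin_diff_le: "\<bar>sin x - sin y\<bar> \<le> \<bar>x - y\<bar>" for x y :: real
  using cos_diff_le[of "pi / 2 - x" "pi / 2 - y"] by (simp add: cos_diff abs_minus_commute)

definition \<omega>e :: real where "\<omega>e = exp 1 - 2"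

lemma \<omega>e_bounds: "0.7182818284 < \<omega>e" "\<omega>e < 0.7182818285"
  using e_bounds by (simp_all add: \<omega>e_def)

text \<open>The rotation by \<open>2 * pi * \<omega>e\<close>, scaled by \<open>10 ^ 8\<close> and rounded to Gaussian integers. The angle
  is three quarters of a turn minus about a fifth of a radian, where Taylor polynomials are accurate.\<close>
lemma rotation_bounds:
  "\<bar>10 ^ 8 * cos (2 * pi * \<omega>e) + 19797456\<bar> \<le> 0.2" "\<bar>10 ^ 8 * sin (2 * pi * \<omega>e) + 98020716\<bar> \<le> 0.3"
proof -
  define x where "x = 2 * pi * \<omega>e - 3 * pi / 2"
  let ?x0 = "- 0.1992911492 :: real"
  define u where "u = 2 * pi * (0.75 - \<omega>e)"
  have "2 * 3.14159265 * (0.75 - 0.7182818285) \<le> u"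
    unfolding u_def using pi_bounds \<omega>e_bounds by (intro mult_mono) auto
  moreover have "u \<le> 2 * 3.1415926537 * (0.75 - 0.7182818284)"
    unfolding u_def using pi_bounds \<omega>e_bounds by (intro mult_mono) auto
  moreover have "x = - u" by (simp add: x_def u_def algebra_simps)
  ultimately have x: "\<bar>x - ?x0\<bar> \<le> 0.000000001" by (intro abs_leI; simp)
  have angle: "2 * pi * \<omega>e = x + 3 / 2 * pi" by (simp add: x_def)
  have c: "cos (2 * pi * \<omega>e) = sin x" and s: "sin (2 * pi * \<omega>e) = - cos x"
    unfolding angle cos_add sin_add cos_3over2_pi sin_3over2_pi by simp_all
  have f: "fact 8 = (40320 :: real)" by (simp add: eval_nat_numeral fact_Suc)
  have ssum: "(\<Sum>m<8. sin_coeff m * y ^ m) = y - y ^ 3 / 6 + y ^ 5 / 120 - y ^ 7 / 5040" for y :: real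
    by (simp add: eval_nat_numeral sin_coeff_Suc cos_coeff_Suc)
  have csum: "(\<Sum>m<8. cos_coeff m * y ^ m) = 1 - y ^ 2 / 2 + y ^ 4 / 24 - y ^ 6 / 720" for y :: real
    by (simp add: eval_nat_numeral sin_coeff_Suc cos_coeff_Suc)
  note bound = Maclaurin_sin_bound[of ?x0 8, unfolded ssum f]
  have "\<bar>sin ?x0 + 0.19797456\<bar> \<le> 0.0000000005"
    using abs_le_D1[OF bound] abs_le_D2[OF bound] by (intro abs_leI; simp add: power_divide)
  then show "\<bar>10 ^ 8 * cos (2 * pi * \<omega>e) + 19797456\<bar> \<le> 0.2"
    unfolding c using order_trans[OF sin_diff_le x] by (simp add: abs_if split: if_splits)
  obtain t where "cos ?x0 = (\<Sum>m<8. cos_coeff m * ?x0 ^ m) + (cos (t + 1/2 * real 8 * pi) / fact 8) * ?x0 ^ 8"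
    using Maclaurin_cos_expansion by blast
  then have "\<bar>cos ?x0 - (\<Sum>m<8. cos_coeff m * ?x0 ^ m)\<bar> = \<bar>cos (t + 1/2 * real 8 * pi)\<bar> * (\<bar>?x0\<bar> ^ 8 / 40320)"
    unfolding f by (simp add: abs_mult abs_divide power_abs)
  also have "\<dots> \<le> 1 * (\<bar>?x0\<bar> ^ 8 / 40320)" by (intro mult_right_mono abs_cos_le_one) auto
  finally have bound: "\<bar>cos ?x0 - (\<Sum>m<8. cos_coeff m * ?x0 ^ m)\<bar> \<le> 1 * (\<bar>?x0\<bar> ^ 8 / 40320)" .
  have "\<bar>cos ?x0 - 0.98020716\<bar> \<le> 0.0000000017"
    using abs_le_D1[OF bound] abs_le_D2[OF bound] unfolding csum by (intro abs_leI; simp add: power_divide)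
  then show "\<bar>10 ^ 8 * sin (2 * pi * \<omega>e) + 98020716\<bar> \<le> 0.3"
    unfolding s using order_trans[OF cos_diff_le x] by (simp add: abs_if split: if_splits)
qed

section \<open>A table of the potential\<close>

text \<open>The values of \<open>10 ^ 4 * potential\<close> at the points \<open>\<omega>e, 2 * \<omega>e, \<dots>, 536 * \<omega>e\<close>, rounded. The first part
  covers the levels of the lower tower.\<close>
definition table1 :: "int list" where
  "table1 =
    [-3959, -18432, 11258, 13975, -16791, -7326, 19692, -471, -19506, 8194, 16261, -14632,
     -10468, 18777, 3033, -19978, 4877, 18047, -12023, -13286, 17284, 6443, -19835, 1411,
     19276, -9043, -15695, 15258, 9654, -19080, -2099, 19911, -5785, -17621, 12762, 12568,
     -17738, -5545, 19933, -2348, -19004, 9872, 15095, -15849, -8819, 19341, 1161, -19801,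
     6679, 17156, -13472, -11822, 18153, 4635, -19988, 3280, 18689, -10680, -14461, 16406,
     7965, -19559, -221, 19647, -7559, -16654, 14153, 11050, -18528, -3714, 19998, -4204,
     -18334, 11464, 13795, -16926, -7093, 19734, -721, -19449, 8421, 16114, -14802, -10254,
     18862, 2785, -19965, 5120, 17937, -12222, -13098, 17408, 6205, -19865, 1660, 19208,
     -9265, -15539, 15418, 9434, -19154, -1850, 19886, -6024, -17501, 12953, 12373, -17852,
     -5304, 19952, -2596, -18924, 10089, 14930, -16000, -8594, 19403, 911, -19764, 6914,
     17027, -13656, -11620, 18257, 4391, -19995, 3526, 18599, -10890, -14287, 16547, 7735,
     -19610, 30, 19598, -7789, -16514, 14328, 10841, -18621, -3468, 19994, -4448, -18232,
     11668, 13613, -17057, -6859, 19773, -970, -19389, 8647, 15965, -14969, -10038, 18943,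
     2537, -19948, 5361, 17825, -12419, -12908, 17530, 5967, -19893, 1909, 19137, -9486,
     -15381, 15576, 9213, -19224, -1601, 19858, -6262, -17379, 13143, 12175, -17963, -5062,
     19968, -2844, -18842, 10304, 14762, -16149, -8368, 19462, 662, -19724, 7148, 16894,
     -13837, -11415, 18357, 4147, -19999, 3772, 18506, -11099, -14111, 16686, 7504, -19658,
     280, 19547, -8019, -16372, 14502, 10630, -18710, -3221, 19986, -4692, -18128, 11870,
     13428, -17187, -6623, 19809, -1220, -19326, 8872, 15813, -15133, -9821, 19022, 2289,
     -19929, 5601, 17711, -12614, -12716, 17649, 5728, -19917, 2158, 19062, -9706, -15219,
     15732, 8990, -19292, -1352, 19827, -6499, -17254, 13330, 11976, -18072, -4820, 19981,
     -3091, -18757, 10518, 14592, -16296, -8140, 19519, 412, -19681, 7381, 16759, -14017,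
     -11209, 18455, 3902, -20000, 4017, 18409, -11306, -13932, 16823, 7271, -19702, 530,
     19492, -8248, -16227, 14673, 10417, -18797, -2974, 19975, -4935, -18021, 12070, 13242,
     -17313, -6387, 19842, -1470, -19260, 9096, 15659, -15296, -9602, 19098, 2041, -19906,
     5841, 17593, -12807, -12522, 17765, 5488, -19938, 2407, 18985, -9924, -15056, 15885,
     8766, -19356, -1102, 19793, -6735, -17126, 13516, 11775, -18178, -4577, 19990, -3338,
     -18668, 10730, 14420, -16439, -7911, 19572, 162, -19635, 7613, 16621, -14194, -11001,
     18550, 3656, -19998, 4262, 18310, -11512, -13752, 16957, 7038, -19744, 780, 19435,
     -8475, -16079, 14841, 10203, -18881, -2727, 19961, -5177, -17911, 12269, 13053, -17437,
     -6149, 19872, -1719, -19191, 9318, 15502, -15456, -9382, 19171, 1792, -19880, 6080,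
     17473, -12998, -12326, 17879, 5247, -19956, 2655, 18905, -10140, -14890, 16036, 8541,
     -19418, -852, 19755, -6970, -16996, 13699, 11571, -18281, -4333, 19996, -3584, -18577,
     10940, 14246, -16580, -7681, 19621, -89, -19586, 7844, 16481, -14369, -10791, 18642,
     3410, -19992, 4506, 18208, -11715, -13569, 17088, 6803, -19782, 1029, 19374, -8701,
     -15929, 15008, 9987, -18962, -2479, 19944, -5418, -17799, 12465, 12863, -17558, -5911,
     19899, -1968, -19119, 9538, 15343, -15613, -9161, 19240, 1542, -19851, 6318, 17350,
     -13187, -12128, 17989, 5005, -19971, 2902, 18822, -10355, -14722, 16184, 8314, -19476,
     -603, 19715, -7203, -16862, 13880, 11367, -18381, -4089, 20000]"

definition table2 :: "int list" where
  "table2 =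
    [-3830, -18483, 11148, 14069, -16719, -7449, 19668, -339, -19534, 8073, 16338, -14542,
     -10580, 18731, 3163, -19984, 4749, 18103, -11917, -13384, 17217, 6567, -19817, 1279,
     19311, -8925, -15777, 15172, 9769, -19040, -2231, 19923, -5658, -17683, 12660, 12670,
     -17677, -5671, 19922, -2217, -19044, 9757, 15181, -15768, -8938, 19307, 1293, -19819,
     6554, 17224, -13374, -11928, 18097, 4763, -19983, 3149, 18736, -10568, -14552, 16330,
     8086, -19531, -353, 19671, -7436, -16727, 14059, 11160, -18478, -3844, 20000]"

definition rotate_int :: "int \<times> int \<Rightarrow> int \<times> int" where
  "rotate_int = (\<lambda>(c, s). ((c * (- 19797456) - s * (- 98020716)) div 100000000,
                        (s * (- 19797456) + c * (- 98020716)) div 100000000))"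

text \<open>The tolerance \<open>6000\<close> at scale \<open>10 ^ 8\<close> is the rounding of the table to the scale \<open>10 ^ 4\<close>.\<close>
fun check_table :: "int \<times> int \<Rightarrow> int list \<Rightarrow> bool" where
  "check_table z [] = True"
| "check_table z (v # vs) = (let z' = rotate_int z in
     abs (10000 * v - 2 * fst z') \<le> 6000 \<and> check_table z' vs)"

lemma table_checked: "check_table (100000000, 0) (table1 @ table2)"
  by code_simp

lemma table_length: "length table1 = 465" "length table2 = 71"
  by (simp_all add: table1_def table2_def)

lemma div_bounds:
  fixes x y :: int
  shows "real_of_int (x div y) \<le> real_of_int x / real_of_int y"
    and "real_of_int x / real_of_int y \<le> real_of_int (x div y) + 1"
  unfolding floor_divide_of_int_eq[where 'a=real, symmetric] by linarith+

text \<open>Each step adds at most \<open>2\<close> for the rounded rotation angle, as \<open>z\<close> has modulus at most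
  \<open>2 * 10 ^ 8\<close>, and \<open>2\<close> for the two integer divisions.\<close>
lemma rotate_int_error:
  fixes c s :: int
  defines "z \<equiv> Complex (of_int c) (of_int s)" and "w \<equiv> cis (2 * pi * \<omega>e)"
  assumes err: "cmod (z - 10 ^ 8 * u) \<le> \<epsilon>" "\<epsilon> \<le> 10 ^ 8" and u: "cmod u = 1"
    and z': "rotate_int (c, s) = (c', s')"
  shows "cmod (Complex (of_int c') (of_int s') - 10 ^ 8 * (u * w)) \<le> \<epsilon> + 4"
proof -
  define z1 where "z1 = Complex (- 19797456) (- 98020716)"
  define \<rho> where "\<rho> = Complex (of_int c') (of_int s') - z * z1 / 10 ^ 8"
  have "cmod (z1 - 10 ^ 8 * w) \<le> \<bar>Re (z1 - 10 ^ 8 * w)\<bar> + \<bar>Im (z1 - 10 ^ 8 * w)\<bar>" by (rule cmod_le)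
  also have "\<dots> \<le> 1"
  proof -
    have "Re (z1 - 10 ^ 8 * w) = - (10 ^ 8 * cos (2 * pi * \<omega>e) + 19797456)"
      "Im (z1 - 10 ^ 8 * w) = - (10 ^ 8 * sin (2 * pi * \<omega>e) + 98020716)"
      by (simp_all add: z1_def w_def)
    then show ?thesis using rotation_bounds unfolding \<open>Re _ = _\<close> \<open>Im _ = _\<close> abs_minus_cancel by simp
  qed
  finally have w1: "cmod (z1 - 10 ^ 8 * w) \<le> 1" .
  have "cmod \<rho> \<le> \<bar>Re \<rho>\<bar> + \<bar>Im \<rho>\<bar>" by (rule cmod_le)
  also have "\<dots> \<le> 1 + 1"
  proof (rule add_mono)
    have c': "c' = (c * (- 19797456) - s * (- 98020716)) div 100000000"
      "s' = (s * (- 19797456) + c * (- 98020716)) div 100000000"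
      using z' by (simp_all add: rotate_int_def)
    have re: "Re \<rho> = of_int c' - real_of_int (c * (- 19797456) - s * (- 98020716)) / real_of_int 100000000"
      "Im \<rho> = of_int s' - real_of_int (s * (- 19797456) + c * (- 98020716)) / real_of_int 100000000"
      by (simp_all add: \<rho>_def z_def z1_def)
    show "\<bar>Re \<rho>\<bar> \<le> 1" unfolding re c' using div_bounds[of "c * (- 19797456) - s * (- 98020716)" 100000000]
      by linarith
    show "\<bar>Im \<rho>\<bar> \<le> 1" unfolding re c' using div_bounds[of "s * (- 19797456) + c * (- 98020716)" 100000000]
      by linarith
  qed
  finally have \<rho>: "cmod \<rho> \<le> 2" by simp
  have cw: "cmod w = 1" by (simp add: w_def)
  have "cmod z \<le> cmod (z - 10 ^ 8 * u) + cmod (10 ^ 8 * u)" by (metis diff_add_cancel norm_triangle_ineq)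
  also have "\<dots> \<le> 2 * 10 ^ 8" using err u by (simp add: norm_mult)
  finally have z: "cmod z \<le> 2 * 10 ^ 8" .
  have "Complex (of_int c') (of_int s') - 10 ^ 8 * (u * w) =
      (z - 10 ^ 8 * u) * w + (z * ((z1 - 10 ^ 8 * w) / 10 ^ 8) + \<rho>)"
    by (simp add: \<rho>_def field_simps)
  also have "cmod \<dots> \<le> cmod ((z - 10 ^ 8 * u) * w) + cmod (z * ((z1 - 10 ^ 8 * w) / 10 ^ 8) + \<rho>)"
    by (rule norm_triangle_ineq)
  also have "\<dots> \<le> cmod ((z - 10 ^ 8 * u) * w) + (cmod (z * ((z1 - 10 ^ 8 * w) / 10 ^ 8)) + cmod \<rho>)"
    by (intro add_left_mono norm_triangle_ineq)
  also have "cmod ((z - 10 ^ 8 * u) * w) \<le> \<epsilon>" using err cw by (simp add: norm_mult)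
  also have "cmod (z * ((z1 - 10 ^ 8 * w) / 10 ^ 8)) \<le> 2 * 10 ^ 8 * (1 / 10 ^ 8)"
    unfolding norm_mult using z w1 by (intro mult_mono) (auto simp: norm_divide)
  finally show ?thesis using \<rho> by simp
qed

lemma check_table_sound:
  assumes "check_table (c, s) vs"
    and "cmod (Complex (of_int c) (of_int s) - 10 ^ 8 * cis (2 * pi * (real n * \<omega>e))) \<le> 4 * real n"
    and "real (n + length vs) \<le> 1000000"
  shows "\<forall>j<length vs. \<bar>10 ^ 4 * real_of_int (vs ! j) - 10 ^ 8 * potential (real (n + Suc j) * \<omega>e)\<bar> \<le> 6000 + 8 * real (n + Suc j)"
  using assms
proof (induction vs arbitrary: c s n)
  case (Cons v vs)
  obtain c' s' where z': "rotate_int (c, s) = (c', s')" by force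
  have "cmod (Complex (of_int c') (of_int s') - 10 ^ 8 * (cis (2 * pi * (real n * \<omega>e)) * cis (2 * pi * \<omega>e))) \<le> 4 * real n + 4"
    by (rule rotate_int_error[OF Cons.prems(2) _ _ z']) (use Cons.prems(3) in auto)
  also have "cis (2 * pi * (real n * \<omega>e)) * cis (2 * pi * \<omega>e) = cis (2 * pi * (real (Suc n) * \<omega>e))"
    by (simp add: cis_mult algebra_simps)
  finally have err: "cmod (Complex (of_int c') (of_int s') - 10 ^ 8 * cis (2 * pi * (real (Suc n) * \<omega>e))) \<le> 4 * real (Suc n)"
    by simp
  have "\<bar>Re (Complex (of_int c') (of_int s') - 10 ^ 8 * cis (2 * pi * (real (Suc n) * \<omega>e)))\<bar> \<le> 4 * real (Suc n)"
    using abs_Re_le_cmod err by (rule order_trans)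
  then have re: "\<bar>of_int c' - 10 ^ 8 * cos (2 * pi * (real (Suc n) * \<omega>e))\<bar> \<le> 4 * real (Suc n)"
    by simp
  have v: "\<bar>10000 * v - 2 * c'\<bar> \<le> 6000" and rest: "check_table (c', s') vs"
    using Cons.prems(1) by (simp_all add: z')
  have "real_of_int \<bar>10000 * v - 2 * c'\<bar> \<le> real_of_int 6000" using v by (simp only: of_int_le_iff)
  then have v': "\<bar>10000 * real_of_int v - 2 * real_of_int c'\<bar> \<le> 6000" by simp
  have first: "\<bar>10 ^ 4 * real_of_int v - 10 ^ 8 * potential (real (Suc n) * \<omega>e)\<bar> \<le> 6000 + 8 * real (Suc n)"
    unfolding potential_def using re v' by (simp add: abs_le_iff)
  have IH: "\<forall>j<length vs. \<bar>10 ^ 4 * real_of_int (vs ! j) - 10 ^ 8 * potential (real (Suc n + Suc j) * \<omega>e)\<bar> \<le> 6000 + 8 * real (Suc n + Suc j)"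
    by (rule Cons.IH[OF rest err]) (use Cons.prems(3) in auto)
  show ?case
  proof (intro allI impI)
    fix j assume j: "j < length (v # vs)"
    show "\<bar>10 ^ 4 * real_of_int ((v # vs) ! j) - 10 ^ 8 * potential (real (n + Suc j) * \<omega>e)\<bar> \<le> 6000 + 8 * real (n + Suc j)"
    proof (cases j)
      case 0 then show ?thesis using first by simp
    next
      case (Suc l) then show ?thesis using IH j by (auto simp del: of_nat_add of_nat_Suc)
    qed
  qed
qed simp

text \<open>The bound is \<open>132\<close> for the oscillation \<open>4 * pi * \<bar>y\<bar>\<close> of the potential over the base interval and
  \<open>2\<close> for the error of the table.\<close>
lemma table_bound:
  assumes "j < 536" "\<bar>y\<bar> \<le> 0.0010503"
  shows "\<bar>real_of_int ((table1 @ table2) ! j) - 10000 * potential (y + real (Suc j) * \<omega>e)\<bar> \<le> 134"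
proof -
  have b: "\<bar>10 ^ 4 * real_of_int ((table1 @ table2) ! j) - 10 ^ 8 * potential (real (0 + Suc j) * \<omega>e)\<bar> \<le> 6000 + 8 * real (0 + Suc j)"
    by (rule check_table_sound[OF table_checked, of 0, rule_format]) (use assms in \<open>simp_all add: table_length complex_eq_iff[symmetric] Complex_eq\<close>)
  have e: "10 ^ 4 * x - 10 ^ 8 * y = 10 ^ 4 * (x - 10000 * y)" for x y :: real by simp
  have 1: "\<bar>real_of_int ((table1 @ table2) ! j) - 10000 * potential (real (Suc j) * \<omega>e)\<bar> \<le> 2"
    using b[unfolded e abs_mult] assms(1) by simp
  have "\<bar>potential (y + real (Suc j) * \<omega>e) - potential (real (Suc j) * \<omega>e)\<bar> \<le> 2 * \<bar>2 * pi * y\<bar>"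
    using cos_diff_le[of "2 * pi * (y + real (Suc j) * \<omega>e)" "2 * pi * (real (Suc j) * \<omega>e)"]
    unfolding potential_def right_diff_distrib[symmetric] by (simp add: abs_mult algebra_simps)
  also have "\<dots> \<le> 2 * (2 * 3.1415926537 * 0.0010503)"
    unfolding abs_mult using pi_bounds assms(2) by (intro mult_left_mono mult_mono) auto
  finally have "\<bar>potential (y + real (Suc j) * \<omega>e) - potential (real (Suc j) * \<omega>e)\<bar> \<le> 132 / 10000" by simp
  moreover have "\<bar>p - q\<bar> \<le> 132 / 10000 \<Longrightarrow> \<bar>t - 10000 * q\<bar> \<le> 2 \<Longrightarrow> \<bar>t - 10000 * p\<bar> \<le> 134"
    for p q t :: real unfolding abs_le_iff by (elim conjE, intro conjI; linarith)
  ultimately show ?thesis using 1 by blast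
qed

section \<open>Certificates\<close>

text \<open>The sheet and slope of the lower boundary, followed by those of the upper one. Slopes are in units of
  \<open>10 ^ (-4)\<close>.\<close>
type_synonym level = "int \<times> int \<times> int \<times> int"

text \<open>Rounding goes outwards: \<open>134\<close> is the tolerance of the table, and the additional \<open>1\<close> for the lower
  boundary turns the rounded down quotient into an upper bound.\<close>
definition level_step :: "int \<Rightarrow> int \<Rightarrow> level \<Rightarrow> int \<Rightarrow> level" where
  "level_step A B = (\<lambda>(i, r, k, p) v.
     (if r > 0 then i + 1 else i, A - v - 135 - 100000000 div r,
      if p > 0 then k + 1 else k, B - v + 134 - 100000000 div p))"

definition level_ok :: "level \<Rightarrow> bool" where
  "level_ok = (\<lambda>(i, r, k, p). r \<noteq> 0 \<and> p \<noteq> 0 \<and> (k = i \<and> r < p \<or> k = i + 1 \<and> p < r))"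

fun climb_levels :: "int \<Rightarrow> int \<Rightarrow> level \<Rightarrow> int list \<Rightarrow> level option" where
  "climb_levels A B s [] = Some s"
| "climb_levels A B s (v # vs) = (if level_ok s then climb_levels A B (level_step A B s v) vs else None)"

definition return_ok :: "int \<Rightarrow> level \<Rightarrow> level \<Rightarrow> bool" where
  "return_ok g = (\<lambda>(i0, r0, k0, p0) (i, r, k, p).
     (g + i0 < i \<or> g + i0 = i \<and> r0 \<le> r) \<and> (k < g + k0 \<or> k = g + k0 \<and> p \<le> p0))"

text \<open>Over one turn of the circle the cones gain \<open>K\<close> sheets, and \<open>m\<close> more per step. The passage through the
  first tower makes 334 turns in 465 steps, the one through the second 385 turns in 536 steps.\<close>
definition certificate :: "int \<Rightarrow> int \<Rightarrow> int \<Rightarrow> int \<Rightarrow> level \<Rightarrow> bool" where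
  "certificate A B K m s0 = (case climb_levels A B s0 table1 of None \<Rightarrow> False | Some s1 \<Rightarrow>
     return_ok (K * 334 + m * 465) s0 s1 \<and>
     (case climb_levels A B s1 table2 of None \<Rightarrow> False | Some s2 \<Rightarrow>
        return_ok (K * 385 + m * 536) s0 s2))"

lemma climb_levels_Some:
  assumes "climb_levels A B s vs = Some s'"
  shows "s' = foldl (level_step A B) s vs \<and> (\<forall>l<length vs. level_ok (foldl (level_step A B) s (take l vs)))"
  using assms
proof (induction vs arbitrary: s)
  case (Cons v vs)
  then have ok: "level_ok s" and IH: "s' = foldl (level_step A B) (level_step A B s v) vs"
    "\<And>l. l < length vs \<Longrightarrow> level_ok (foldl (level_step A B) (level_step A B s v) (take l vs))"
    by (auto split: if_splits)
  have "level_ok (foldl (level_step A B) s (take l (v # vs)))" if "l < length (v # vs)" for l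
    using ok IH(2) that by (cases l) auto
  then show ?case using IH(1) by simp
qed simp

lemma certificate_sound:
  assumes cert: "certificate A B K m s0"
    and A: "of_int A \<le> 10000 * a" and B: "10000 * b \<le> of_int B"
  shows "cone_family \<omega>e a b (K * \<omega>e + m)"
proof -
  let ?tab = "table1 @ table2"
  define st where "st l = foldl (level_step A B) s0 (take l ?tab)" for l
  obtain s1 s2 where s1: "climb_levels A B s0 table1 = Some s1" "return_ok (K * 334 + m * 465) s0 s1"
    and s2: "climb_levels A B s1 table2 = Some s2" "return_ok (K * 385 + m * 536) s0 s2"
    using cert unfolding certificate_def by (auto split: option.splits)
  note c1 = climb_levels_Some[OF s1(1)] and c2 = climb_levels_Some[OF s2(1)]
  have st0: "st 0 = s0" and st1: "st 465 = s1" and st2: "st 536 = s2"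
    using c1 c2 table_length by (simp_all add: st_def)
  have ok: "level_ok (st l)" if "l < 536" for l
  proof (cases "l < 465")
    case True
    then show ?thesis using c1 table_length by (simp add: st_def)
  next
    case False
    then have "st l = foldl (level_step A B) s1 (take (l - 465) table2)"
      using c1 table_length by (simp add: st_def)
    then show ?thesis using c2 False that table_length by auto
  qed
  have stS: "st (Suc l) = level_step A B (st l) (?tab ! l)" if "l < 536" for l
    using that table_length by (simp add: st_def take_Suc_conv_app_nth del: append_take_drop_id take_append)
  define i where "i l = fst (st l)" for l
  define R where "R l = fst (snd (st l))" for l
  define k where "k l = fst (snd (snd (st l)))" for l
  define P where "P l = snd (snd (snd (st l)))" for l
  have st: "st l = (i l, R l, k l, P l)" for l by (simp add: i_def R_def k_def P_def)
  have okl: "R l \<noteq> 0" "P l \<noteq> 0" "k l = i l \<and> R l < P l \<or> k l = i l + 1 \<and> P l < R l" if "l < 536" for l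
    using ok[OF that] unfolding st level_ok_def by auto
  have step: "i (Suc l) = i l + (if R l > 0 then 1 else 0)" "R (Suc l) = A - ?tab ! l - 135 - 100000000 div R l"
    "k (Suc l) = k l + (if P l > 0 then 1 else 0)" "P (Suc l) = B - ?tab ! l + 134 - 100000000 div P l" if "l < 536" for l
    using stS[OF that] unfolding st level_step_def by simp_all
  have sh: "sheet (real_of_int x / 10000) = (if x > 0 then 1 else 0)" for x
    by (simp add: sheet_def zero_less_divide_iff)
  have "cone_family \<omega>e a b (of_int K * \<omega>e + of_int m)"
  proof (rule tower_cone_family[where D=10000 and ?h1.0=465 and ?h2.0=536 and ?p1.0=334 and ?p2.0=385 and H=536
        and \<eta>="0.0010503" and i=i and R=R and k=k and P=P])
    fix l :: nat assume l: "l < 536"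
    show "R l \<noteq> 0 \<and> P l \<noteq> 0 \<and> lifted_cone (i l) (real_of_int (R l) / 10000) (k l) (real_of_int (P l) / 10000)"
      using okl[OF l] by (auto simp: lifted_cone_def divide_strict_right_mono)
    fix y :: real assume y: "\<bar>y\<bar> \<le> 0.0010503"
    note t = table_bound[OF l y]
    have "real_of_int (R (Suc l)) = A - real_of_int (?tab ! l) - 135 - real_of_int (100000000 div R l)"
      using step(2)[OF l] by simp
    then have "real_of_int (R (Suc l)) \<le> 10000 * a - 10000 * potential (y + real (Suc l) * \<omega>e) - 100000000 / R l"
      using t A div_bounds(2)[of 100000000 "R l"] by (simp add: abs_le_iff)
    then have "R (Suc l) / 10000 \<le> a - potential (y + real (Suc l) * \<omega>e) - 1 / (R l / 10000)"
      using okl(1)[OF l] by (simp add: field_simps)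
    then show "lexle (i (Suc l)) (R (Suc l) / 10000) (i l + sheet (R l / 10000))
       (a - potential (y + real (Suc l) * \<omega>e) - 1 / (R l / 10000))"
      unfolding sh step(1)[OF l] lexle_def by simp
    have "real_of_int (P (Suc l)) = B - real_of_int (?tab ! l) + 134 - real_of_int (100000000 div P l)"
      using step(4)[OF l] by simp
    then have "10000 * b - 10000 * potential (y + real (Suc l) * \<omega>e) - 100000000 / P l \<le> real_of_int (P (Suc l))"
      using t B div_bounds(1)[of 100000000 "P l"] by (simp add: abs_le_iff)
    then have "b - potential (y + real (Suc l) * \<omega>e) - 1 / (P l / 10000) \<le> P (Suc l) / 10000"
      using okl(2)[OF l] by (simp add: field_simps)
    then show "lexle (k l + sheet (P l / 10000)) (b - potential (y + real (Suc l) * \<omega>e) - 1 / (P l / 10000))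
       (k (Suc l)) (P (Suc l) / 10000)"
      unfolding sh step(3)[OF l] lexle_def by simp
  next
    have r1: "return_ok (K * 334 + m * 465) (i 0, R 0, k 0, P 0) (i 465, R 465, k 465, P 465)"
      using s1(2) unfolding st0[symmetric] st1[symmetric] st .
    have r2: "return_ok (K * 385 + m * 536) (i 0, R 0, k 0, P 0) (i 536, R 536, k 536, P 536)"
      using s2(2) unfolding st0[symmetric] st2[symmetric] st .
    show "lexle (K * 334 + m * int 465 + i 0) (R 0 / 10000) (i 465) (R 465 / 10000)"
      "lexle (k 465) (P 465 / 10000) (K * 334 + m * int 465 + k 0) (P 0 / 10000)"
      using r1 by (auto simp: return_ok_def lexle_def divide_right_mono)
    show "lexle (K * 385 + m * int 536 + i 0) (R 0 / 10000) (i 536) (R 536 / 10000)"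
      "lexle (k 536) (P 536 / 10000) (K * 385 + m * int 536 + k 0) (P 0 / 10000)"
      using r2 by (auto simp: return_ok_def lexle_def divide_right_mono)
  qed (use \<omega>e_bounds in auto)
  then show ?thesis by simp
qed

section \<open>The gaps\<close>

text \<open>The starting slopes were found by iterating the two return maps: the lower boundary lies below
  their attracting values at the left end of the interval, the upper one above those at the right
  end.\<close>
lemma certificate_gap_m4: "certificate (- 26573) (- 26444) (- 4) 3 (0, - 22000, 0, 200000)"
  by code_simp

lemma certificate_gap_3: "certificate (- 26043) (- 25664) 3 (- 2) (0, - 230000, 0, - 30000)"
  by code_simp

lemma certificate_gap_m1: "certificate (- 24644) (- 8203) (- 1) 1 (0, - 68000, 0, - 17000)"
  by code_simp

lemma certificate_gap_m5: "certificate (- 6467) (- 6111) (- 5) 4 (0, - 26000, 0, - 13000)"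
  by code_simp

lemma certificate_gap_2: "certificate (- 5705) (- 1166) 2 (- 1) (0, - 13000, 1, - 5000000)"
  by code_simp

lemma certificate_gap_9: "certificate (- 741) (- 583) 9 (- 6) (0, - 5000000, 0, - 50000)"
  by code_simp

lemma certificate_above: "certificate 27449 60000 0 1 (0, 3650, 0, 60000)"
  by code_simp

lemma large_energy:
  assumes "E\<^sup>2 > 32"
  shows "E \<notin> amo_spectrum 2 \<omega> \<theta>"
proof -
  let ?J = "\<lambda>E. jacobi (\<lambda>n. amo_potential 2 \<omega> \<theta> n - E)"
  have "(E\<^sup>2 / 2 - 16) * nsq x \<le> nsq (?J E x)" if x: "x \<in> ell2" for x
  proof -
    have H: "?J 0 x \<in> ell2" "nsq (?J 0 x) \<le> 16 * nsq x"
      using jacobi_ell2[where u="\<lambda>n. amo_potential 2 \<omega> \<theta> n - 0" and B=2, OF _ x] amo_potential_bound[of 2 \<omega> \<theta> _ 0]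
      by simp_all
    have J: "?J E x \<in> ell2" by (rule jacobi_ell2(1)[OF amo_potential_bound x])
    have "(\<lambda>n. complex_of_real E * x n) = (\<lambda>n. ?J 0 x n - ?J E x n)"
      by (rule ext) (simp add: jacobi_def left_diff_distrib)
    then have "\<bar>E\<bar>\<^sup>2 * nsq x = nsq (\<lambda>n. ?J 0 x n - ?J E x n)"
      using ell2_scale(2)[OF x, of "complex_of_real E"] by simp
    also have "\<dots> \<le> 2 * nsq (?J 0 x) + 2 * nsq (?J E x)" by (rule ell2_diff(2)[OF H(1) J])
    finally show ?thesis using H(2) by (simp add: algebra_simps)
  qed
  then have "bounded_below 2 \<omega> \<theta> E (E\<^sup>2 / 2 - 16)" by (simp add: bounded_below_def)
  moreover have "E\<^sup>2 / 2 - 16 > 0" using assms by simp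
  ultimately show ?thesis unfolding not_in_amo_spectrum_iff by blast
qed

lemma cone_family_resolvent:
  assumes "cone_family \<omega> a b N"
  shows "{a<..<b} \<subseteq> - amo_spectrum 2 \<omega> \<theta>"
proof
  fix E assume "E \<in> {a<..<b}"
  then have "\<exists>c>0. bounded_below 2 \<omega> \<theta> E c" using cone_family_bounded_below[OF assms] by simp
  then show "E \<in> - amo_spectrum 2 \<omega> \<theta>" unfolding Compl_iff not_in_amo_spectrum_iff .
qed

text \<open>The cones give the density of states at one energy only, and connectedness carries it to the whole
  component, beyond the interval \<open>(a, b)\<close>.\<close>
lemma gap_of_cone_family:
  assumes cf: "cone_family \<omega> a b N" and ab: "a < b"
    and T: "connected T" "{a<..<b} \<subseteq> T" "T \<subseteq> - amo_spectrum 2 \<omega> \<theta>"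
  shows "\<exists>G. G \<in> amo_gaps 2 \<omega> \<theta> \<and> T \<subseteq> G \<and> open G \<and> (\<forall>E\<in>G. amo_ids_approx 2 \<omega> \<theta> E \<longlonglongrightarrow> N)"
proof -
  obtain E where E: "a < E" "E < b" "amo_ids_approx 2 \<omega> \<theta> E \<longlonglongrightarrow> N"
    using cone_family_ids_exists[OF cf ab] by blast
  then have "E \<in> T" using T by auto
  then obtain G where G: "G \<in> components (- amo_spectrum 2 \<omega> \<theta>)" "T \<subseteq> G"
    using exists_component_superset[of T "- amo_spectrum 2 \<omega> \<theta>"] T by blast
  have "amo_ids_approx 2 \<omega> \<theta> E' \<longlonglongrightarrow> N" if "E' \<in> G" for E'
    using ids_constant_on_gap[OF in_components_connected[OF G(1)] in_components_subset[OF G(1)] _ that E(3)]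
      \<open>E \<in> T\<close> G(2) by blast
  then show ?thesis using G open_components[OF open_resolvent G(1)] unfolding amo_gaps_def by blast
qed

theorem mainTheorem2:
  fixes \<omega> \<theta> :: real
  assumes "\<omega> = exp 1 - 2"
  shows "\<exists>G :: int \<Rightarrow> real set.
    inj_on G {-1, 1, -2, 2, -3, 3, -4, 4, -5, 5, -9, 9} \<and>
    (\<forall>k \<in> {-1, 1, -2, 2, -3, 3, -4, 4, -5, 5, -9, 9}.
        G k \<in> amo_gaps 2 \<omega> \<theta> \<and> bounded (G k) \<and> open (G k) \<and> amo_gap_label 2 \<omega> \<theta> (G k) k) \<and>
    {-2.65721095492 <..< -2.64443590307} \<subseteq> G (-4) \<and>
    {-2.60421010408 <..< -2.56648816182} \<subseteq> G 3 \<and>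
    {-2.46431695653 <..< -0.820368049989} \<subseteq> G (-1) \<and>
    {-0.646689943693 <..< -0.611187586183} \<subseteq> G (-5) \<and>
    {-0.570487209785 <..< -0.116609296737} \<subseteq> G 2 \<and>
    {-0.0740258280376 <..< -0.0583643948664} \<subseteq> G 9 \<and>
    {0.0583643948664 <..< 0.0740258280376} \<subseteq> G (-9) \<and>
    {0.116609296737 <..< 0.570487209785} \<subseteq> G (-2) \<and>
    {0.611187586183 <..< 0.646689943693} \<subseteq> G 5 \<and>
    {0.820368049989 <..< 2.46431695653} \<subseteq> G 1 \<and>
    {2.56648816182 <..< 2.60421010408} \<subseteq> G (-3) \<and>
    {2.64443590307 <..< 2.65721095492} \<subseteq> G 4 \<and>
    (\<exists>A. A \<in> amo_gaps 2 \<omega> \<theta> \<and> \<not> bdd_below A \<and> bdd_above A \<and> amo_gap_label 2 \<omega> \<theta> A 0 \<and>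
       {..< -2.74495255625} \<subseteq> A) \<and>
    (\<exists>B. B \<in> amo_gaps 2 \<omega> \<theta> \<and> \<not> bdd_above B \<and> bdd_below B \<and> amo_gap_label 2 \<omega> \<theta> B 0 \<and>
       {2.74495255625 <..} \<subseteq> B)"
proof -
  have \<omega>: "\<omega> = \<omega>e" using assms by (simp add: \<omega>e_def)
  let ?S = "{-1, 1, -2, 2, -3, 3, -4, 4, -5, 5, -9, 9} :: int set"
  define lo :: "int \<Rightarrow> real" where "lo = (\<lambda>_. 0)(-4 := -2.65721095492, 3 := -2.60421010408,
    -1 := -2.46431695653, -5 := -0.646689943693, 2 := -0.570487209785, 9 := -0.0740258280376,
    -9 := 0.0583643948664, -2 := 0.116609296737, 5 := 0.611187586183, 1 := 0.820368049989,
    -3 := 2.56648816182, 4 := 2.64443590307)"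
  define hi :: "int \<Rightarrow> real" where "hi = (\<lambda>_. 0)(-4 := -2.64443590307, 3 := -2.56648816182,
    -1 := -0.820368049989, -5 := -0.611187586183, 2 := -0.116609296737, 9 := -0.0583643948664,
    -9 := 0.0740258280376, -2 := 0.570487209785, 5 := 0.646689943693, 1 := 2.46431695653,
    -3 := 2.60421010408, 4 := 2.65721095492)"
  \<comment> \<open>Minus the integer part of \<open>k * \<omega>\<close>.\<close>
  define m :: "int \<Rightarrow> int" where "m = (\<lambda>_. 0)(-4 := 3, 3 := -2, -1 := 1, -5 := 4, 2 := -1, 9 := -6,
    -9 := 7, -2 := 2, 5 := -3, 1 := 0, -3 := 3, 4 := -2)"
  define N where "N k = of_int k * \<omega> + of_int (m k)" for k
  have cone: "cone_family \<omega> (lo k) (hi k) (N k) \<and> cone_family \<omega> (lo (- k)) (hi (- k)) (N (- k))"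
    if k: "k \<in> {-4, 3, -1, -5, 2, 9}" for k
  proof -
    have "cone_family \<omega> (lo k) (hi k) (N k)"
      using k certificate_sound[OF certificate_gap_m4] certificate_sound[OF certificate_gap_3]
        certificate_sound[OF certificate_gap_m1] certificate_sound[OF certificate_gap_m5]
        certificate_sound[OF certificate_gap_2] certificate_sound[OF certificate_gap_9]
      by (auto simp: lo_def hi_def N_def m_def \<omega>)
    moreover have "lo (- k) = - hi k" "hi (- k) = - lo k" "N (- k) = 1 - N k"
      using k by (auto simp: lo_def hi_def N_def m_def)
    ultimately show ?thesis using cone_family_reflect by metis
  qed
  have cone: "cone_family \<omega> (lo k) (hi k) (N k)" if "k \<in> ?S" for k
    using cone[of k] cone[of "- k"] that by auto
  have lohi: "lo k < hi k" if "k \<in> ?S" for k using that by (auto simp: lo_def hi_def)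
  have N01: "0 < N k \<and> N k < 1" if "k \<in> ?S" for k
    using that \<omega>e_bounds by (auto simp: N_def m_def \<omega>)
  have N_inj: "k = l" if "k \<in> ?S" "l \<in> ?S" "N k = N l" for k l
    using that \<omega>e_bounds by (auto simp: N_def m_def \<omega>)
  have "\<exists>G. G \<in> amo_gaps 2 \<omega> \<theta> \<and> {lo k<..<hi k} \<subseteq> G \<and> open G \<and>
      (\<forall>E\<in>G. amo_ids_approx 2 \<omega> \<theta> E \<longlonglongrightarrow> N k)" if "k \<in> ?S" for k
    by (rule gap_of_cone_family[OF cone[OF that] lohi[OF that] _ _ cone_family_resolvent[OF cone[OF that]]]) auto
  then obtain G where G: "\<And>k. k \<in> ?S \<Longrightarrow> G k \<in> amo_gaps 2 \<omega> \<theta>" "\<And>k. k \<in> ?S \<Longrightarrow> {lo k<..<hi k} \<subseteq> G k"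
    "\<And>k. k \<in> ?S \<Longrightarrow> open (G k)" "\<And>k E. k \<in> ?S \<Longrightarrow> E \<in> G k \<Longrightarrow> amo_ids_approx 2 \<omega> \<theta> E \<longlonglongrightarrow> N k"
    by metis
  have above: "cone_family \<omega> 2.74495255625 6 1"
    using certificate_sound[OF certificate_above, of "2.74495255625" 6] by (simp add: \<omega>)
  have far: "E \<notin> amo_spectrum 2 \<omega> \<theta>" if "\<bar>E\<bar> \<ge> 5.8" for E
  proof -
    have "(5.8 :: real)\<^sup>2 \<le> \<bar>E\<bar>\<^sup>2" by (rule power_mono[OF that]) simp
    then show ?thesis by (intro large_energy) (simp add: power2_eq_square)
  qed
  have res_above: "{2.74495255625<..} \<subseteq> - amo_spectrum 2 \<omega> \<theta>"
    using cone_family_resolvent[OF above] far by force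
  have "\<exists>G. G \<in> amo_gaps 2 \<omega> \<theta> \<and> {2.74495255625<..} \<subseteq> G \<and> open G \<and>
      (\<forall>E\<in>G. amo_ids_approx 2 \<omega> \<theta> E \<longlonglongrightarrow> 1)"
    by (rule gap_of_cone_family[OF above _ _ _ res_above]) auto
  then obtain B where B: "B \<in> amo_gaps 2 \<omega> \<theta>" "{2.74495255625<..} \<subseteq> B" "\<And>E. E \<in> B \<Longrightarrow> amo_ids_approx 2 \<omega> \<theta> E \<longlonglongrightarrow> 1"
    by blast
  have below: "cone_family \<omega> (- 6) (- 2.74495255625) 0"
    using cone_family_reflect[OF above] by simp
  have res_below: "{..<- 2.74495255625} \<subseteq> - amo_spectrum 2 \<omega> \<theta>"
    using cone_family_resolvent[OF below] far by force
  have "\<exists>G. G \<in> amo_gaps 2 \<omega> \<theta> \<and> {..<- 2.74495255625} \<subseteq> G \<and> open G \<and>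
      (\<forall>E\<in>G. amo_ids_approx 2 \<omega> \<theta> E \<longlonglongrightarrow> 0)"
    by (rule gap_of_cone_family[OF below _ _ _ res_below]) auto
  then obtain A where A: "A \<in> amo_gaps 2 \<omega> \<theta>" "{..<- 2.74495255625} \<subseteq> A" "\<And>E. E \<in> A \<Longrightarrow> amo_ids_approx 2 \<omega> \<theta> E \<longlonglongrightarrow> 0"
    by blast
  \<comment> \<open>The unbounded components carry the densities \<open>0\<close> and \<open>1\<close>, so they differ from each other and from
    all \<open>G k\<close>, which are therefore bounded.\<close>
  have AB: "A \<inter> B = {}"
  proof (rule equals0I)
    fix E assume E: "E \<in> A \<inter> B"
    show False using LIMSEQ_unique[OF A(3) B(3), of E] E by simp
  qed
  have GAB: "G k \<inter> A = {}" "G k \<inter> B = {}" if k: "k \<in> ?S" for k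
  proof -
    show "G k \<inter> A = {}"
    proof (rule equals0I)
      fix E assume E: "E \<in> G k \<inter> A"
      show False using LIMSEQ_unique[OF G(4)[OF k] A(3), of E] E N01[OF k] by simp
    qed
    show "G k \<inter> B = {}"
    proof (rule equals0I)
      fix E assume E: "E \<in> G k \<inter> B"
      show False using LIMSEQ_unique[OF G(4)[OF k] B(3), of E] E N01[OF k] by simp
    qed
  qed
  have A3: "E \<in> A" if "E < - 3" for E by (rule subsetD[OF A(2)]) (use that in simp)
  have B3: "E \<in> B" if "E > 3" for E by (rule subsetD[OF B(2)]) (use that in simp)
  have nA: "\<not> bdd_below A"
  proof
    assume "bdd_below A"
    then obtain c where c: "\<And>x. x \<in> A \<Longrightarrow> c \<le> x" by (auto simp: bdd_below_def)
    have "c \<le> min c (- 3) - 1" by (rule c, rule A3) simp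
    then show False by simp
  qed
  have nB: "\<not> bdd_above B"
  proof
    assume "bdd_above B"
    then obtain c where c: "\<And>x. x \<in> B \<Longrightarrow> x \<le> c" by (auto simp: bdd_above_def)
    have "max c 3 + 1 \<le> c" by (rule c, rule B3) simp
    then show False by simp
  qed
  have bA: "bdd_above A" using AB B3 by (intro bdd_aboveI[of _ 3]) (metis disjoint_iff not_le)
  have bB: "bdd_below B" using AB A3 by (intro bdd_belowI[of _ "- 3"]) (metis disjoint_iff not_le)
  have label0: "amo_gap_label 2 \<omega> \<theta> A 0" "amo_gap_label 2 \<omega> \<theta> B 0"
    using A(1) B(1) nA nB bounded_imp_bdd_below[of A] bounded_imp_bdd_above[of B]
    unfolding amo_gap_label_def by auto
  have bounded: "bounded (G k)" if k: "k \<in> ?S" for k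
  proof (rule bounded_subset[of "{- 3..3}"])
    show "G k \<subseteq> {- 3..3}"
    proof
      fix E assume E: "E \<in> G k"
      then have "E \<notin> A" "E \<notin> B" using GAB[OF k] by blast+
      then show "E \<in> {- 3..3}" using A3[of E] B3[of E] by (simp add: not_less[symmetric]) blast
    qed
  qed simp
  have label: "amo_gap_label 2 \<omega> \<theta> (G k) k" if k: "k \<in> ?S" for k
  proof -
    have "frac (of_int k * \<omega>) = N k"
      using N01[OF k] unfolding frac_unique_iff by (auto simp: N_def)
    then show ?thesis
      using G(1,4)[OF k] bounded[OF k] unfolding amo_gap_label_def amo_ids_def
      by (auto simp: convergent_def limI)
  qed
  have inj: "inj_on G ?S"
  proof (rule inj_onI)
    fix k l assume k: "k \<in> ?S" and l: "l \<in> ?S" and eq: "G k = G l"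
    obtain E where "E \<in> G k" using G(2)[OF k] lohi[OF k] dense by (metis greaterThanLessThan_iff subsetD)
    then show "k = l" using LIMSEQ_unique[OF G(4)[OF k] G(4)[OF l]] eq N_inj[OF k l] by blast
  qed
  have all: "\<forall>k\<in>?S. G k \<in> amo_gaps 2 \<omega> \<theta> \<and> bounded (G k) \<and> open (G k) \<and> amo_gap_label 2 \<omega> \<theta> (G k) k"
    by (intro ballI conjI G(1) G(3) bounded label)
  have sub:
    "{-2.65721095492 <..< -2.64443590307} \<subseteq> G (-4)"
    "{-2.60421010408 <..< -2.56648816182} \<subseteq> G 3"
    "{-2.46431695653 <..< -0.820368049989} \<subseteq> G (-1)"
    "{-0.646689943693 <..< -0.611187586183} \<subseteq> G (-5)"
    "{-0.570487209785 <..< -0.116609296737} \<subseteq> G 2"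
    "{-0.0740258280376 <..< -0.0583643948664} \<subseteq> G 9"
    "{0.0583643948664 <..< 0.0740258280376} \<subseteq> G (-9)"
    "{0.116609296737 <..< 0.570487209785} \<subseteq> G (-2)"
    "{0.611187586183 <..< 0.646689943693} \<subseteq> G 5"
    "{0.820368049989 <..< 2.46431695653} \<subseteq> G 1"
    "{2.56648816182 <..< 2.60421010408} \<subseteq> G (-3)"
    "{2.64443590307 <..< 2.65721095492} \<subseteq> G 4"
    by ((rule subset_trans[OF equalityD1 G(2)]; simp add: lo_def hi_def)+)
  have "\<exists>A. A \<in> amo_gaps 2 \<omega> \<theta> \<and> \<not> bdd_below A \<and> bdd_above A \<and> amo_gap_label 2 \<omega> \<theta> A 0 \<and>
       {..< -2.74495255625} \<subseteq> A"
    by (intro exI[of _ A] conjI A(1) nA bA label0(1) A(2))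
  moreover have "\<exists>B. B \<in> amo_gaps 2 \<omega> \<theta> \<and> \<not> bdd_above B \<and> bdd_below B \<and> amo_gap_label 2 \<omega> \<theta> B 0 \<and>
       {2.74495255625 <..} \<subseteq> B"
    by (intro exI[of _ B] conjI B(1) nB bB label0(2) B(2))
  ultimately show ?thesis
    using inj all sub by (intro exI[of _ G] conjI) assumption+
qed

end
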